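(* For any graph $G$, the following are equivalent: (a) $G$ is a $(2P_3,C_4,C_6,C_7,T_0)$-free graph that contains an induced 3-pentagon and contains no simplicial vertices; (b) $G$ contains exactly one nontrivial anticomponent, and this anticomponent is a 5-basket, a villa, or a mansion; (c) $G$ can be obtained from a 5-basket, a villa, or a mansion by possibly adding universal vertices to it.
   Context: All graphs are finite, simple, nonnull. A graph is $(H_1,\dots,H_m)$-free if it has no induced subgraph isomorphic to any $H_i$. $P_k$, $C_k$ are the path and cycle on $k$ vertices; $2P_3$ is two disjoint copies of $P_3$. $T_0$ is the graph with vertices $p,q,u_0,u_1,u_2,u_3,w_1,w_2,w_3$ and edges $pq,pu_0,pu_2,pu_3,qu_1,qu_2,qu_3,u_0w_1,u_1w_1,u_2w_2,u_3w_3,w_1w_2,w_1w_3,w_2w_3$. For $t\ge3$ the $t$-pentagon is the graph on vertices $a,b_1,\dots,b_t,c_1,\dots,c_t$ where $a$ is adjacent to every $b_i$ and to no $c_i$, $\{b_1,\dots,b_t\}$ is stable, $\{c_1,\dots,c_t\}$ is a clique, and $b_i c_j$ is an edge iff $i=j$; the 3-pentagon is the case $t=3$. A clique (stable set) is a possibly empty set of pairwise adjacent (nonadjacent) vertices. A vertex is simplicial if its neighbours form a clique, universal if adjacent to all other vertices. For disjoint vertex sets $X,Y$, $X$ is complete (anticomplete) to $Y$ if every vertex of $X$ is adjacent (nonadjacent) to every vertex of $Y$. An anticomponent of $G$ is a maximal induced subgraph whose complement is connected; it is nontrivial if it has at least two vertices. "$G$ can be obtained from $Q$ by possibly adding universal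 vertices" means $Q$ is an induced subgraph of $G$ and $V(G)\setminus V(Q)$ is a (possibly empty) clique complete to $V(Q)$. 5-basket: a graph $Q$ whose vertex set partitions into $A,B_1,B_2,B_3,C_1,C_2,C_3,F$ where $A,B_i,C_i$ are nonempty cliques, $F$ is a possibly empty clique, $B_1,B_2,B_3$ are pairwise anticomplete, $C_1,C_2,C_3$ are pairwise complete; there is $i^*\in\{1,2,3\}$ such that $A$ is complete to $(B_1\cup B_2\cup B_3)\setminus B_{i^*}$ and $A$ can be ordered $a_1,\dots,a_t$ with $N(a_t)\cap B_{i^*}\subseteq\cdots\subseteq N(a_1)\cap B_{i^*}=B_{i^*}$; $A$ is anticomplete to $C_1\cup C_2\cup C_3$; each $B_i$ is complete to $C_i$ and anticomplete to $C_j$ for $j\ne i$; and there is $j^*$ such that $F$ is complete to $V(Q)\setminus(B_{j^*}\cup C_{j^*}\cup F)$ and anticomplete to $B_{j^*}\cup C_{j^*}$. $t$-villa ($t\ge3$): a graph $Q$ whose vertex set partitions into nonempty cliques $A,B_1,\dots,B_t,C_1,\dots,C_t$ such that $A$ is complete to $B_1\cup\dots\cup B_t$ and anticomplete to $C_1\cup\dots\cup C_t$; the $B_i$ are pairwise anticomplete; the $C_i$ are pairwise complete; $B_i$ is anticomplete to $C_j$ for $i\ne j$; each $B_i$ can be ordered $b^i_1,\dots,b^i_{r_i}$ with $\emptyset\ne N(b^i_{r_i})\cap C_i\subseteq\dots\subseteq N(b^i_1)\cap C_i=C_i$. Then $(A;B_1,\dots,B_t;C_1,\dots,C_t)$ is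 a $t$-villa partition. A villa is a $t$-villa for some $t\ge3$. $t$-mansion ($t\ge3$): a graph $Q$ whose vertex set partitions into cliques $A,B_1,\dots,B_t,C_1,\dots,C_t,F,X,Y$, with $A,B_i,C_i,F$ nonempty ($X,Y$ possibly empty), such that $Q[A\cup B_1\cup\dots\cup C_t]$ is a $t$-villa with $t$-villa partition $(A;B_1,\dots,B_t;C_1,\dots,C_t)$; there is $j^*$ such that $F$ is complete to $A$, to $\bigcup_{i\ne j^*}B_i$ and to $\bigcup_{i\ne j^*}C_i$ and anticomplete to $B_{j^*}\cup C_{j^*}$, $B_{j^*}$ is complete to $C_{j^*}$, and $X$ is complete to $A\cup B_{j^*}$ and anticomplete to $\bigcup_{i\ne j^*}B_i$ and to $C_1\cup\dots\cup C_t$; $F$ is complete to $X\cup Y$; $X$ is anticomplete to $Y$; $Y$ is complete to $C_1\cup\dots\cup C_t$ and anticomplete to $A\cup B_1\cup\dots\cup B_t$. A mansion is a $t$-mansion for some $t\ge3$. *)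

theory Defs
  imports Main
begin

text \<open>A graph is given by a vertex set V and an adjacency relation E; only the
restriction of E to V matters. Induced subgraphs G[S] are represented by (S, E).\<close>

definition graph :: "'a set \<Rightarrow> ('a \<Rightarrow> 'a \<Rightarrow> bool) \<Rightarrow> bool" where
  "graph V E \<longleftrightarrow> finite V \<and> V \<noteq> {} \<and> (\<forall>x y. E x y \<longrightarrow> E y x) \<and> (\<forall>x. \<not> E x x)"

definition nbr :: "'a set \<Rightarrow> ('a \<Rightarrow> 'a \<Rightarrow> bool) \<Rightarrow> 'a \<Rightarrow> 'a set" where
  "nbr V E v = {x \<in> V. E v x}"

definition clique :: "('a \<Rightarrow> 'a \<Rightarrow> bool) \<Rightarrow> 'a set \<Rightarrow> bool" where
  "clique E X \<longleftrightarrow> (\<forall>x\<in>X. \<forall>y\<in>X. x \<noteq> y \<longrightarrow> E x y)"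

definition stable :: "('a \<Rightarrow> 'a \<Rightarrow> bool) \<Rightarrow> 'a set \<Rightarrow> bool" where
  "stable E X \<longleftrightarrow> (\<forall>x\<in>X. \<forall>y\<in>X. \<not> E x y)"

definition complete :: "('a \<Rightarrow> 'a \<Rightarrow> bool) \<Rightarrow> 'a set \<Rightarrow> 'a set \<Rightarrow> bool" where
  "complete E X Y \<longleftrightarrow> (\<forall>x\<in>X. \<forall>y\<in>Y. E x y)"

definition anticomplete :: "('a \<Rightarrow> 'a \<Rightarrow> bool) \<Rightarrow> 'a set \<Rightarrow> 'a set \<Rightarrow> bool" where
  "anticomplete E X Y \<longleftrightarrow> (\<forall>x\<in>X. \<forall>y\<in>Y. \<not> E x y)"

definition simplicial :: "'a set \<Rightarrow> ('a \<Rightarrow> 'a \<Rightarrow> bool) \<Rightarrow> 'a \<Rightarrow> bool" where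
  "simplicial V E v \<longleftrightarrow> v \<in> V \<and> clique E (nbr V E v)"

definition contains_induced ::
  "'a set \<Rightarrow> ('a \<Rightarrow> 'a \<Rightarrow> bool) \<Rightarrow> 'b set \<Rightarrow> ('b \<Rightarrow> 'b \<Rightarrow> bool) \<Rightarrow> bool" where
  "contains_induced V E HV HE \<longleftrightarrow>
     (\<exists>f. inj_on f HV \<and> f ` HV \<subseteq> V \<and> (\<forall>x\<in>HV. \<forall>y\<in>HV. E (f x) (f y) \<longleftrightarrow> HE x y))"

definition connected_wrt :: "'a set \<Rightarrow> ('a \<Rightarrow> 'a \<Rightarrow> bool) \<Rightarrow> bool" where
  "connected_wrt S R \<longleftrightarrow> S \<noteq> {} \<and>
     (\<forall>x\<in>S. \<forall>y\<in>S. (\<lambda>a b. a \<in> S \<and> b \<in> S \<and> R a b)\<^sup>*\<^sup>* x y)"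

definition anticonnected :: "'a set \<Rightarrow> ('a \<Rightarrow> 'a \<Rightarrow> bool) \<Rightarrow> bool" where
  "anticonnected S E \<longleftrightarrow> connected_wrt S (\<lambda>a b. a \<noteq> b \<and> \<not> E a b)"

definition anticomponent :: "'a set \<Rightarrow> ('a \<Rightarrow> 'a \<Rightarrow> bool) \<Rightarrow> 'a set \<Rightarrow> bool" where
  "anticomponent V E S \<longleftrightarrow> S \<subseteq> V \<and> anticonnected S E \<and>
     (\<forall>T. S \<subseteq> T \<and> T \<subseteq> V \<and> anticonnected T E \<longrightarrow> T = S)"

definition nontrivial_anticomponent :: "'a set \<Rightarrow> ('a \<Rightarrow> 'a \<Rightarrow> bool) \<Rightarrow> 'a set \<Rightarrow> bool" where
  "nontrivial_anticomponent V E S \<longleftrightarrow> anticomponent V E S \<and> card S \<ge> 2"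

definition edges_rel :: "(nat \<times> nat) list \<Rightarrow> nat \<Rightarrow> nat \<Rightarrow> bool" where
  "edges_rel es x y \<longleftrightarrow> (x, y) \<in> set es \<or> (y, x) \<in> set es"

definition twoP3_V :: "nat set" where "twoP3_V = {0..<6}"
definition twoP3_E :: "nat \<Rightarrow> nat \<Rightarrow> bool" where
  "twoP3_E = edges_rel [(0,1),(1,2),(3,4),(4,5)]"

definition cycle_V :: "nat \<Rightarrow> nat set" where "cycle_V k = {0..<k}"
definition cycle_E :: "nat \<Rightarrow> nat \<Rightarrow> nat \<Rightarrow> bool" where
  "cycle_E k x y \<longleftrightarrow> x < k \<and> y < k \<and> x \<noteq> y \<and> (y = (x + 1) mod k \<or> x = (y + 1) mod k)"

text \<open>T0: p=0, q=1, u0=2, u1=3, u2=4, u3=5, w1=6, w2=7, w3=8.\<close>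
definition T0_V :: "nat set" where "T0_V = {0..<9}"
definition T0_E :: "nat \<Rightarrow> nat \<Rightarrow> bool" where
  "T0_E = edges_rel [(0,1),(0,2),(0,4),(0,5),(1,3),(1,4),(1,5),
                      (2,6),(3,6),(4,7),(5,8),(6,7),(6,8),(7,8)]"

text \<open>t-pentagon: a=0, b_i=i, c_i=t+i (1 \<le> i \<le> t).\<close>
definition pentagon_V :: "nat \<Rightarrow> nat set" where "pentagon_V t = {0..2*t}"
definition pentagon_E0 :: "nat \<Rightarrow> nat \<Rightarrow> nat \<Rightarrow> bool" where
  "pentagon_E0 t x y \<longleftrightarrow>
     (x = 0 \<and> y \<in> {1..t}) \<or>
     (x \<in> {t+1..2*t} \<and> y \<in> {t+1..2*t} \<and> x \<noteq> y) \<or>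
     (x \<in> {1..t} \<and> y = x + t)"
definition pentagon_E :: "nat \<Rightarrow> nat \<Rightarrow> nat \<Rightarrow> bool" where
  "pentagon_E t x y \<longleftrightarrow> pentagon_E0 t x y \<or> pentagon_E0 t y x"

definition is_partition :: "'a set \<Rightarrow> 'a set list \<Rightarrow> bool" where
  "is_partition V Ps \<longleftrightarrow> \<Union>(set Ps) = V \<and>
     (\<forall>i<length Ps. \<forall>j<length Ps. i \<noteq> j \<longrightarrow> Ps ! i \<inter> Ps ! j = {})"

definition is_5basket :: "'a set \<Rightarrow> ('a \<Rightarrow> 'a \<Rightarrow> bool) \<Rightarrow> bool" where
  "is_5basket V E \<longleftrightarrow>
   (\<exists>A B C F istar jstar.
      is_partition V ([A, B 1, B 2, B 3, C 1, C 2, C 3, F]) \<and>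
      A \<noteq> {} \<and> clique E A \<and>
      (\<forall>i\<in>{1,2,3::nat}. B i \<noteq> {} \<and> clique E (B i) \<and> C i \<noteq> {} \<and> clique E (C i)) \<and>
      clique E F \<and>
      (\<forall>i\<in>{1,2,3::nat}. \<forall>j\<in>{1,2,3}. i \<noteq> j \<longrightarrow> anticomplete E (B i) (B j)) \<and>
      (\<forall>i\<in>{1,2,3::nat}. \<forall>j\<in>{1,2,3}. i \<noteq> j \<longrightarrow> complete E (C i) (C j)) \<and>
      istar \<in> {1,2,3} \<and>
      complete E A ((B 1 \<union> B 2 \<union> B 3) - B istar) \<and>
      (\<exists>as. distinct as \<and> set as = A \<and>
          (\<forall>k. Suc k < length as \<longrightarrow>
              nbr V E (as ! Suc k) \<inter> B istar \<subseteq> nbr V E (as ! k) \<inter> B istar) \<and>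
          nbr V E (as ! 0) \<inter> B istar = B istar) \<and>
      anticomplete E A (C 1 \<union> C 2 \<union> C 3) \<and>
      (\<forall>i\<in>{1,2,3::nat}. complete E (B i) (C i)) \<and>
      (\<forall>i\<in>{1,2,3::nat}. \<forall>j\<in>{1,2,3}. i \<noteq> j \<longrightarrow> anticomplete E (B i) (C j)) \<and>
      jstar \<in> {1,2,3} \<and>
      complete E F (V - (B jstar \<union> C jstar \<union> F)) \<and>
      anticomplete E F (B jstar \<union> C jstar))"

definition villa_partition ::
  "'a set \<Rightarrow> ('a \<Rightarrow> 'a \<Rightarrow> bool) \<Rightarrow> nat \<Rightarrow> 'a set \<Rightarrow> (nat \<Rightarrow> 'a set) \<Rightarrow> (nat \<Rightarrow> 'a set) \<Rightarrow> bool" where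
  "villa_partition V E t A B C \<longleftrightarrow>
     t \<ge> 3 \<and>
     is_partition V ([A] @ map B [1..<t+1] @ map C [1..<t+1]) \<and>
     A \<noteq> {} \<and> clique E A \<and>
     (\<forall>i\<in>{1..t}. B i \<noteq> {} \<and> clique E (B i) \<and> C i \<noteq> {} \<and> clique E (C i)) \<and>
     complete E A (\<Union>i\<in>{1..t}. B i) \<and>
     anticomplete E A (\<Union>i\<in>{1..t}. C i) \<and>
     (\<forall>i\<in>{1..t}. \<forall>j\<in>{1..t}. i \<noteq> j \<longrightarrow> anticomplete E (B i) (B j)) \<and>
     (\<forall>i\<in>{1..t}. \<forall>j\<in>{1..t}. i \<noteq> j \<longrightarrow> complete E (C i) (C j)) \<and>
     (\<forall>i\<in>{1..t}. \<forall>j\<in>{1..t}. i \<noteq> j \<longrightarrow> anticomplete E (B i) (C j)) \<and>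
     (\<forall>i\<in>{1..t}. \<exists>bs. distinct bs \<and> set bs = B i \<and>
          nbr V E (last bs) \<inter> C i \<noteq> {} \<and>
          (\<forall>k. Suc k < length bs \<longrightarrow>
              nbr V E (bs ! Suc k) \<inter> C i \<subseteq> nbr V E (bs ! k) \<inter> C i) \<and>
          nbr V E (bs ! 0) \<inter> C i = C i)"

definition is_villa :: "'a set \<Rightarrow> ('a \<Rightarrow> 'a \<Rightarrow> bool) \<Rightarrow> bool" where
  "is_villa V E \<longleftrightarrow> (\<exists>t A B C. villa_partition V E t A B C)"

definition is_mansion :: "'a set \<Rightarrow> ('a \<Rightarrow> 'a \<Rightarrow> bool) \<Rightarrow> bool" where
  "is_mansion V E \<longleftrightarrow>
   (\<exists>t A B C F X Y jstar.
      t \<ge> 3 \<and>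
      is_partition V ([A] @ map B [1..<t+1] @ map C [1..<t+1] @ [F, X, Y]) \<and>
      clique E F \<and> clique E X \<and> clique E Y \<and> F \<noteq> {} \<and>
      villa_partition (A \<union> (\<Union>i\<in>{1..t}. B i) \<union> (\<Union>i\<in>{1..t}. C i)) E t A B C \<and>
      jstar \<in> {1..t} \<and>
      complete E F A \<and>
      complete E F (\<Union>i\<in>{1..t} - {jstar}. B i) \<and>
      complete E F (\<Union>i\<in>{1..t} - {jstar}. C i) \<and>
      anticomplete E F (B jstar \<union> C jstar) \<and>
      complete E (B jstar) (C jstar) \<and>
      complete E X (A \<union> B jstar) \<and>
      anticomplete E X (\<Union>i\<in>{1..t} - {jstar}. B i) \<and>
      anticomplete E X (\<Union>i\<in>{1..t}. C i) \<and>
      complete E F (X \<union> Y) \<and>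
      anticomplete E X Y \<and>
      complete E Y (\<Union>i\<in>{1..t}. C i) \<and>
      anticomplete E Y (A \<union> (\<Union>i\<in>{1..t}. B i)))"

definition basket_villa_or_mansion :: "'a set \<Rightarrow> ('a \<Rightarrow> 'a \<Rightarrow> bool) \<Rightarrow> bool" where
  "basket_villa_or_mansion V E \<longleftrightarrow> is_5basket V E \<or> is_villa V E \<or> is_mansion V E"

end

theory Submission
  imports Defs
begin

text \<open>Everything is phrased with the reflexive closure R of adjacency. None of the forbidden graphs has two
adjacent vertices with the same closed neighbourhood, so an R-pattern of a forbidden graph forces its
vertices to be distinct, and the vertices of a reference pentagon need no separate treatment.

For (a) to (c), fix an induced t-pentagon with t maximal and classify every vertex by its neighbours in it.
The excluded induced subgraphs determine the adjacencies between the classes almost completely, but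
some vertices may still hang on to the rest by a clique. Such vertices are removed by one principle: if a
nonempty clique K has all its outside neighbours in a clique, then, since there is no induced 4-cycle,
a vertex of K with the fewest outside neighbours is simplicial. What survives is a basket, a villa or a
mansion together with universal vertices; these three cases are treated at once as a \<open>blueprint\<close>.

For (c) to (a), label the vertices of a blueprint by top (A and X), middle (the B's) and base (the C's and
Y). The labels that an induced path on four vertices can carry show that the holes are 5-cycles labelled
top, middle, base, base, middle, and everything else follows from this.\<close>

section \<open>Graphs with a maximal pentagon\<close>

text \<open>Call \<open>B i\<close> and \<open>C i\<close> the i-th arm. Which of the three graphs
  arises depends first on whether top and middle are completely joined. A missing edge between them
  forces exactly three arms, complete middle-base adjacency in each arm, and empty \<open>X\<close>
  and \<open>Y\<close>: a basket. Otherwise the middle-base adjacency is only nested and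
  \<open>F\<close> decides. Without \<open>F\<close>, both \<open>X\<close> and \<open>Y\<close>
  fall to the removal principle and a villa remains. With \<open>F\<close>, the arm that it misses
  is complete, and \<open>X\<close> and \<open>Y\<close> may survive: \<open>F\<close> is adjacent
  to them but not to that arm, so their outside neighbours need not form a clique. This is a
  mansion.

  For the converse, vertices of \<open>F\<close> and \<open>U\<close> have no label. Their
  non-neighbours form a clique, whereas every vertex of 2P3, C6, C7 and T0 has two nonadjacent
  non-neighbours. These graphs can thus occur only on labelled vertices, and the 4-cycle alone needs
  an extra argument about \<open>F\<close>.\<close>

lemma ex_third:
  assumes "card S \<ge> 3"
  shows "\<exists>k\<in>S. k \<noteq> i \<and> k \<noteq> l"
proof (rule ccontr)
  assume "\<not> ?thesis"
  then have "card S \<le> card {i, l}" using card_mono[of "{i, l}" S] by blast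
  also have "\<dots> \<le> 2" by (simp add: card_insert_if)
  finally show False using assms by simp
qed

text \<open>\<open>R x x\<close> doubles as membership in the vertex set, so reflexivity is demanded
  only of points that have a neighbour.\<close>

locale refl_graph =
  fixes R :: "'a \<Rightarrow> 'a \<Rightarrow> bool"
  assumes sym: "R x y \<Longrightarrow> R y x"
    and refl: "R x y \<Longrightarrow> R x x"

text \<open>\<open>C4\<close> is a disjunction because it is mostly applied to a 4-cycle with one
  diagonal known to be absent, where it yields the other.\<close>

locale forb_graph = refl_graph +
  assumes C4: "\<lbrakk>R x y; R y z; R z w; R w x\<rbrakk> \<Longrightarrow> R x z \<or> R y w"
    and C6: "\<lbrakk>R u v; R v w; R w x; R x y; R y z; R z u;
       \<not> R u w; \<not> R u x; \<not> R u y; \<not> R v x; \<not> R v y; \<not> R v z;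
       \<not> R w y; \<not> R w z; \<not> R x z\<rbrakk> \<Longrightarrow> False"
    and C7: "\<lbrakk>R s u; R u v; R v w; R w x; R x y; R y z; R z s;
       \<not> R s v; \<not> R s w; \<not> R s x; \<not> R s y;
       \<not> R u w; \<not> R u x; \<not> R u y; \<not> R u z; \<not> R v x; \<not> R v y; \<not> R v z;
       \<not> R w y; \<not> R w z; \<not> R x z\<rbrakk> \<Longrightarrow> False"
    and P2: "\<lbrakk>R x y; R y z; \<not> R x z; R u v; R v w; \<not> R u w;
       \<not> R x u; \<not> R x v; \<not> R x w; \<not> R y u; \<not> R y v; \<not> R y w;
       \<not> R z u; \<not> R z v; \<not> R z w\<rbrakk> \<Longrightarrow> False"
    and T0: "\<lbrakk>R p q; R p u0; R p u2; R p u3; R q u1; R q u2; R q u3;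
       R u0 w1; R u1 w1; R u2 w2; R u3 w3; R w1 w2; R w1 w3; R w2 w3;
       \<not> R p u1; \<not> R p w1; \<not> R p w2; \<not> R p w3;
       \<not> R q u0; \<not> R q w1; \<not> R q w2; \<not> R q w3;
       \<not> R u0 u1; \<not> R u0 u2; \<not> R u0 u3; \<not> R u0 w2; \<not> R u0 w3;
       \<not> R u1 u2; \<not> R u1 u3; \<not> R u1 w2; \<not> R u1 w3;
       \<not> R u2 u3; \<not> R u2 w1; \<not> R u2 w3; \<not> R u3 w1; \<not> R u3 w2\<rbrakk> \<Longrightarrow> False"

text \<open>The clause \<open>maximal\<close> is the maximality of the number of arms: such
  \<open>s\<close> and \<open>y\<close> would be the \<open>b\<close> and the \<open>c\<close> of
  one more arm.\<close>

locale pentagon_graph = forb_graph +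
  fixes a :: 'a and b c :: "nat \<Rightarrow> 'a" and I :: "nat set"
  assumes finI: "finite I" and cardI: "card I \<ge> 3"
    and ab: "i \<in> I \<Longrightarrow> R a (b i)"
    and ac: "i \<in> I \<Longrightarrow> \<not> R a (c i)"
    and bb: "\<lbrakk>i \<in> I; j \<in> I; i \<noteq> j\<rbrakk> \<Longrightarrow> \<not> R (b i) (b j)"
    and cc: "\<lbrakk>i \<in> I; j \<in> I\<rbrakk> \<Longrightarrow> R (c i) (c j)"
    and bc: "\<lbrakk>i \<in> I; j \<in> I\<rbrakk> \<Longrightarrow> R (b i) (c j) \<longleftrightarrow> i = j"
    and maximal: "\<lbrakk>R a s; R s y; \<And>i. i \<in> I \<Longrightarrow> \<not> R s (b i); \<And>i. i \<in> I \<Longrightarrow> \<not> R s (c i);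
       \<And>i. i \<in> I \<Longrightarrow> R y (c i); \<And>i. i \<in> I \<Longrightarrow> \<not> R y (b i); \<not> R a y\<rbrakk> \<Longrightarrow> False"
    and finV: "finite {v. R v v}"
    and nonsimplicial: "R v v \<Longrightarrow> \<exists>x y. R v x \<and> R v y \<and> \<not> R x y"
begin

lemma ex_index: "\<exists>k\<in>I. k \<noteq> i \<and> k \<noteq> j"
  using ex_third[OF cardI] .

lemma ex_two_indices: "\<exists>j\<in>I. \<exists>k\<in>I. j \<noteq> i \<and> k \<noteq> i \<and> j \<noteq> k"
  using ex_index by metis

lemmas pent = ab ac bb cc bc

lemma simplicial_clique:
  assumes "K \<noteq> {}" "\<And>v. v \<in> K \<Longrightarrow> R v v" "\<And>x y. x \<in> K \<Longrightarrow> y \<in> K \<Longrightarrow> R x y"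
    and N: "\<And>x y. x \<in> N \<Longrightarrow> y \<in> N \<Longrightarrow> R x y"
    and nb: "\<And>v x. v \<in> K \<Longrightarrow> R v x \<Longrightarrow> x \<in> K \<or> x \<in> N"
  shows False
proof -
  define f where "f v = card {x\<in>N. R v x}" for v
  obtain v where v: "v \<in> K" "\<And>u. u \<in> K \<Longrightarrow> f v \<le> f u"
    using ex_has_least_nat[of "\<lambda>v. v \<in> K" _ f] assms(1) by blast
  \<comment> \<open>Minimality makes the trace of \<open>v\<close> on \<open>N\<close> the smallest
    by inclusion. If \<open>v\<close> sees a \<open>y\<close> that \<open>x\<close> misses, then by
    counting \<open>x\<close> sees a \<open>z\<close> that \<open>v\<close> misses, and
    \<open>v\<close>, \<open>x\<close>, \<open>z\<close>, \<open>y\<close> is an induced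
    4-cycle.\<close>
  have low: "\<not> (R v y \<and> \<not> R x y)" if "x \<in> K" "y \<in> N" for x y
  proof
    assume h: "R v y \<and> \<not> R x y"
    have "\<exists>z\<in>N. R x z \<and> \<not> R v z"
    proof (rule ccontr)
      assume "\<not> ?thesis"
      then have "{z\<in>N. R x z} \<subset> {z\<in>N. R v z}" using h that by blast
      moreover have "finite {z\<in>N. R v z}"
        by (rule finite_subset[OF _ finV]) (auto intro: N)
      ultimately have "f x < f v" unfolding f_def by (rule psubset_card_mono[rotated])
      then show False using v(2)[OF that(1)] by simp
    qed
    then obtain z where "z \<in> N" "R x z" "\<not> R v z" by blast
    then show False using C4[of v x z y] h that assms(3) v(1) N sym by blast
  qed
  obtain x y where xy: "R v x" "R v y" "\<not> R x y" using nonsimplicial assms(2) v(1) by blast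
  have "\<not> (x \<in> K \<and> y \<in> K)" "\<not> (x \<in> N \<and> y \<in> N)" using xy assms(3) N by blast+
  moreover have "\<not> (x \<in> K \<and> y \<in> N)" "\<not> (y \<in> K \<and> x \<in> N)" using xy low sym by blast+
  ultimately show False using nb[OF v(1)] xy by blast
qed

text \<open>The vertices a, b i and c i themselves fall into A, B i and D. The classes S1 and S3 turn out to be
empty.\<close>

definition A where
  "A = {v. R v a \<and> (\<forall>i\<in>I. \<not> R v (c i)) \<and> (\<exists>i\<in>I. \<exists>j\<in>I. i \<noteq> j \<and> R v (b i) \<and> R v (b j))}"
text \<open>Adjacency to \<open>a\<close> and to \<open>c i\<close> is left open; it is settled only
  after the other classes are understood.\<close>

definition B where
  "B i = {v. (\<forall>k\<in>I. (R v (b k) \<longleftrightarrow> k = i) \<and> (R v (c k) \<longrightarrow> k = i))}"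
definition D where
  "D = {v. \<not> R v a \<and> (\<forall>k\<in>I. R v (c k))}"
definition F where
  "F j = {v. R v a \<and> (\<forall>k\<in>I. (R v (b k) \<longleftrightarrow> k \<noteq> j) \<and> (R v (c k) \<longleftrightarrow> k \<noteq> j))}"
definition U where
  "U = {v. R v a \<and> (\<forall>k\<in>I. R v (b k) \<and> R v (c k))}"
text \<open>Only this class has to ask for \<open>R v v\<close>; in the others, for indices in
  \<open>I\<close>, some adjacency implies it.\<close>

definition S1 where
  "S1 = {v. R v v \<and> (\<forall>k\<in>I. \<not> R v (b k) \<and> \<not> R v (c k))}"
definition S3 where
  "S3 = {v. \<not> R v a \<and> (\<forall>k\<in>I. \<not> R v (b k)) \<and> (\<exists>i\<in>I. R v (c i)) \<and> (\<exists>i\<in>I. \<not> R v (c i))}"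

lemmas cls = A_def B_def D_def F_def U_def S1_def S3_def

section \<open>Traces of a vertex on the pentagon\<close>

lemma a_c_imp_b: "\<lbrakk>R v a; R v (c i); i \<in> I\<rbrakk> \<Longrightarrow> R v (b i)"
  using C4[of v a "b i" "c i"] pent sym by blast

lemma b_c_imp_c: "\<lbrakk>R v (b i); R v (c j); i \<in> I; j \<in> I; i \<noteq> j\<rbrakk> \<Longrightarrow> R v (c i)"
  using C4[of v "b i" "c i" "c j"] pent sym by blast

lemma b_b_imp_a: "\<lbrakk>R v (b i); R v (b j); i \<in> I; j \<in> I; i \<noteq> j\<rbrakk> \<Longrightarrow> R v a"
  using C4[of v "b i" a "b j"] pent sym by blast

text \<open>The paths \<open>b i\<close>, \<open>v\<close>, \<open>b j\<close> and
  \<open>b k\<close>, \<open>c k\<close>, \<open>c l\<close> would form an induced 2P3.\<close>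

lemma two_b_misses_one:
  assumes "R v (b i)" "R v (b j)" "i \<in> I" "j \<in> I" "i \<noteq> j"
    "k \<in> I" "\<not> R v (b k)" "\<not> R v (c k)" "l \<in> I" "l \<noteq> i" "l \<noteq> j" "l \<noteq> k" "\<not> R v (c l)"
  shows False
  using P2[of "b i" v "b j" "b k" "c k" "c l"] assms pent sym by metis

text \<open>A neighbour of \<open>a\<close> that sees some \<open>c j\<close> sees
  \<open>b k\<close> and \<open>c k\<close> together or not at all, and if it sees two arms it
  misses at most one. A non-neighbour of \<open>a\<close> sees at most one \<open>b i\<close>, and
  if it also sees a \<open>c\<close> of another arm, a 6-cycle forces it to see all of them.\<close>

lemma classify:
  assumes "R v v"
  shows "v \<in> A \<or> (\<exists>i\<in>I. v \<in> B i) \<or> v \<in> D \<or> (\<exists>j\<in>I. v \<in> F j) \<or> v \<in> U \<or> v \<in> S1 \<or> v \<in> S3"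
proof (cases "R v a")
  case True
  show ?thesis
  proof (cases "\<exists>j\<in>I. R v (c j)")
    case False
    then show ?thesis using True assms unfolding cls by simp metis
  next
    case c: True
    then obtain j where j: "j \<in> I" "R v (c j)" by blast
    have eq: "R v (b k) \<longleftrightarrow> R v (c k)" if "k \<in> I" for k
      using j that True a_c_imp_b b_c_imp_c by metis
    have one: "k = l" if "k \<in> I" "l \<in> I" "\<not> R v (b k)" "\<not> R v (b l)" "i \<in> I" "R v (b i)" "i \<noteq> j" for k l i
      using two_b_misses_one[of v i j k l] eq that j by metis
    show ?thesis
    proof (cases "\<exists>i\<in>I. i \<noteq> j \<and> R v (b i)")
      case False
      then have "v \<in> B j" using eq j unfolding cls by auto
      then show ?thesis using j by blast
    next
      case True
      then obtain i where i: "i \<in> I" "i \<noteq> j" "R v (b i)" by blast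
      show ?thesis
      proof (cases "\<exists>k\<in>I. \<not> R v (b k)")
        case True
        then obtain k where k: "k \<in> I" "\<not> R v (b k)" by blast
        then have "R v (b l) \<longleftrightarrow> l \<noteq> k" if "l \<in> I" for l using one[OF k(1) that k(2) _ i(1) i(3) i(2)] by metis
        then have "v \<in> F k" using eq \<open>R v a\<close> unfolding F_def by blast
        then show ?thesis using k by blast
      next
        case False
        then have "v \<in> U" using eq \<open>R v a\<close> unfolding cls by auto
        then show ?thesis by blast
      qed
    qed
  qed
next
  case False
  show ?thesis
  proof (cases "\<exists>i\<in>I. R v (b i)")
    case b: True
    then obtain i where i: "i \<in> I" "R v (b i)" by blast
    have bi: "R v (b k) \<longleftrightarrow> k = i" if "k \<in> I" for k using b_b_imp_a i that False by blast
    show ?thesis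
    proof (cases "\<exists>j\<in>I. j \<noteq> i \<and> R v (c j)")
      case True
      then obtain j where j: "j \<in> I" "j \<noteq> i" "R v (c j)" by blast
      have "R v (c k)" if k: "k \<in> I" for k
      proof (rule ccontr)
        assume n: "\<not> R v (c k)"
        then have "k \<noteq> i" "k \<noteq> j" using b_c_imp_c i j by blast+
        then show False using C6[of v "b i" a "b k" "c k" "c j"] pent sym False i j k n bi by metis
      qed
      then show ?thesis using False unfolding cls by blast
    next
      case False
      then have "v \<in> B i" using bi unfolding cls by auto
      then show ?thesis using i by blast
    qed
  next
    case b: False
    then show ?thesis using False assms unfolding cls by simp blast
  qed
qed

section \<open>Adjacencies among the classes\<close>

lemma A_missing_b_unique:
  assumes "v \<in> A" "i \<in> I" "\<not> R v (b i)" "k \<in> I" "k \<noteq> i"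
  shows "R v (b k)"
  using assms two_b_misses_one[of v _ _ i k] unfolding A_def mem_Collect_eq by metis

lemma A_ex_other_b:
  assumes "v \<in> A"
  shows "\<exists>k\<in>I. k \<noteq> i \<and> R v (b k)"
  using assms unfolding A_def mem_Collect_eq by metis

text \<open>The arms \<open>k\<close> and \<open>i\<close> give an induced path from
  \<open>v\<close> to \<open>w\<close>. The edge between \<open>v\<close> and \<open>w\<close>
  closes it to a 6-cycle; if that edge is absent, a third \<open>b l\<close> closes it to a 7-cycle.
  This is the only use of \<open>C7\<close>.\<close>

lemma A_same_missing:
  assumes v: "v \<in> A" "i \<in> I" "\<not> R v (b i)" and w: "w \<in> A" "k \<in> I" "\<not> R w (b k)"
  shows "i = k"
proof (rule ccontr)
  assume ne: "i \<noteq> k"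
  obtain l where l: "l \<in> I" "l \<noteq> i" "l \<noteq> k" using ex_index by blast
  have f: "R v (b k)" "R v (b l)" "R w (b i)" "R w (b l)"
    using A_missing_b_unique[OF v] A_missing_b_unique[OF w] v(2) w(2) ne l by blast+
  have g: "\<not> R v (c m)" "\<not> R w (c m)" if "m \<in> I" for m using v w that unfolding A_def by auto
  show False
  proof (cases "R v w")
    case True
    show ?thesis
      using C6[of v "b k" "c k" "c i" "b i" w] True f g v w ne pent sym by metis
  next
    case False
    show ?thesis
      using C7[of v "b k" "c k" "c i" "b i" w "b l"] False f g v w ne l pent sym by metis
  qed
qed

text \<open>Both vertices miss at most one and the same \<open>b\<close>, so they have two
  nonadjacent common neighbours.\<close>

lemma A_clique:
  assumes "v \<in> A" "w \<in> A"
  shows "R v w"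
proof -
  obtain i where i: "\<And>k. k \<in> I \<Longrightarrow> k \<noteq> i \<Longrightarrow> R v (b k) \<and> R w (b k)"
    using A_same_missing[of v _ w] A_missing_b_unique[of v] A_missing_b_unique[of w] assms by metis
  obtain j k where "j \<in> I" "k \<in> I" "j \<noteq> i" "k \<noteq> i" "j \<noteq> k" using ex_two_indices by metis
  then show ?thesis using C4[of v "b j" w "b k"] i sym bb by metis
qed

lemma B_clique:
  assumes "v \<in> B i" "w \<in> B i" "i \<in> I"
  shows "R v w"
proof -
  obtain j k where "j \<in> I" "k \<in> I" "j \<noteq> i" "k \<noteq> i" "j \<noteq> k" using ex_two_indices by metis
  then show ?thesis using P2[of v "b i" w "b j" "c j" "c k"] assms pent sym unfolding B_def mem_Collect_eq by metis
qed

lemma B_S1: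
  assumes "v \<in> B i" "s \<in> S1" "i \<in> I"
  shows "\<not> R s v"
proof -
  obtain j k where "j \<in> I" "k \<in> I" "j \<noteq> i" "k \<noteq> i" "j \<noteq> k" using ex_two_indices by metis
  then show ?thesis using P2[of s v "b i" "b j" "c j" "c k"] assms pent sym unfolding B_def S1_def mem_Collect_eq by metis
qed

lemma B_anticomplete_aux:
  assumes "v \<in> B i" "w \<in> B j" "i \<in> I" "j \<in> I" "i \<noteq> j" "R v w"
  shows "R v (c i)"
proof -
  obtain k where "k \<in> I" "k \<noteq> i" "k \<noteq> j" using ex_index by metis
  then show ?thesis using P2[of v w "b j" "b k" "c k" "c i"] assms pent sym unfolding B_def mem_Collect_eq by metis
qed

lemma B_anticomplete:
  assumes "v \<in> B i" "w \<in> B j" "i \<in> I" "j \<in> I" "i \<noteq> j"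
  shows "\<not> R v w"
proof
  assume h: "R v w"
  have "R v (c i)" "R w (c j)" using B_anticomplete_aux assms h sym by metis+
  then show False using C4[of v w "c j" "c i"] h assms cc sym unfolding B_def mem_Collect_eq by metis
qed

lemma D_b_unique:
  assumes "v \<in> D" "i \<in> I" "j \<in> I" "R v (b i)" "R v (b j)"
  shows "i = j"
  using b_b_imp_a assms unfolding D_def mem_Collect_eq by metis

lemma D_b_at_most_one:
  assumes "v \<in> D"
  shows "\<exists>i\<in>I. \<forall>j\<in>I. j \<noteq> i \<longrightarrow> \<not> R v (b j)"
  using D_b_unique[OF assms] ex_index by metis

text \<open>If the two vertices see \<open>b\<close>s of at most one arm, two other
  \<open>b\<close>s joined by \<open>a\<close> give an anticomplete path. Otherwise they see
  different \<open>b\<close>s, and these close a 6-cycle through \<open>a\<close> and a third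
  \<open>c k\<close>.\<close>

lemma D_clique:
  assumes "v \<in> D" "w \<in> D"
  shows "R v w"
proof (cases "\<exists>i\<in>I. \<forall>j\<in>I. j \<noteq> i \<longrightarrow> \<not> R v (b j) \<and> \<not> R w (b j)")
  case True
  then obtain i where i: "i \<in> I" "\<And>j. j \<in> I \<Longrightarrow> j \<noteq> i \<Longrightarrow> \<not> R v (b j) \<and> \<not> R w (b j)" by blast
  obtain j k where "j \<in> I" "k \<in> I" "j \<noteq> i" "k \<noteq> i" "j \<noteq> k" using ex_two_indices by metis
  then show ?thesis using P2[of v "c i" w "b j" a "b k"] i assms pent sym unfolding D_def mem_Collect_eq by metis
next
  case False
  then obtain i j where ij: "i \<in> I" "j \<in> I" "i \<noteq> j" "R v (b i)" "R w (b j)"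
    using D_b_at_most_one assms by metis
  obtain k where k: "k \<in> I" "k \<noteq> i" "k \<noteq> j" using ex_index by metis
  have "\<not> R v (b k)" "\<not> R v (b j)" "\<not> R w (b i)" "\<not> R w (b k)" using D_b_unique assms ij k by metis+
  then show ?thesis using C6[of v "b i" a "b j" w "c k"] ij k assms pent sym unfolding D_def mem_Collect_eq by metis
qed

text \<open>A vertex of \<open>A\<close> sees at least two \<open>b\<close>s and one of
  \<open>D\<close> at most one, so some \<open>b i\<close> tells them apart; with \<open>c i\<close>
  it closes a 4-cycle.\<close>

lemma A_D:
  assumes "v \<in> A" "w \<in> D"
  shows "\<not> R v w"
proof -
  obtain i where i: "i \<in> I" "R v (b i)" "\<not> R w (b i)"
    using assms D_b_unique[OF assms(2)] unfolding A_def mem_Collect_eq by metis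
  then show ?thesis using C4[of v "b i" "c i" w] assms pent sym unfolding A_def D_def mem_Collect_eq by metis
qed

lemma B_D_link:
  assumes "v \<in> B i" "w \<in> D" "i \<in> I" "R v w"
  shows "R v (c i) \<or> R w (b i)"
  using C4[of v "b i" "c i" w] assms pent sym unfolding B_def D_def mem_Collect_eq by metis

lemma B_D_a:
  assumes "v \<in> B i" "w \<in> D" "i \<in> I" "R v w" "\<not> R v a"
  shows "R w (b i)"
proof (rule ccontr)
  assume n: "\<not> R w (b i)"
  obtain k where k: "k \<in> I" "k \<noteq> i" "\<not> R w (b k)"
    using D_b_unique[OF assms(2)] ex_two_indices by metis
  then show False using C6[of v "b i" a "b k" "c k" w] n assms pent sym unfolding B_def D_def mem_Collect_eq by metis
qed

lemma B_D_b:
  assumes "v \<in> B i" "w \<in> D" "i \<in> I" "R v w" "j \<in> I" "R w (b j)"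
  shows "j = i"
proof (rule ccontr)
  assume n: "j \<noteq> i"
  have "R v a" using B_D_a D_b_unique assms n by metis
  then show False using C4[of v w "b j" a] n assms pent sym unfolding B_def D_def mem_Collect_eq by metis
qed

text \<open>This assigns every base vertex that has a middle neighbour to a single arm, which is
  what makes the later classes \<open>Q i\<close> disjoint.\<close>

lemma B_D_unique:
  assumes "v \<in> B i" "w \<in> B j" "d \<in> D" "i \<in> I" "j \<in> I" "R v d" "R w d"
  shows "i = j"
proof (rule ccontr)
  assume n: "i \<noteq> j"
  have "\<not> R v w" using B_anticomplete assms n by metis
  show False
  proof (cases "R v a \<and> R w a")
    case True
    then show ?thesis using C4[of v d w a] \<open>\<not> R v w\<close> assms sym unfolding D_def mem_Collect_eq by metis
  next
    case False
    then have "R d (b i) \<or> R d (b j)" using B_D_a assms by blast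
    then show ?thesis using B_D_b assms n by metis
  qed
qed

text \<open>The nonadjacent common neighbours \<open>a\<close> and \<open>c k\<close> make
  \<open>v\<close> and \<open>w\<close> adjacent; then \<open>v\<close>, \<open>c j\<close>,
  \<open>c i\<close>, \<open>w\<close> is a 4-cycle without chords.\<close>

lemma F_unique:
  assumes "v \<in> F i" "w \<in> F j" "i \<in> I" "j \<in> I"
  shows "i = j"
proof (rule ccontr)
  assume n: "i \<noteq> j"
  obtain k where k: "k \<in> I" "k \<noteq> i" "k \<noteq> j" using ex_index by metis
  then have "R v w" using C4[of v a w "c k"] n assms pent sym unfolding F_def mem_Collect_eq by metis
  then show False using C4[of v "c j" "c i" w] n assms pent sym unfolding F_def mem_Collect_eq by metis
qed

end

text \<open>At most one of the classes F i is inhabited; it plays the role of the set F of a basket or mansion.\<close>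

locale pentagon_graph_F = pentagon_graph +
  fixes j0 :: nat
  assumes j0: "j0 \<in> I" and F_j0: "\<lbrakk>i \<in> I; v \<in> F i\<rbrakk> \<Longrightarrow> i = j0"
begin

text \<open>\<open>F j0\<close> and \<open>U\<close> behave alike on every arm but
  \<open>j0\<close>, so most arguments treat them as one clique.\<close>

definition W where "W = F j0 \<union> U"

lemma W_cases: "w \<in> W \<longleftrightarrow> w \<in> F j0 \<or> w \<in> U"
  unfolding W_def by blast

lemma W_a: "w \<in> W \<Longrightarrow> R w a"
  unfolding W_cases F_def U_def by blast

lemma W_bc: "\<lbrakk>w \<in> W; k \<in> I; k \<noteq> j0 \<or> w \<in> U\<rbrakk> \<Longrightarrow> R w (b k) \<and> R w (c k)"
  unfolding W_cases F_def U_def by blast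

lemma F_not: "w \<in> F j0 \<Longrightarrow> \<not> R w (b j0) \<and> \<not> R w (c j0)"
  using j0 unfolding F_def by blast

lemma W_clique:
  assumes "v \<in> W" "w \<in> W"
  shows "R v w"
proof -
  obtain k where k: "k \<in> I" "k \<noteq> j0" using ex_index by metis
  then show ?thesis using C4[of v a w "c k"] W_a W_bc assms ac sym by metis
qed

lemma A_a: "v \<in> A \<Longrightarrow> R v a"
  and A_c: "\<lbrakk>v \<in> A; k \<in> I\<rbrakk> \<Longrightarrow> \<not> R v (c k)"
  unfolding A_def by auto

text \<open>Usually \<open>v\<close> and \<open>w\<close> share two \<open>b\<close>s. The exception
  is a \<open>v\<close> that misses some \<open>b i\<close> with \<open>i \<noteq> j0\<close>: it
  then sees \<open>b j0\<close>, and a \<open>w\<close> in \<open>F j0\<close> not adjacent to it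
  would lie with it on a 6-cycle.\<close>

lemma W_A:
  assumes w: "w \<in> W" and v: "v \<in> A"
  shows "R w v"
proof (cases "\<exists>i\<in>I. i \<noteq> j0 \<and> \<not> R v (b i)")
  case False
  obtain k l where kl: "k \<in> I" "l \<in> I" "k \<noteq> j0" "l \<noteq> j0" "k \<noteq> l" using ex_two_indices by metis
  then show ?thesis using C4[of w "b k" v "b l"] False W_bc[OF w] bb sym by metis
next
  case True
  then obtain i where i: "i \<in> I" "i \<noteq> j0" "\<not> R v (b i)" by blast
  obtain k where k: "k \<in> I" "k \<noteq> i" "k \<noteq> j0" using ex_index by metis
  have v': "R v (b k)" "R v (b j0)" using A_missing_b_unique[OF v i(1) i(3)] k i(2) j0 by metis+
  show ?thesis
  proof (cases "w \<in> U")
    case True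
    then show ?thesis using C4[of w "b k" v "b j0"] v' k j0 W_bc[OF w] bb sym by metis
  next
    case False
    then have "\<not> R w (b j0)" "\<not> R w (c j0)" using w F_not W_cases by blast+
    then show ?thesis
      using C6[of v "b j0" "c j0" "c i" w "b k"] v' k i j0 W_bc[OF w] A_c[OF v] pent sym by metis
  qed
qed

lemma W_D:
  assumes "w \<in> W" "d \<in> D" "i \<in> I" "R d (b i)" "i \<noteq> j0 \<or> w \<in> U"
  shows "R w d"
proof -
  obtain k where "k \<in> I" "k \<noteq> i" "k \<noteq> j0" using ex_index by metis
  then show ?thesis using C4[of w "b i" d "c k"] assms W_bc[OF assms(1)] pent sym
    unfolding D_def mem_Collect_eq by metis
qed

lemma F_D:
  assumes "f \<in> F j0" "d \<in> D" "R d (b j0)"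
  shows "\<not> R f d"
  using C4[of f a "b j0" d] assms F_not[OF assms(1)] j0 W_a[of f] pent sym
  unfolding D_def W_cases mem_Collect_eq by metis

lemma W_B_D:
  assumes "w \<in> W" "v \<in> B i" "d \<in> D" "i \<in> I" "R v d" "i \<noteq> j0 \<or> w \<in> U"
  shows "R w d"
proof (cases "R d (b i)")
  case True
  then show ?thesis using W_D assms by metis
next
  case False
  then have v: "R v (c i)" "R v a" using B_D_link B_D_a assms by metis+
  then have wv: "R w v" using C4[of w a v "c i"] W_a W_bc assms ac sym by metis
  obtain k where "k \<in> I" "k \<noteq> i" "k \<noteq> j0" using ex_index by metis
  then show ?thesis using C4[of w v d "c k"] wv assms W_bc[OF assms(1)] sym
    unfolding D_def B_def mem_Collect_eq by metis
qed

section \<open>Emptiness of \<open>S1\<close>\<close>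

lemma S1_S3:
  assumes x: "x \<in> S1" and z: "z \<in> S3" shows "\<not> R x z"
proof
  assume h: "R x z"
  obtain i j where ij: "i \<in> I" "j \<in> I" "R z (c i)" "\<not> R z (c j)" using z unfolding S3_def by blast
  show False
  proof (cases "R x a")
    case True
    then show ?thesis using C6[of x a "b j" "c j" "c i" z] ij h x z pent sym
      unfolding S1_def S3_def mem_Collect_eq by metis
  next
    case False
    obtain k l where "k \<in> I" "l \<in> I" "k \<noteq> i" "l \<noteq> i" "k \<noteq> l" using ex_two_indices by metis
    then show ?thesis using P2[of x z "c i" "b k" a "b l"] False ij h x z pent sym
      unfolding S1_def S3_def mem_Collect_eq by metis
  qed
qed

text \<open>The one place where the maximality of the pentagon enters: if \<open>x\<close> sees
  \<open>a\<close> and \<open>z\<close> sees no \<open>b\<close>, the edge between them is a new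
  arm.\<close>

lemma S1_D:
  assumes x: "x \<in> S1" and z: "z \<in> D" shows "\<not> R x z"
proof
  assume h: "R x z"
  show False
  proof (cases "R x a")
    case True
    show ?thesis
    proof (cases "\<exists>i\<in>I. R z (b i)")
      case True
      then show ?thesis using C4[of x a _ z] \<open>R x a\<close> h x z ab sym
        unfolding S1_def D_def mem_Collect_eq by metis
    next
      case False
      then show ?thesis using maximal[of x z] True h x z sym
        unfolding S1_def D_def mem_Collect_eq by metis
    qed
  next
    case False
    obtain i where i: "i \<in> I" "\<And>j. j \<in> I \<Longrightarrow> j \<noteq> i \<Longrightarrow> \<not> R z (b j)" using D_b_at_most_one[OF z] by metis
    obtain k l where "k \<in> I" "l \<in> I" "k \<noteq> i" "l \<noteq> i" "k \<noteq> l" using ex_two_indices by metis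
    then show ?thesis using P2[of x z "c i" "b k" a "b l"] False i h x z pent sym
      unfolding S1_def D_def mem_Collect_eq by metis
  qed
qed

lemma S1_trans:
  assumes "x \<in> S1" "y \<in> S1" "z \<in> S1" "R x y" "R y z" shows "R x z"
proof -
  obtain i where "i \<in> I" using j0 by blast
  moreover obtain k where "k \<in> I" "k \<noteq> i" using ex_index by metis
  ultimately show ?thesis using P2[of x y z "b i" "c i" "c k"] assms pent sym
    unfolding S1_def mem_Collect_eq by metis
qed

text \<open>By \<open>S1_trans\<close> the vertex \<open>s\<close> and its neighbours in
  \<open>S1\<close> form a clique, and this clique sees nothing else except in the clique formed by
  \<open>A\<close> and \<open>W\<close>.\<close>

lemma S1_empty: "s \<notin> S1"
proof
  assume s: "s \<in> S1"
  show False
  proof (rule simplicial_clique[of "{x\<in>S1. R s x}" "A \<union> W"])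
    show "{x\<in>S1. R s x} \<noteq> {}" using s unfolding S1_def by blast
    show "R v v" if "v \<in> {x\<in>S1. R s x}" for v using that unfolding S1_def by blast
    show "R x y" if "x \<in> {x\<in>S1. R s x}" "y \<in> {x\<in>S1. R s x}" for x y
      using that S1_trans[of x s y] s sym by blast
    show "R x y" if "x \<in> A \<union> W" "y \<in> A \<union> W" for x y
      using that A_clique W_A W_clique sym by blast
    show "x \<in> {x\<in>S1. R s x} \<or> x \<in> A \<union> W" if v: "v \<in> {x\<in>S1. R s x}" and x: "R v x" for v x
      using classify[of x] refl[OF sym[OF x]] S1_D[of v x] S1_S3[of v x] B_S1[of x _ v]
        F_j0[of _ x] W_cases[of x] S1_trans[of s v x] s v x by blast
  qed
qed

section \<open>Emptiness of \<open>S3\<close> and the neighbours of a middle vertex\<close>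

lemma in_V: "R x y \<Longrightarrow> R y y"
  using refl sym by blast

lemma nbr_cases:
  assumes "R v x"
  shows "x \<in> A \<or> (\<exists>i\<in>I. x \<in> B i) \<or> x \<in> D \<or> x \<in> W \<or> x \<in> S3"
  using classify[OF in_V[OF assms]] S1_empty F_j0 W_cases by metis

lemma b_B: "i \<in> I \<Longrightarrow> b i \<in> B i"
  using bb bc ab refl[OF sym[OF ab]] unfolding B_def by blast

lemma B_bi: "\<lbrakk>v \<in> B i; i \<in> I\<rbrakk> \<Longrightarrow> R v (b i)"
  unfolding B_def by blast

text \<open>Otherwise the path \<open>z\<close>, \<open>d\<close>, \<open>c i\<close> is
  anticomplete to two other \<open>b\<close>s joined by \<open>a\<close>. The lemma carries the
  trace on the \<open>c\<close>s along an edge.\<close>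

lemma common_c:
  assumes z: "z \<in> S3 \<or> (z \<in> B i \<and> \<not> R z a)" and d: "d \<in> D \<or> d \<in> S3" and "R z d" "i \<in> I" "R d (c i)"
    "\<And>k. k \<in> I \<Longrightarrow> k \<noteq> i \<Longrightarrow> \<not> R d (b k)"
  shows "R z (c i)"
proof -
  obtain j k where "j \<in> I" "k \<in> I" "j \<noteq> i" "k \<noteq> i" "j \<noteq> k" using ex_two_indices by metis
  then show ?thesis using P2[of z d "c i" "b j" a "b k"] assms pent sym
    unfolding S3_def D_def B_def mem_Collect_eq by metis
qed

lemma B_S3:
  assumes v: "v \<in> B i" and i: "i \<in> I" and z: "z \<in> S3"
  shows "\<not> R v z"
proof
  assume h: "R v z"
  have vb: "\<And>k. k \<in> I \<Longrightarrow> R v (b k) \<longleftrightarrow> k = i" and vc: "\<And>k. k \<in> I \<Longrightarrow> k \<noteq> i \<Longrightarrow> \<not> R v (c k)"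
    using v unfolding B_def by blast+
  have za: "\<not> R z a" and zb: "\<And>k. k \<in> I \<Longrightarrow> \<not> R z (b k)" using z unfolding S3_def by blast+
  have "R v a" if "j \<in> I" "j \<noteq> i" "R z (c j)" for j
    using C6[of v "b i" a "b j" "c j" z] that h i vb vc za zb pent sym by metis
  note va = this
  show False
  proof (cases "R z (c i)")
    case True
    then have vci: "R v (c i)" using C4[of v "b i" "c i" z] h i vb zb pent sym by metis
    show False
    proof (cases "\<exists>j\<in>I. j \<noteq> i \<and> R z (c j)")
      case True
      then obtain j where j: "j \<in> I" "j \<noteq> i" "R z (c j)" by blast
      obtain k where k: "k \<in> I" "\<not> R z (c k)" using z unfolding S3_def by blast
      then have "k \<noteq> i" "k \<noteq> j" using j \<open>R z (c i)\<close> by blast+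
      then show False using C6[of z v a "b k" "c k" "c j"] va[OF j] j k h vb vc za zb pent sym by metis
    next
      case False
      obtain j k where "j \<in> I" "k \<in> I" "j \<noteq> i" "k \<noteq> i" "j \<noteq> k" using ex_two_indices by metis
      then show False using P2[of z v "b i" "b j" "c j" "c k"] False i h vb vc zb pent sym by metis
    qed
  next
    case n: False
    obtain j where j: "j \<in> I" "R z (c j)" using z unfolding S3_def by blast
    then have ji: "j \<noteq> i" using n by blast
    have vci: "\<not> R v (c i)" using C4[of v z "c j" "c i"] j ji n h vc i pent sym by metis
    show False
    proof (cases "\<exists>k\<in>I. k \<noteq> i \<and> \<not> R z (c k)")
      case True
      then obtain k where "k \<in> I" "k \<noteq> i" "\<not> R z (c k)" by blast
      then show False using C6[of v z "c j" "c k" "b k" a] va[OF j(1) ji j(2)] j ji h vb vc za zb pent sym by metis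
    next
      case False
      obtain k where k: "k \<in> I" "k \<noteq> i" "k \<noteq> j" using ex_index by metis
      then have "R z (c k)" using False by blast
      \<comment> \<open>No hole arises when \<open>z\<close> sees every \<open>c\<close> except
        \<open>c i\<close>; here \<open>T0\<close> itself appears. The order of its arguments is p,
        q, u0, u2, u3, u1, w1, w2, w3.\<close>
      then show False using T0[of "c j" "c k" "b j" "c i" z "b k" a "b i" v]
          va[OF j(1) ji j(2)] j ji k i h n vb vc vci za zb pent sym by metis
    qed
  qed
qed

text \<open>A neighbour \<open>c i\<close> of \<open>z\<close> forces \<open>v\<close> to miss
  \<open>b i\<close>, hence to see all other \<open>b\<close>s. Then \<open>a\<close> and
  \<open>v\<close> are the adjacent pair p, q of a copy of \<open>T0\<close>.\<close>

lemma A_S3: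
  assumes v: "v \<in> A" and z: "z \<in> S3"
  shows "\<not> R v z"
proof
  assume h: "R v z"
  have za: "\<not> R z a" and zb: "\<And>k. k \<in> I \<Longrightarrow> \<not> R z (b k)" using z unfolding S3_def by blast+
  have miss: "\<not> R v (b i)" if "i \<in> I" "R z (c i)" for i
    using C4[of z v "b i" "c i"] that h zb A_c[OF v] pent sym by metis
  obtain i where i: "i \<in> I" "R z (c i)" using z unfolding S3_def by blast
  obtain j k where jk: "j \<in> I" "k \<in> I" "j \<noteq> i" "k \<noteq> i" "j \<noteq> k" using ex_two_indices by metis
  have "R v (b j)" "R v (b k)" using A_missing_b_unique[OF v i(1) miss[OF i]] jk by metis+
  then show False
    using T0[of a v "b i" "b j" "b k" z "c i" "c j" "c k"] miss i jk h za zb A_a[OF v] A_c[OF v] pent sym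
    by metis
qed

text \<open>The vertices of \<open>B i\<close> that miss both \<open>a\<close> and
  \<open>c i\<close> form a clique \<open>K\<close>. Its outside neighbours lie in
  \<open>B i\<close>, \<open>A\<close> and \<open>W\<close>; the claim \<open>BAW\<close> shows that
  they are pairwise adjacent, so the removal principle applies.\<close>

lemma B_no_a_imp_c:
  assumes i: "i \<in> I" and v0: "v0 \<in> B i" "\<not> R v0 a"
  shows "R v0 (c i)"
proof (rule ccontr)
  assume n: "\<not> R v0 (c i)"
  define K where "K = {v\<in>B i. \<not> R v a \<and> \<not> R v (c i)}"
  define N where "N = (B i - K) \<union> {x\<in>A \<union> W. \<exists>v\<in>K. R v x}"
  have AW: "R x y" if "x \<in> A \<union> W" "y \<in> A \<union> W" for x y
    using that A_clique W_A W_clique sym by blast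
  have BAW: "R w x" if w: "w \<in> B i - K" and x: "x \<in> A \<union> W" and v: "v \<in> K" "R v x" for w x v
  proof (rule ccontr)
    assume wx: "\<not> R w x"
    have vB: "v \<in> B i" "\<not> R v a" "\<not> R v (c i)" "R v w"
      using v w B_clique i unfolding K_def by blast+
    have "R x a" using x A_a W_a by blast
    then have wa: "\<not> R w a" using C4[of w v x a] wx v vB sym by metis
    then have wc: "R w (c i)" using w unfolding K_def by blast
    show False
    proof (cases "x \<in> A")
      case True
      obtain k where k: "k \<in> I" "k \<noteq> i" "R x (b k)" using A_ex_other_b[OF True] by metis
      have wb: "\<And>k. k \<in> I \<Longrightarrow> R w (b k) \<Longrightarrow> k = i" "\<And>k. k \<in> I \<Longrightarrow> R w (c k) \<Longrightarrow> k = i"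
        "\<And>k. k \<in> I \<Longrightarrow> R v (b k) \<Longrightarrow> k = i" "\<And>k. k \<in> I \<Longrightarrow> R v (c k) \<Longrightarrow> k = i"
        using w vB(1) unfolding B_def by blast+
      then show False using k C6[of v w "c i" "c k" "b k" x] wx wc vB(3,4) v(2) wb A_c[OF True] i pent sym
        by metis
    next
      case False
      then have xW: "x \<in> W" using x by blast
      show False
      proof (cases "R x (c i)")
        case True
        then show False using C4[of v w "c i" x] wx wc vB v sym by metis
      next
        case False
        then have "x \<in> F j0" "i = j0" using W_bc[OF xW i] xW W_cases by blast+
        then show False using C4[of x v "b j0" a] F_not[of x] vB B_bi[OF vB(1)] \<open>R x a\<close> v i ab sym by metis
      qed
    qed
  qed
  show False
  proof (rule simplicial_clique[of K N])
    show "K \<noteq> {}" using n v0 unfolding K_def by blast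
    show "R v v" if "v \<in> K" for v using that B_clique i unfolding K_def by blast
    show "R x y" if "x \<in> K" "y \<in> K" for x y using that B_clique i unfolding K_def by blast
    show "R x y" if "x \<in> N" "y \<in> N" for x y
      using that AW BAW B_clique[OF _ _ i] sym unfolding N_def by blast
    show "x \<in> K \<or> x \<in> N" if v: "v \<in> K" and x: "R v x" for v x
    proof -
      have vB: "v \<in> B i" "\<not> R v a" "\<not> R v (c i)" using v unfolding K_def by blast+
      have "x \<notin> D"
      proof
        assume d: "x \<in> D"
        then have "R x (b i)" using B_D_link vB x i by metis
        then have "R v (c i)" using common_c[of v i x] d vB x i D_b_unique[OF d] unfolding D_def by blast
        then show False using vB by blast
      qed
      moreover have "x \<notin> S3" using B_S3 vB x i by blast
      moreover have "k = i" if "x \<in> B k" "k \<in> I" for k using B_anticomplete that vB x i by blast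
      ultimately show ?thesis using nbr_cases[OF x] v x unfolding N_def by blast
    qed
  qed
qed

lemma S3_meet:
  assumes "x \<in> S3" "y \<in> S3" "i \<in> I" "R x (c i)" "R y (c i)" shows "R x y"
proof -
  obtain j k where "j \<in> I" "k \<in> I" "j \<noteq> i" "k \<noteq> i" "j \<noteq> k" using ex_two_indices by metis
  then show ?thesis using P2[of x "c i" y "b j" a "b k"] assms pent sym
    unfolding S3_def mem_Collect_eq by metis
qed

text \<open>Adjacent vertices of \<open>S3\<close> have the same trace on the \<open>c\<close>s, and
  vertices with a common \<open>c\<close> are adjacent. A component is therefore a clique fixed by
  its trace, and its outside neighbours lie in \<open>D\<close> and \<open>W\<close>.\<close>

lemma S3_empty: "z \<notin> S3"
proof
  assume z: "z \<in> S3"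
  define K where "K = {x\<in>S3. R z x}"
  define N where "N = {x\<in>D \<union> W. \<exists>v\<in>K. R v x}"
  have c_iff: "R x (c i) \<longleftrightarrow> R y (c i)" if "x \<in> S3" "y \<in> S3" "R x y" "i \<in> I" for x y i
  proof -
    have "\<not> R x (b k)" "\<not> R y (b k)" if "k \<in> I" for k
      using that \<open>x \<in> S3\<close> \<open>y \<in> S3\<close> unfolding S3_def by blast+
    then show ?thesis using common_c[of x i y] common_c[of y i x] that sym by metis
  qed
  have z': "\<exists>i\<in>I. R z (c i)" using z unfolding S3_def by blast
  have K_iff: "x \<in> K \<longleftrightarrow> x \<in> S3 \<and> (\<forall>i\<in>I. R x (c i) \<longleftrightarrow> R z (c i))" for x
    using c_iff[of z x] S3_meet[of z x] z z' unfolding K_def mem_Collect_eq by metis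
  have DW: "R x y" if x: "x \<in> D" "R v x" "v \<in> K" and y: "y \<in> W" "R v' y" "v' \<in> K" for x y v v'
  proof -
    have v: "v \<in> S3" "v' \<in> S3" "\<And>i. i \<in> I \<Longrightarrow> R v (c i) \<longleftrightarrow> R v' (c i)" using x y K_iff by blast+
    obtain k where k: "k \<in> I" "\<not> R v (c k)" using v unfolding S3_def by blast
    \<comment> \<open>If \<open>x\<close> saw no \<open>b\<close>, \<open>common_c\<close> would
      apply to every index and give \<open>v\<close> the neighbour \<open>c k\<close> that it
      misses. If \<open>x\<close> sees \<open>b i\<close>, the same lemma puts \<open>c i\<close>
      into the trace.\<close>
    have "\<exists>i\<in>I. R x (b i) \<and> R v (c i)"
    proof (rule ccontr)
      assume n: "\<not> ?thesis"
      have xc: "\<And>i. i \<in> I \<Longrightarrow> R x (c i)" using x(1) unfolding D_def by blast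
      show False
      proof (cases "\<exists>i\<in>I. R x (b i)")
        case True
        then obtain i where i: "i \<in> I" "R x (b i)" by blast
        then have "R v (c i)" using common_c[of v i x] v x xc D_b_unique[OF x(1)] by blast
        then show False using n i by blast
      next
        case False
        then have "R v (c k)" using common_c[of v k x] v x xc k by blast
        then show False using k by blast
      qed
    qed
    then obtain i where i: "i \<in> I" "R x (b i)" "R v (c i)" by blast
    show ?thesis
    proof (cases "i \<noteq> j0 \<or> y \<in> U")
      case True
      then show ?thesis using W_D x y i sym by metis
    next
      case False
      then have f: "y \<in> F j0" "i = j0" using y W_cases by blast+
      then have "k \<noteq> j0" using i k by blast
      then show ?thesis using C4[of y v' "c j0" "c k"] y(2) i f F_not[OF f(1)] W_bc[OF y(1) k(1)] v k i cc sym by metis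
    qed
  qed
  show False
  proof (rule simplicial_clique[of K N])
    show "K \<noteq> {}" using z K_iff by blast
    show "R v v" if "v \<in> K" for v using that in_V unfolding K_def by blast
    show "R x y" if "x \<in> K" "y \<in> K" for x y using that S3_meet[of x y] z K_iff unfolding S3_def by blast
    show "R x y" if "x \<in> N" "y \<in> N" for x y
    proof -
      have "R x y" if "x \<in> D" "y \<in> D" using that D_clique by blast
      moreover have "R x y" if "x \<in> W" "y \<in> W" using that W_clique by blast
      ultimately show ?thesis using that DW sym unfolding N_def by blast
    qed
    show "x \<in> K \<or> x \<in> N" if v: "v \<in> K" and x: "R v x" for v x
    proof -
      have v': "v \<in> S3" using v K_iff by blast
      have "x \<in> S3 \<Longrightarrow> x \<in> K" using c_iff[OF v' _ x] v K_iff by blast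
      moreover have "x \<notin> A" using A_S3 v' x sym by blast
      moreover have "\<not> (\<exists>i\<in>I. x \<in> B i)" using B_S3 v' x sym by blast
      ultimately show ?thesis using nbr_cases[OF x] v x unfolding N_def by blast
    qed
  qed
qed

text \<open>A vertex of \<open>B i\<close> without neighbours in \<open>A\<close> misses
  \<open>a\<close>, hence sees \<open>c i\<close>, and all its neighbours in \<open>D\<close> see
  \<open>b i\<close>. This is enough to make the outside neighbours of all such vertices a
  clique.\<close>

lemma B_has_A:
  assumes v0: "v0 \<in> B i" and i: "i \<in> I"
  shows "\<exists>x\<in>A. R v0 x"
proof (rule ccontr)
  assume n: "\<not> ?thesis"
  have aA: "a \<in> A"
    using ex_two_indices[of i] ab ac refl[OF ab[OF i]] unfolding A_def by blast
  define K where "K = {v\<in>B i. \<forall>x\<in>A. \<not> R v x}"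
  define N where "N = (B i - K) \<union> {x\<in>D \<union> W. \<exists>v\<in>K. R v x}"
  have Kp: "v \<in> B i" "\<not> R v a" "R v (c i)" if "v \<in> K" for v
    using that aA B_no_a_imp_c[OF i] unfolding K_def by blast+
  have Db: "R x (b i)" if "x \<in> D" "R v x" "v \<in> K" for x v
    using B_D_a Kp that i by blast
  have BDW: "R w x" if w: "w \<in> B i - K" and x: "x \<in> D \<union> W" and v: "v \<in> K" "R v x" for w x v
  proof (rule ccontr)
    assume wx: "\<not> R w x"
    obtain y where y: "y \<in> A" "R w y" using w unfolding K_def by blast
    have vy: "\<not> R v y" using v y unfolding K_def by blast
    have vw: "R v w" using B_clique Kp v w i by blast
    show False
    proof (cases "x \<in> D")
      case True
      obtain k where k: "k \<in> I" "k \<noteq> i" "R y (b k)" using A_ex_other_b[OF y(1)] by metis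
      have wb: "\<And>k. k \<in> I \<Longrightarrow> R w (b k) \<longleftrightarrow> k = i" "\<And>k. k \<in> I \<Longrightarrow> R w (c k) \<Longrightarrow> k = i"
        "\<And>k. k \<in> I \<Longrightarrow> R v (b k) \<longleftrightarrow> k = i" "\<And>k. k \<in> I \<Longrightarrow> R v (c k) \<Longrightarrow> k = i"
        using w Kp(1)[OF v(1)] unfolding B_def by blast+
      have xb: "\<not> R x (b k)" using D_b_unique[OF True] Db[OF True v(2,1)] k i by blast
      have "R x (c k)" using True k unfolding D_def by blast
      then show False using C6[of v w y "b k" "c k" x] wx vy vw y k v wb xb A_c[OF y(1)] A_D[OF y(1) True] pent sym by metis
    next
      case False
      then have "R x y" using W_A x y by blast
      then show False using C4[of w v x y] wx vy vw y v sym by metis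
    qed
  qed
  have DW: "R x y" if x: "x \<in> D" "R v x" "v \<in> K" and y: "y \<in> W" "R v' y" "v' \<in> K" for x y v v'
  proof (cases "i \<noteq> j0 \<or> y \<in> U")
    case True
    then show ?thesis using W_D[OF y(1) x(1) i Db] x sym by metis
  next
    case False
    then have f: "y \<in> F j0" "i = j0" using y W_cases by blast+
    obtain k where k: "k \<in> I" "k \<noteq> j0" using ex_index by metis
    then have "\<not> R v' (c k)" using Kp(1)[OF y(3)] f unfolding B_def by blast
    then show ?thesis
      using C4[of y v' "c j0" "c k"] f y k Kp[OF y(3)] F_not[OF f(1)] W_bc[OF y(1) k(1)] j0 cc sym by metis
  qed
  show False
  proof (rule simplicial_clique[of K N])
    show "K \<noteq> {}" using n v0 unfolding K_def by blast
    show "R v v" if "v \<in> K" for v using that Kp B_clique i by blast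
    show "R x y" if "x \<in> K" "y \<in> K" for x y using that Kp B_clique i by blast
    show "R x y" if "x \<in> N" "y \<in> N" for x y
    proof -
      have "R x y" if "x \<in> D" "y \<in> D" using that D_clique by blast
      moreover have "R x y" if "x \<in> W" "y \<in> W" using that W_clique by blast
      moreover have "R x y" if "x \<in> B i" "y \<in> B i" using that B_clique i by blast
      ultimately show ?thesis using that DW BDW sym unfolding N_def by blast
    qed
    show "x \<in> K \<or> x \<in> N" if v: "v \<in> K" and x: "R v x" for v x
    proof -
      have "k = i" if "x \<in> B k" "k \<in> I" for k using B_anticomplete that Kp v x i by blast
      moreover have "x \<notin> A" using v x unfolding K_def by blast
      ultimately show ?thesis using nbr_cases[OF x] S3_empty v x unfolding N_def by blast
    qed
  qed
qed

section \<open>Refinement of the middle and the base\<close>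

definition X where "X i = {v\<in>B i. \<forall>d\<in>D. \<not> R v d}"
definition Y where "Y = {d\<in>D. \<forall>i\<in>I. \<forall>v\<in>B i. \<not> R v d}"

lemma c_D: "i \<in> I \<Longrightarrow> c i \<in> D"
  using ac cc sym unfolding D_def by blast

text \<open>Away from the arm \<open>j0\<close>, or when \<open>F j0\<close> is empty,
  \<open>W\<close> sees every base vertex that \<open>B i\<close> sees. This makes the outside
  neighbours of \<open>X i\<close> a clique, so \<open>X i\<close> can survive only on the arm that
  \<open>F\<close> misses.\<close>

lemma X_empty:
  assumes i: "i \<in> I" and free: "i \<noteq> j0 \<or> F j0 = {}"
  shows "X i = {}"
proof (rule ccontr)
  assume ne: "X i \<noteq> {}"
  define N where "N = (B i - X i) \<union> {x\<in>A \<union> W. \<exists>v\<in>X i. R v x}"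
  have free': "i \<noteq> j0 \<or> x \<in> U" if "x \<in> W" for x using that free W_cases by blast
  have BAW: "R w x" if w: "w \<in> B i - X i" and x: "x \<in> A \<union> W" and v: "v \<in> X i" "R v x" for w x v
  proof (rule ccontr)
    assume wx: "\<not> R w x"
    obtain d where d: "d \<in> D" "R w d" using w unfolding X_def by blast
    have vd: "\<not> R v d" and vB: "v \<in> B i" using v d unfolding X_def by blast+
    have vw: "R v w" using B_clique vB w i by blast
    show False
    proof (cases "x \<in> A")
      case True
      obtain k where k: "k \<in> I" "k \<noteq> i" "R x (b k)" using A_ex_other_b[OF True] by metis
      have wb: "\<not> R w (b k)" "\<not> R w (c k)" "\<not> R v (b k)" "\<not> R v (c k)"
        using w vB k unfolding B_def by blast+
      have db: "\<not> R d (b k)" using B_D_b[OF _ d(1) i d(2) k(1)] w k by blast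
      have "R d (c k)" using d k unfolding D_def by blast
      then show False using C6[of v w d "c k" "b k" x] wx vw vd d v wb db k A_c[OF True k(1)] A_D[OF True d(1)]
          bc sym by metis
    next
      case False
      then have xW: "x \<in> W" using x by blast
      have "R x d" using W_B_D[OF xW _ d(1) i d(2) free'[OF xW]] w by blast
      then show False using C4[of v w d x] wx vw vd d v sym by metis
    qed
  qed
  show False
  proof (rule simplicial_clique[of "X i" N])
    show "X i \<noteq> {}" by (rule ne)
    show "R v v" if "v \<in> X i" for v using that B_clique i unfolding X_def by blast
    show "R x y" if "x \<in> X i" "y \<in> X i" for x y using that B_clique i unfolding X_def by blast
    show "R x y" if "x \<in> N" "y \<in> N" for x y
    proof -
      have "R x y" if "x \<in> A \<union> W" "y \<in> A \<union> W" using that A_clique W_A W_clique sym by blast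
      moreover have "R x y" if "x \<in> B i" "y \<in> B i" using that B_clique i by blast
      ultimately show ?thesis using that BAW sym unfolding N_def by blast
    qed
    show "x \<in> X i \<or> x \<in> N" if v: "v \<in> X i" and x: "R v x" for v x
    proof -
      have "k = i" if "x \<in> B k" "k \<in> I" for k using B_anticomplete that v x i unfolding X_def by blast
      moreover have "x \<notin> D" using v x unfolding X_def by blast
      ultimately show ?thesis using nbr_cases[OF x] S3_empty v x unfolding N_def by blast
    qed
  qed
qed

text \<open>Without \<open>F j0\<close> all of \<open>W\<close> sees every base vertex attached to
  an arm, so the outside neighbours of \<open>Y\<close> form a clique.\<close>

lemma Y_empty:
  assumes "F j0 = {}"
  shows "Y = {}"
proof (rule ccontr)
  assume ne: "Y \<noteq> {}"
  show False
  proof (rule simplicial_clique[of Y "(D - Y) \<union> W"])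
    show "Y \<noteq> {}" by (rule ne)
    show "R v v" if "v \<in> Y" for v using that D_clique unfolding Y_def by blast
    show "R x y" if "x \<in> Y" "y \<in> Y" for x y using that D_clique unfolding Y_def by blast
    show "R x y" if "x \<in> (D - Y) \<union> W" "y \<in> (D - Y) \<union> W" for x y
    proof -
      have "R x y" if "x \<in> D" "y \<in> D" for x y using that D_clique by blast
      moreover have "R x y" if "x \<in> W" "y \<in> W" for x y using that W_clique by blast
      moreover have "R x y" if x: "x \<in> W" and y: "y \<in> D - Y" for x y
      proof -
        obtain i v where "i \<in> I" "v \<in> B i" "R v y" using y unfolding Y_def by blast
        then show ?thesis using W_B_D[OF x] y x assms W_cases by blast
      qed
      ultimately show ?thesis using that sym by blast
    qed
    show "x \<in> Y \<or> x \<in> D - Y \<union> W" if v: "v \<in> Y" and x: "R v x" for v x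
    proof -
      have "v \<in> D" using v unfolding Y_def by blast
      then have "x \<notin> A" using A_D x sym by blast
      moreover have "\<not> (\<exists>i\<in>I. x \<in> B i)" using v x sym unfolding Y_def by blast
      ultimately show ?thesis using nbr_cases[OF x] S3_empty by blast
    qed
  qed
qed

text \<open>These are the final middle and base of arm \<open>i\<close>: each vertex of one has a
  neighbour in the other.\<close>

definition P where "P i = B i - X i"
definition Q where "Q i = {d\<in>D. \<exists>v\<in>B i. R v d}"

lemma P_B: "v \<in> P i \<Longrightarrow> v \<in> B i"
  unfolding P_def by blast

lemma P_Q: "v \<in> P i \<Longrightarrow> \<exists>d\<in>Q i. R v d"
  unfolding P_def X_def Q_def by blast

lemma Q_D: "d \<in> Q i \<Longrightarrow> d \<in> D"
  unfolding Q_def by blast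

lemma Q_P: "d \<in> Q i \<Longrightarrow> \<exists>v\<in>P i. R v d"
  unfolding P_def X_def Q_def by blast

lemma b_P: "i \<in> I \<Longrightarrow> b i \<in> P i"
  using b_B c_D bc unfolding P_def X_def by blast

lemma c_Q: "i \<in> I \<Longrightarrow> c i \<in> Q i"
  using b_B c_D bc unfolding Q_def by blast

lemma B_Q: "\<lbrakk>v \<in> B i; d \<in> Q j; i \<in> I; j \<in> I; i \<noteq> j\<rbrakk> \<Longrightarrow> \<not> R v d"
  using B_D_unique[of v i _ j d] unfolding Q_def by blast

lemma B_c: "\<lbrakk>v \<in> B i; k \<in> I; k \<noteq> i\<rbrakk> \<Longrightarrow> \<not> R v (c k)"
  unfolding B_def by blast

lemma D_c: "\<lbrakk>d \<in> D; k \<in> I\<rbrakk> \<Longrightarrow> R d (c k)"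
  unfolding D_def by blast

section \<open>Missing edges between top and middle\<close>

lemma A_miss_one:
  assumes v: "v \<in> A" and w: "w \<in> P i" "\<not> R v w" and x: "x \<in> P j" and ij: "i \<in> I" "j \<in> I" "i \<noteq> j"
  shows "R v x"
proof (rule ccontr)
  assume n: "\<not> R v x"
  \<comment> \<open>The argument needs \<open>v\<close> to see \<open>b i\<close>. As
    \<open>v\<close> misses at most one \<open>b\<close>, this holds for one of the two arms, and
    the situation is symmetric in them.\<close>
  have aux: False if h: "R v (b i)" "w \<in> P i" "\<not> R v w" "x \<in> P j" "\<not> R v x" "i \<in> I" "j \<in> I" "i \<noteq> j"
    for i j w x
  proof -
    obtain d where d: "d \<in> Q j" "R x d" using P_Q h by blast
    obtain k where k: "k \<in> I" "k \<noteq> i" "k \<noteq> j" using ex_index by metis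
    have B: "w \<in> B i" "x \<in> B j" "b i \<in> B i" using that P_B b_B by blast+
    show False
      using P2[of v "b i" w x d "c k"] that d k B B_bi[OF B(1)] B_anticomplete[OF B(1,2)]
        B_anticomplete[OF B(3,2)] B_Q[OF B(1) d(1)] B_Q[OF B(3) d(1)] B_c[OF B(1) k(1)] B_c[OF B(2) k(1)]
        B_c[OF B(3) k(1)] A_D[OF v Q_D[OF d(1)]] A_c[OF v k(1)] D_c[OF Q_D[OF d(1)] k(1)] sym
      by metis
  qed
  show False
  proof (cases "R v (b i)")
    case True
    then show ?thesis using aux[OF True w x n ij] by blast
  next
    case False
    then have "R v (b j)" using A_missing_b_unique[OF v ij(1)] ij by metis
    then show ?thesis using aux[where i = j and w = x and j = i and x = w] w x n ij by blast
  qed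
qed

text \<open>By \<open>A_miss_one\<close> each of \<open>v\<close> and \<open>v'\<close> sees the
  vertex that the other misses; with base neighbours of \<open>w\<close> and \<open>x\<close> this
  closes a 6-cycle.\<close>

lemma A_incomplete_unique:
  assumes "v \<in> A" "w \<in> P i" "\<not> R v w" "v' \<in> A" "x \<in> P j" "\<not> R v' x" "i \<in> I" "j \<in> I"
  shows "i = j"
proof (rule ccontr)
  assume n: "i \<noteq> j"
  have r: "R v x" "R v' w" using A_miss_one assms n by metis+
  obtain d e where de: "d \<in> Q i" "R w d" "e \<in> Q j" "R x e" using P_Q assms by metis
  have B: "w \<in> B i" "x \<in> B j" using assms P_B by blast+
  show False
    using C6[of w v' v x e d] r assms n de B_anticomplete[OF B] B_Q[OF B(1) de(3)] B_Q[OF B(2) de(1)]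
      A_clique[of v v'] A_D[OF assms(1)] A_D[OF assms(4)] D_clique[of d e] Q_D[OF de(1)] Q_D[OF de(3)] sym
    by metis
qed

text \<open>The source of the three arms of a basket: a fourth arm \<open>l\<close> would make
  \<open>b j\<close>, \<open>v\<close>, \<open>b k\<close> anticomplete to \<open>w\<close>,
  \<open>d\<close>, \<open>c l\<close>.\<close>

lemma A_incomplete_index:
  assumes v: "v \<in> A" and w: "w \<in> P i" "\<not> R v w" and I: "i \<in> I" "j \<in> I" "k \<in> I" "l \<in> I"
    and ne: "j \<noteq> i" "k \<noteq> i" "l \<noteq> i" "j \<noteq> k" "j \<noteq> l"
  shows "k = l"
proof (rule ccontr)
  assume kl: "k \<noteq> l"
  have r: "R v (b j)" "R v (b k)" using A_miss_one[OF v w b_P] I ne by metis+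
  obtain d where d: "d \<in> Q i" "R w d" using P_Q w by blast
  have B: "w \<in> B i" "b j \<in> B j" "b k \<in> B k" using w P_B b_B I by blast+
  show False
    using P2[of "b j" v "b k" w d "c l"] r w kl ne I d bb bc B_anticomplete[OF B(1,2)] B_anticomplete[OF B(1,3)]
      B_Q[OF B(2) d(1)] B_Q[OF B(3) d(1)] B_c[OF B(1) I(4)] A_D[OF v Q_D[OF d(1)]] A_c[OF v I(4)]
      D_c[OF Q_D[OF d(1)] I(4)] sym by metis
qed

lemma A_incomplete_P_Q:
  assumes v: "v \<in> A" and w: "w \<in> P i" "\<not> R v w" and I: "i \<in> I" "k \<in> I"
    and x: "x \<in> P k" and d: "d \<in> Q k"
  shows "R x d"
proof (rule ccontr)
  assume n: "\<not> R x d"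
  obtain e where e: "e \<in> Q i" "R w e" using P_Q w by blast
  have ed: "R e d" using D_clique Q_D e d by blast
  show False
  proof (cases "k = i")
    case False
    obtain l where l: "l \<in> I" "l \<noteq> i" "l \<noteq> k" using ex_index by metis
    have r: "R v x" "R v (b l)" using A_miss_one[OF v w _ I(1)] x b_P l I False by metis+
    have B: "w \<in> B i" "x \<in> B k" "b l \<in> B l" using w P_B b_B x l by blast+
    show False
      using P2[of w e d x v "b l"] r e ed n d w False I l B_anticomplete[OF B(1,2)] B_anticomplete[OF B(1,3)]
        B_anticomplete[OF B(2,3)] B_Q[OF B(1) d] B_Q[OF B(2) e(1)] B_Q[OF B(3) d] B_Q[OF B(3) e(1)]
        A_D[OF v Q_D[OF d]] A_D[OF v Q_D[OF e(1)]] sym by metis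
  next
    case k: True
    obtain j l where jl: "j \<in> I" "l \<in> I" "j \<noteq> i" "l \<noteq> i" "j \<noteq> l" using ex_two_indices by metis
    have r: "R v (b j)" "R v (b l)" using A_miss_one[OF v w b_P I(1)] jl by metis+
    \<comment> \<open>On the arm \<open>i\<close> itself the claim is first proved for the vertices
      that \<open>v\<close> misses. A vertex \<open>x\<close> that \<open>v\<close> sees is then
      compared with \<open>w\<close>, on a 6-cycle through \<open>v\<close>, \<open>d\<close> and
      the arm \<open>j\<close>.\<close>
    have aux: "R u d" if u: "u \<in> P i" "\<not> R v u" for u
    proof (rule ccontr)
      assume n: "\<not> R u d"
      obtain f where f: "f \<in> Q i" "R u f" using P_Q u by blast
      have B: "u \<in> B i" "b j \<in> B j" "b l \<in> B l" using u P_B b_B jl by blast+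
      have di: "d \<in> Q i" using d k by blast
      show False
        using P2[of u f d "b j" v "b l"] r n u f jl I B_anticomplete[OF B(1,2)] B_anticomplete[OF B(1,3)] bb
          B_Q[OF B(2) f(1)] B_Q[OF B(2) di] B_Q[OF B(3) f(1)] B_Q[OF B(3) di]
          A_D[OF v Q_D[OF d]] A_D[OF v Q_D[OF f(1)]] D_clique[OF Q_D[OF f(1)] Q_D[OF d]] sym by metis
    qed
    then have "R w d" "R v x" using w x n k by blast+
    have B: "w \<in> B i" "x \<in> B i" "b j \<in> B j" using w x k P_B b_B jl by blast+
    have "d \<in> Q i" using d k by blast
    then show False
      using C6[of v x w d "c j" "b j"] r \<open>R w d\<close> \<open>R v x\<close> n w jl I B_clique[OF B(1,2) I(1)]
        B_anticomplete[OF B(1,3)] B_anticomplete[OF B(2,3)] B_Q[OF B(3)] B_c[OF B(1) jl(1)] B_c[OF B(2) jl(1)]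
        A_D[OF v Q_D[OF d]] A_c[OF v jl(1)] D_c[OF Q_D[OF d] jl(1)] bc sym by metis
  qed
qed

end

section \<open>Blueprints\<close>

text \<open>The neighbourhoods in \<open>T\<close> of the vertices of \<open>S\<close> form a chain.
  Written as the absence of crossing edges, this is exactly what excluding 4-cycles gives between
  two cliques.\<close>

definition nested :: "('a \<Rightarrow> 'a \<Rightarrow> bool) \<Rightarrow> 'a set \<Rightarrow> 'a set \<Rightarrow> bool" where
  "nested R S T \<longleftrightarrow> (\<forall>x\<in>S. \<forall>y\<in>S. \<forall>u\<in>T. \<forall>v\<in>T. R x u \<longrightarrow> R y v \<longrightarrow> R x v \<or> R y u)"

text \<open>\<open>U\<close> holds the universal vertices and \<open>j\<close> is the arm that
  \<open>F\<close> misses. The conditional on \<open>F\<close> separates villas from mansions; in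
  the last disjunction the first alternative is a villa or mansion and the second a basket.\<close>

definition blueprint where
  "blueprint R I j A B C F X Y U \<longleftrightarrow>
     j \<in> I \<and>
     {v. R v v} = A \<union> (\<Union>i\<in>I. B i) \<union> (\<Union>i\<in>I. C i) \<union> F \<union> X \<union> Y \<union> U \<and>
     A \<noteq> {} \<and> complete R A A \<and> complete R F F \<and> complete R X X \<and> complete R Y Y \<and>
     complete R U {v. R v v} \<and>
     (\<forall>i\<in>I. B i \<noteq> {} \<and> C i \<noteq> {} \<and> complete R (B i) (B i) \<and> anticomplete R A (C i) \<and>
        nested R A (B i) \<and> nested R (B i) (C i) \<and>
        (\<forall>v\<in>B i. (\<exists>x\<in>A. R v x) \<and> (\<exists>x\<in>C i. R v x)) \<and> (\<forall>v\<in>C i. \<exists>x\<in>B i. R v x) \<and>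
        anticomplete R X (C i) \<and> complete R Y (C i) \<and> anticomplete R Y (B i)) \<and>
     (\<forall>i\<in>I. \<forall>k\<in>I. complete R (C i) (C k) \<and>
        (i \<noteq> k \<longrightarrow> anticomplete R (B i) (B k) \<and> anticomplete R (B i) (C k))) \<and>
     (\<forall>i\<in>I - {j}. complete R F (B i) \<and> complete R F (C i) \<and> anticomplete R X (B i)) \<and>
     anticomplete R F (B j) \<and> anticomplete R F (C j) \<and>
     complete R F A \<and> complete R F X \<and> complete R F Y \<and>
     complete R X A \<and> complete R X (B j) \<and> anticomplete R X Y \<and> anticomplete R Y A \<and>
     (if F = {} then X = {} \<and> Y = {} else complete R (B j) (C j)) \<and>
     ((\<forall>i\<in>I. complete R A (B i)) \<or>
      X = {} \<and> Y = {} \<and> card I = 3 \<and> (\<forall>i\<in>I. complete R (B i) (C i)) \<and>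
      (\<exists>i\<in>I. \<forall>k\<in>I - {i}. complete R A (B k)))"

lemma completeI: "(\<And>x y. x \<in> S \<Longrightarrow> y \<in> T \<Longrightarrow> R x y) \<Longrightarrow> complete R S T"
  and anticompleteI: "(\<And>x y. x \<in> S \<Longrightarrow> y \<in> T \<Longrightarrow> \<not> R x y) \<Longrightarrow> anticomplete R S T"
  unfolding complete_def anticomplete_def by blast+

context pentagon_graph_F begin

section \<open>Adjacencies of \<open>F\<close>, \<open>U\<close>, \<open>X\<close> and
  \<open>Y\<close>\<close>

lemma F_W: "f \<in> F j0 \<Longrightarrow> f \<in> W" and U_W: "u \<in> U \<Longrightarrow> u \<in> W"
  using W_cases by blast+

text \<open>A middle vertex has a neighbour in \<open>A\<close> and one in the base. These are
  nonadjacent and both seen by \<open>w\<close>.\<close>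

lemma W_P:
  assumes w: "w \<in> W" and v: "v \<in> P i" and i: "i \<in> I" "i \<noteq> j0 \<or> w \<in> U"
  shows "R w v"
proof -
  obtain x d where x: "x \<in> A" "R v x" and d: "d \<in> Q i" "R v d" using B_has_A P_B P_Q v i by metis
  have "R w d" using W_B_D[OF w P_B[OF v] Q_D[OF d(1)] i(1) d(2) i(2)] .
  then show ?thesis using C4[of w x v d] x d W_A[OF w x(1)] A_D[OF x(1) Q_D[OF d(1)]] sym by metis
qed

lemma W_Q:
  assumes w: "w \<in> W" and d: "d \<in> Q i" and i: "i \<in> I" "i \<noteq> j0 \<or> w \<in> U"
  shows "R w d"
  using W_B_D[OF w] d i unfolding Q_def by blast

lemma F_Q:
  assumes f: "f \<in> F j0" and d: "d \<in> Q j0"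
  shows "\<not> R f d"
proof (cases "R d (b j0)")
  case True
  then show ?thesis using F_D f Q_D[OF d] by blast
next
  case False
  obtain w where w: "w \<in> B j0" "R w d" using d unfolding Q_def by blast
  have wa: "R w a" "R w (c j0)" using B_D_link[OF w(1) Q_D[OF d] j0 w(2)] B_D_a[OF w(1) Q_D[OF d] j0 w(2)] False by blast+
  obtain k where k: "k \<in> I" "k \<noteq> j0" using ex_index by metis
  have fw: "\<not> R f w"
    using C4[of f w "c j0" "c k"] wa F_not[OF f] W_bc[OF F_W[OF f] k(1)] k B_c[OF w(1) k] cc j0 sym by metis
  have "\<not> R d a" using Q_D[OF d] unfolding D_def by blast
  then show ?thesis using C4[of f a w d] fw wa w W_a[OF F_W[OF f]] sym by metis
qed

lemma F_P:
  assumes f: "f \<in> F j0" and w: "w \<in> P j0"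
  shows "\<not> R f w"
proof -
  obtain d where d: "d \<in> Q j0" "R w d" using P_Q w by blast
  obtain k where k: "k \<in> I" "k \<noteq> j0" using ex_index by metis
  show ?thesis
    using C4[of f w d "c k"] F_Q[OF f d(1)] d k B_c[OF P_B[OF w] k] D_c[OF Q_D[OF d(1)] k(1)]
      W_bc[OF F_W[OF f] k(1)] sym by metis
qed

text \<open>\<open>f\<close> joins two \<open>b\<close>s of other arms into a path anticomplete to
  arm \<open>j0\<close>, so that arm contains no induced path on three vertices. The same path
  serves \<open>F_X\<close> and \<open>F_Y\<close>.\<close>

lemma F_P_Q:
  assumes f: "f \<in> F j0" and w: "w \<in> P j0" and d: "d \<in> Q j0"
  shows "R w d"
proof (rule ccontr)
  assume n: "\<not> R w d"
  obtain e where e: "e \<in> Q j0" "R w e" using P_Q w by blast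
  obtain k l where kl: "k \<in> I" "l \<in> I" "k \<noteq> j0" "l \<noteq> j0" "k \<noteq> l" using ex_two_indices by metis
  have B: "w \<in> B j0" "b k \<in> B k" "b l \<in> B l" using w P_B b_B kl by blast+
  show False
    using P2[of w e d "b k" f "b l"] n e kl j0 B_anticomplete[OF B(1,2)] B_anticomplete[OF B(1,3)] bb
      B_Q[OF B(2) d] B_Q[OF B(3) d] B_Q[OF B(2) e(1)] B_Q[OF B(3) e(1)] F_P[OF f w] F_Q[OF f d] F_Q[OF f e(1)]
      W_bc[OF F_W[OF f] kl(1)] W_bc[OF F_W[OF f] kl(2)] D_clique[OF Q_D[OF e(1)] Q_D[OF d]] sym by metis
qed

lemma X_B: "x \<in> X i \<Longrightarrow> x \<in> B i" and X_D: "\<lbrakk>x \<in> X i; d \<in> D\<rbrakk> \<Longrightarrow> \<not> R x d"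
  unfolding X_def by blast+

lemma Y_D: "y \<in> Y \<Longrightarrow> y \<in> D" and Y_B: "\<lbrakk>y \<in> Y; v \<in> B i; i \<in> I\<rbrakk> \<Longrightarrow> \<not> R v y"
  unfolding Y_def by blast+

lemma F_X:
  assumes f: "f \<in> F j0" and x: "x \<in> X j0"
  shows "R f x"
proof (rule ccontr)
  assume n: "\<not> R f x"
  obtain k l where kl: "k \<in> I" "l \<in> I" "k \<noteq> j0" "l \<noteq> j0" "k \<noteq> l" using ex_two_indices by metis
  have B: "x \<in> B j0" "b k \<in> B k" "b l \<in> B l" using x X_B b_B kl by blast+
  show False
    using P2[of x "b j0" "c j0" "b k" f "b l"] n kl j0 B_anticomplete[OF B(1,2)] B_anticomplete[OF B(1,3)] bb bc
      B_bi[OF B(1)] X_D[OF x c_D[OF j0]] F_not[OF f]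
      W_bc[OF F_W[OF f] kl(1)] W_bc[OF F_W[OF f] kl(2)] sym by metis
qed

lemma F_Y:
  assumes f: "f \<in> F j0" and y: "y \<in> Y"
  shows "R f y"
proof (rule ccontr)
  assume n: "\<not> R f y"
  obtain k l where kl: "k \<in> I" "l \<in> I" "k \<noteq> j0" "l \<noteq> j0" "k \<noteq> l" using ex_two_indices by metis
  show False
    using P2[of y "c j0" "b j0" "b k" f "b l"] n kl j0 Y_B[OF y b_B] D_c[OF Y_D[OF y]] bb bc F_not[OF f]
      W_bc[OF F_W[OF f] kl(1)] W_bc[OF F_W[OF f] kl(2)] sym by metis
qed

text \<open>Whether \<open>x\<close> sees \<open>v\<close> is not yet known. If it does, the path
  \<open>x\<close>, \<open>w\<close>, \<open>d\<close> closes to a 6-cycle through \<open>v\<close>;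
  if not, that path is anticomplete to \<open>b k\<close>, \<open>v\<close>,
  \<open>b l\<close>.\<close>

lemma X_P_A:
  assumes x: "x \<in> X j0" and v: "v \<in> A" and w: "w \<in> P j0"
  shows "R v w"
proof (rule ccontr)
  assume n: "\<not> R v w"
  obtain d where d: "d \<in> Q j0" "R w d" using P_Q w by blast
  obtain k l where kl: "k \<in> I" "l \<in> I" "k \<noteq> j0" "l \<noteq> j0" "k \<noteq> l" using ex_two_indices by metis
  have r: "R v (b k)" "R v (b l)" using A_miss_one[OF v w n b_P j0] kl by metis+
  have B: "x \<in> B j0" "w \<in> B j0" "b k \<in> B k" "b l \<in> B l" using x w P_B X_B b_B kl by blast+
  note facts = n d kl r j0 B_clique[OF B(1,2) j0] B_anticomplete[OF B(1,3)] B_anticomplete[OF B(1,4)]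
    B_anticomplete[OF B(2,3)] B_anticomplete[OF B(2,4)] X_D[OF x Q_D[OF d(1)]] X_D[OF x c_D[OF kl(1)]]
    A_D[OF v Q_D[OF d(1)]] A_c[OF v kl(1)] B_c[OF B(2) kl(1)] D_c[OF Q_D[OF d(1)] kl(1)]
    B_Q[OF B(3) d(1)] B_Q[OF B(4) d(1)] bc[OF kl(1) kl(1)] bb[OF kl(1,2)]
  show False
  proof (cases "R x v")
    case True
    then show ?thesis using C6[of x w d "c k" "b k" v] facts sym by metis
  next
    case False
    then show ?thesis using P2[of x w d "b k" v "b l"] facts sym by metis
  qed
qed

lemma X_A:
  assumes f: "f \<in> F j0" and x: "x \<in> X j0" and v: "v \<in> A"
  shows "R x v"
  using C4[of x "b j0" v f] X_P_A[OF x v b_P[OF j0]] F_not[OF f] F_X[OF f x] W_A[OF F_W[OF f] v]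
    B_bi[OF X_B[OF x] j0] sym by metis

text \<open>Together with \<open>Y_imp_A_complete\<close> this says that an inhabited
  \<open>X j0\<close> or \<open>Y\<close> excludes the basket.\<close>

lemma X_imp_A_complete:
  assumes f: "f \<in> F j0" and x: "x \<in> X j0" and v: "v \<in> A" and w: "w \<in> P i" and i: "i \<in> I"
  shows "R v w"
proof (cases "i = j0")
  case True
  then show ?thesis using X_P_A x v w by blast
next
  case False
  show ?thesis
  proof (rule ccontr)
    assume n: "\<not> R v w"
    obtain d where d: "d \<in> Q i" "R w d" using P_Q w by blast
    obtain l where l: "l \<in> I" "l \<noteq> i" "l \<noteq> j0" using ex_index by metis
    have r: "R v (b l)" using A_miss_one[OF v w n b_P i] l by metis
    have B: "x \<in> B j0" "w \<in> B i" "b l \<in> B l" using x w P_B X_B b_B l by blast+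
    show False
      using P2[of x v "b l" w d "c j0"] X_A[OF f x v] n d l r j0 i False B_anticomplete[OF B(1,2)]
        B_anticomplete[OF B(1,3)] B_anticomplete[OF B(2,3)] X_D[OF x Q_D[OF d(1)]] X_D[OF x c_D[OF j0]]
        A_D[OF v Q_D[OF d(1)]] A_c[OF v j0] B_c[OF B(2) j0] B_Q[OF B(3) d(1)] D_c[OF Q_D[OF d(1)] j0]
        bc[OF l(1) j0] sym by metis
  qed
qed

lemma Y_imp_A_complete:
  assumes y: "y \<in> Y" and v: "v \<in> A" and w: "w \<in> P i" and i: "i \<in> I"
  shows "R v w"
proof (rule ccontr)
  assume n: "\<not> R v w"
  obtain d where d: "d \<in> Q i" "R w d" using P_Q w by blast
  obtain k l where kl: "k \<in> I" "l \<in> I" "k \<noteq> i" "l \<noteq> i" "k \<noteq> l" using ex_two_indices by metis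
  have r: "R v (b k)" "R v (b l)" using A_miss_one[OF v w n b_P i] kl by metis+
  have B: "w \<in> B i" "b k \<in> B k" "b l \<in> B l" using w P_B b_B kl by blast+
  show False
    using P2[of w d y "b k" v "b l"] n d kl r i B_anticomplete[OF B(1,2)] B_anticomplete[OF B(1,3)] bb
      Y_B[OF y B(1) i] Y_B[OF y B(2)] Y_B[OF y B(3)] A_D[OF v Q_D[OF d(1)]] A_D[OF v Y_D[OF y]]
      B_Q[OF B(2) d(1)] B_Q[OF B(3) d(1)] D_clique[OF Q_D[OF d(1)] Y_D[OF y]] sym by metis
qed

lemma nested_cliques:
  assumes "\<And>x y. x \<in> S \<Longrightarrow> y \<in> S \<Longrightarrow> R x y" "\<And>x y. x \<in> T \<Longrightarrow> y \<in> T \<Longrightarrow> R x y"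
  shows "nested R S T"
  unfolding nested_def using C4 assms sym by metis

text \<open>The classes \<open>B i\<close> and \<open>D\<close> enter as \<open>P i\<close> and
  \<open>Q i\<close>. The remainder \<open>X j0\<close> moves from the middle to the top, and
  \<open>Y\<close> is the part of the base that belongs to no arm.\<close>

lemma blueprint:
  "blueprint R I j0 A P Q (F j0) (X j0) Y U"
  unfolding blueprint_def
proof (intro conjI ballI)
  have V: "v \<in> A \<or> (\<exists>i\<in>I. v \<in> P i) \<or> (\<exists>i\<in>I. v \<in> Q i) \<or> v \<in> F j0 \<or> v \<in> X j0 \<or> v \<in> Y \<or> v \<in> U"
    if "R v v" for v
  proof -
    have "v \<in> P i \<or> v \<in> X j0" if "v \<in> B i" "i \<in> I" for i
      using that X_empty unfolding P_def by blast
    moreover have "(\<exists>i\<in>I. v \<in> Q i) \<or> v \<in> Y" if "v \<in> D" using that unfolding Q_def Y_def by blast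
    ultimately show ?thesis using nbr_cases[OF that] W_cases[of v] S3_empty[of v] by metis
  qed
  have aV: "R v v" if "v \<in> A \<or> (\<exists>i\<in>I. v \<in> P i) \<or> (\<exists>i\<in>I. v \<in> Q i) \<or> v \<in> F j0 \<or> v \<in> X j0 \<or> v \<in> Y \<or> v \<in> U" for v
    using that A_clique B_clique P_B X_B j0 Q_D D_clique Y_D W_clique W_cases by metis
  show "{v. R v v} = A \<union> \<Union> (P ` I) \<union> \<Union> (Q ` I) \<union> F j0 \<union> X j0 \<union> Y \<union> U" (is "?L = ?R")
  proof (rule set_eqI)
    fix v
    have "v \<in> ?R \<longleftrightarrow> v \<in> A \<or> (\<exists>i\<in>I. v \<in> P i) \<or> (\<exists>i\<in>I. v \<in> Q i) \<or> v \<in> F j0 \<or> v \<in> X j0 \<or> v \<in> Y \<or> v \<in> U"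
      by blast
    then show "v \<in> ?L \<longleftrightarrow> v \<in> ?R" using V[of v] aV[of v] unfolding mem_Collect_eq by metis
  qed
  show "complete R U {v. R v v}"
    unfolding complete_def
  proof (intro ballI)
    fix u v assume u: "u \<in> U" and "v \<in> {v. R v v}"
    then have v: "R v v" by blast
    \<comment> \<open>A vertex in \<open>X j0\<close> implies that some \<open>f\<close> exists, and
      then \<open>b j0\<close> and \<open>f\<close> are nonadjacent common neighbours of
      \<open>u\<close> and \<open>v\<close>. For \<open>Y\<close> the vertex \<open>c j0\<close>
      takes the place of \<open>b j0\<close>.\<close>
    have uX: "R u v" if x: "v \<in> X j0"
    proof -
      obtain f where f: "f \<in> F j0" using X_empty j0 x by blast
      then show ?thesis using C4[of u "b j0" v f] F_X[OF f x] F_not[OF f] W_clique[OF U_W[OF u] F_W[OF f]]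
          B_bi[OF X_B[OF x] j0] W_bc[OF U_W[OF u] j0] u sym by metis
    qed
    have uY: "R u v" if x: "v \<in> Y"
    proof -
      obtain f where f: "f \<in> F j0" using Y_empty x by blast
      then show ?thesis using C4[of u "c j0" v f] F_Y[OF f x] F_not[OF f] W_clique[OF U_W[OF u] F_W[OF f]]
          D_c[OF Y_D[OF x] j0] W_bc[OF U_W[OF u] j0] u sym by metis
    qed
    show "R u v"
      using V[OF v] uX uY u W_A[OF U_W[OF u]] W_P[OF U_W[OF u]] W_Q[OF U_W[OF u]] W_clique[OF U_W[OF u]] F_W U_W
      by blast
  qed
  show "if F j0 = {} then X j0 = {} \<and> Y = {} else complete R (P j0) (Q j0)"
    using X_empty[OF j0] Y_empty F_P_Q unfolding complete_def by auto
  show "A \<noteq> {}" using B_has_A[OF b_B[OF j0] j0] by blast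
  show "(\<forall>i\<in>I. complete R A (P i)) \<or>
      X j0 = {} \<and> Y = {} \<and> card I = 3 \<and> (\<forall>i\<in>I. complete R (P i) (Q i)) \<and>
      (\<exists>i\<in>I. \<forall>k\<in>I - {i}. complete R A (P k))"
  proof (cases "\<forall>i\<in>I. complete R A (P i)")
    case False
    then obtain i v w where i: "i \<in> I" and v: "v \<in> A" and w: "w \<in> P i" "\<not> R v w"
      unfolding complete_def by blast
    have "X j0 = {}"
      using X_imp_A_complete[OF _ _ v w(1) i] w(2) X_empty[OF j0] by blast
    moreover have "Y = {}" using Y_imp_A_complete[OF _ v w(1) i] w(2) by blast
    moreover have "card I = 3"
    proof -
      obtain k l where kl: "k \<in> I" "l \<in> I" "k \<noteq> i" "l \<noteq> i" "k \<noteq> l" using ex_two_indices by metis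
      have "I = {i, k, l}"
        using A_incomplete_index[OF v w i kl(1) kl(2) _ kl(3) kl(4) _ kl(5)] i kl by blast
      then show ?thesis using kl by simp
    qed
    moreover have "complete R (P k) (Q k)" if "k \<in> I" for k
      using A_incomplete_P_Q[OF v w i that] unfolding complete_def by blast
    moreover have "complete R A (P k)" if "k \<in> I - {i}" for k
      using A_incomplete_unique[OF v w _ _ _ i] that unfolding complete_def by blast
    ultimately show ?thesis using i by blast
  qed blast
  show "nested R A (P i)" if "i \<in> I" for i
    by (rule nested_cliques; use A_clique B_clique P_B that in blast)
  show "nested R (P i) (Q i)" if "i \<in> I" for i
    by (rule nested_cliques; use D_clique Q_D B_clique P_B that in blast)
  show "j0 \<in> I" by (rule j0)
  show "complete R A A" by (intro completeI A_clique)
  show "complete R (F j0) (F j0)" by (intro completeI W_clique F_W)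
  show "complete R (X j0) (X j0)" by (intro completeI B_clique[OF X_B X_B j0])
  show "complete R Y Y" by (intro completeI D_clique Y_D)
  show "anticomplete R (F j0) (P j0)" by (intro anticompleteI F_P)
  show "anticomplete R (F j0) (Q j0)" by (intro anticompleteI F_Q)
  show "complete R (F j0) A" by (intro completeI W_A F_W)
  show "complete R (F j0) (X j0)" by (intro completeI F_X)
  show "complete R (F j0) Y" by (intro completeI F_Y)
  show "complete R (X j0) (P j0)" by (intro completeI B_clique[OF X_B P_B j0])
  show "anticomplete R (X j0) Y" by (intro anticompleteI X_D Y_D)
  show "anticomplete R Y A"
    using A_D[OF _ Y_D] sym unfolding anticomplete_def by blast
  show "complete R (X j0) A" using X_A X_empty[OF j0] unfolding complete_def by blast
  fix i assume i: "i \<in> I"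
  show "P i \<noteq> {}" "Q i \<noteq> {}" using b_P c_Q i by blast+
  show "complete R (P i) (P i)" by (intro completeI B_clique[OF P_B P_B i])
  show "anticomplete R A (Q i)" by (intro anticompleteI A_D Q_D)
  show "anticomplete R (X j0) (Q i)" by (intro anticompleteI X_D Q_D)
  show "complete R Y (Q i)" by (intro completeI D_clique Y_D Q_D)
  show "anticomplete R Y (P i)"
    using Y_B[OF _ P_B i] sym unfolding anticomplete_def by blast
  show "\<exists>x\<in>A. R v x" "\<exists>x\<in>Q i. R v x" if "v \<in> P i" for v
    using B_has_A[OF P_B[OF that] i] P_Q[OF that] by blast+
  show "\<exists>x\<in>P i. R v x" if "v \<in> Q i" for v using Q_P[OF that] sym by blast
  fix k assume k: "k \<in> I"
  show "complete R (Q i) (Q k)" using D_clique Q_D unfolding complete_def by blast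
  show "i \<noteq> k \<longrightarrow> anticomplete R (P i) (P k) \<and> anticomplete R (P i) (Q k)"
    using B_anticomplete[OF P_B P_B i k] B_Q[OF P_B _ i k] unfolding anticomplete_def by blast
next
  fix i assume "i \<in> I - {j0}"
  then have i: "i \<in> I" "i \<noteq> j0" by blast+
  show "complete R (F j0) (P i)" "complete R (F j0) (Q i)" "anticomplete R (X j0) (P i)"
    using W_P[OF F_W _ i(1)] W_Q[OF F_W _ i(1)] i B_anticomplete[OF X_B P_B j0 i(1)]
    unfolding complete_def anticomplete_def by blast+
qed

end

section \<open>Blueprints avoid the forbidden graphs\<close>

text \<open>Labels: 0 for top, 1 for middle, 2 for base.\<close>

definition path_labels :: "nat \<Rightarrow> nat \<Rightarrow> nat \<Rightarrow> nat \<Rightarrow> bool" where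
  "path_labels w x y z \<longleftrightarrow> (w, x, y, z) \<in> {(1,0,1,2), (2,1,0,1), (1,0,1,1), (1,1,0,1), (0,0,1,1), (1,1,0,0),
    (0,0,1,2), (2,1,0,0), (0,1,2,2), (2,2,1,0), (1,2,2,1), (1,1,2,2), (2,2,1,1)}"

text \<open>The five rotations of the pentagon's own labelling; read from its top, that word is its
  own mirror image.\<close>

definition pentagon_labels :: "nat \<Rightarrow> nat \<Rightarrow> nat \<Rightarrow> nat \<Rightarrow> nat \<Rightarrow> bool" where
  "pentagon_labels v w x y z \<longleftrightarrow>
     (v, w, x, y, z) \<in> {(0,1,2,2,1), (1,0,1,2,2), (2,1,0,1,2), (2,2,1,0,1), (1,2,2,1,0)}"

text \<open>Any four consecutive vertices of a hole of length at least five induce a path. The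
  lemmas on cycles search for cyclic words whose windows of length four are all allowed.\<close>

lemma path_labels_C5:
  assumes "path_labels v w x y" "path_labels w x y z" "path_labels x y z v" "path_labels y z v w"
  shows "pentagon_labels v w x y z"
  using assms(1) unfolding path_labels_def insert_iff empty_iff prod.inject
  by (elim disjE conjE; use assms(2-) in \<open>auto simp: path_labels_def pentagon_labels_def\<close>)

lemma path_labels_C6:
  assumes "path_labels u v w x" "path_labels v w x y" "path_labels w x y z" "path_labels x y z u"
    "path_labels y z u v" "path_labels z u v w"
  shows False
  using assms(1) unfolding path_labels_def insert_iff empty_iff prod.inject
  by (elim disjE conjE; use assms(2-) in \<open>auto simp: path_labels_def\<close>)

text \<open>Gluing two windows into a word of length five keeps the search for the 7-cycle small:
  three such words overlap around the cycle.\<close>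

lemma path_labels_step:
  assumes "path_labels v w x y" "path_labels w x y z"
  shows "(v, w, x, y, z) \<in> {(1,0,1,2,2), (0,0,1,2,2), (0,1,2,2,1), (1,2,2,1,0), (2,2,1,0,1), (2,2,1,0,0),
    (2,1,0,1,2), (2,1,0,1,1), (1,1,0,1,2), (1,1,0,1,1), (1,1,2,2,1), (1,2,2,1,1)}"
  using assms(1) unfolding path_labels_def insert_iff empty_iff prod.inject
  by (elim disjE conjE; use assms(2-) in \<open>simp add: path_labels_def\<close>)

lemma path_labels_C7:
  assumes "path_labels s u v w" "path_labels u v w x" "path_labels v w x y" "path_labels w x y z"
    "path_labels x y z s" "path_labels y z s u"
  shows False
  using path_labels_step[OF assms(1,2)] unfolding insert_iff empty_iff prod.inject
  by (elim disjE conjE; use path_labels_step[OF assms(3,4)] path_labels_step[OF assms(5,6)] in \<open>auto\<close>)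

text \<open>The hypotheses are three 5-cycles of \<open>T0\<close> through \<open>p\<close>; each
  two of them share a path, and only a labelling with the top at \<open>p\<close> suits all
  three.\<close>

lemma pentagon_labels_T0:
  assumes "pentagon_labels p u0 w1 w2 u2" "pentagon_labels p u0 w1 w3 u3" "pentagon_labels p u2 w2 w3 u3"
  shows "p = 0 \<and> u0 = 1 \<and> w1 = 2"
  using assms(1) unfolding pentagon_labels_def insert_iff empty_iff prod.inject
  by (elim disjE conjE; use assms(2-) in \<open>auto simp: pentagon_labels_def\<close>)

locale blueprint_graph = refl_graph +
  fixes I :: "nat set" and j A B C F X Y U
  assumes bp: "blueprint R I j A B C F X Y U"
    and cardI: "card I \<ge> 3"
begin

lemma ex_index: "\<exists>k\<in>I. k \<noteq> i \<and> k \<noteq> l"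
  using ex_third[OF cardI] .

lemma jI: "j \<in> I"
  and V_eq: "{v. R v v} = A \<union> (\<Union>i\<in>I. B i) \<union> (\<Union>i\<in>I. C i) \<union> F \<union> X \<union> Y \<union> U"
  and A_ne: "A \<noteq> {}"
  and AA: "complete R A A" and FF: "complete R F F" and XX: "complete R X X" and YY: "complete R Y Y"
  and FB': "anticomplete R F (B j)" and FC': "anticomplete R F (C j)"
  and FA: "complete R F A" and FX: "complete R F X" and FY: "complete R F Y"
  and XA: "complete R X A" and XB: "complete R X (B j)" and XY: "anticomplete R X Y" and YA: "anticomplete R Y A"
  using bp unfolding blueprint_def by simp_all

lemma UV: "complete R U {v. R v v}"
  using bp unfolding blueprint_def by (elim conjE)

lemma
  assumes "i \<in> I"
  shows B_ne: "B i \<noteq> {}" and C_ne: "C i \<noteq> {}" and BB: "complete R (B i) (B i)"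
    and AC: "anticomplete R A (C i)" and nestAB: "nested R A (B i)" and nestBC: "nested R (B i) (C i)"
    and B_A: "v \<in> B i \<Longrightarrow> \<exists>x\<in>A. R v x" and B_C: "v \<in> B i \<Longrightarrow> \<exists>x\<in>C i. R v x"
    and C_B: "v \<in> C i \<Longrightarrow> \<exists>x\<in>B i. R v x"
    and XC: "anticomplete R X (C i)" and YC: "complete R Y (C i)" and YB: "anticomplete R Y (B i)"
  using bp assms unfolding blueprint_def by simp_all

lemma
  assumes "i \<in> I" "k \<in> I"
  shows CC: "complete R (C i) (C k)"
    and BB': "i \<noteq> k \<Longrightarrow> anticomplete R (B i) (B k)" and BC': "i \<noteq> k \<Longrightarrow> anticomplete R (B i) (C k)"
  using bp assms unfolding blueprint_def by simp_all

lemma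
  assumes "i \<in> I" "i \<noteq> j"
  shows FB: "complete R F (B i)" and FC: "complete R F (C i)" and XB': "anticomplete R X (B i)"
  using bp assms unfolding blueprint_def by simp_all

lemma FXY: "F = {} \<Longrightarrow> X = {} \<and> Y = {}"
  and F_BC: "f \<in> F \<Longrightarrow> complete R (B j) (C j)"
  using bp unfolding blueprint_def by (auto split: if_splits)

lemma AB_or: "(\<forall>i\<in>I. complete R A (B i)) \<or>
      X = {} \<and> Y = {} \<and> card I = 3 \<and> (\<forall>i\<in>I. complete R (B i) (C i)) \<and>
      (\<exists>i\<in>I. \<forall>k\<in>I - {i}. complete R A (B k))"
  using bp unfolding blueprint_def by (elim conjE)

section \<open>Layers and labels of a blueprint\<close>

definition T where "T = A \<union> X"
definition K where "K = (\<Union>i\<in>I. C i) \<union> Y"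
definition BU where "BU = (\<Union>i\<in>I. B i)"

lemmas cdefs = complete_def anticomplete_def

lemma inV: "R x y \<Longrightarrow> R y y"
  using refl sym by blast

lemma V_cases: "R x x \<Longrightarrow> x \<in> T \<or> x \<in> BU \<or> x \<in> K \<or> x \<in> F \<or> x \<in> U"
  using V_eq unfolding T_def K_def BU_def by blast

lemma TT: "\<lbrakk>x \<in> T; y \<in> T\<rbrakk> \<Longrightarrow> R x y"
  using AA XX XA sym unfolding cdefs T_def by blast

lemma KK: "\<lbrakk>x \<in> K; y \<in> K\<rbrakk> \<Longrightarrow> R x y"
  using YY CC YC sym unfolding cdefs K_def by blast

lemma TK: "\<lbrakk>x \<in> T; y \<in> K\<rbrakk> \<Longrightarrow> \<not> R x y"
  using AC XC XY YA sym unfolding cdefs K_def T_def by blast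

lemma BUE:
  assumes "x \<in> BU" obtains i where "i \<in> I" "x \<in> B i"
  using assms unfolding BU_def by blast

lemma B_eq: "\<lbrakk>x \<in> B i; y \<in> B k; i \<in> I; k \<in> I; R x y\<rbrakk> \<Longrightarrow> i = k"
  using BB' unfolding cdefs by blast

lemma B_adj: "\<lbrakk>x \<in> B i; y \<in> B i; i \<in> I\<rbrakk> \<Longrightarrow> R x y"
  using BB unfolding cdefs by blast

lemma K_C: "\<lbrakk>x \<in> B i; i \<in> I; k \<in> K; R x k\<rbrakk> \<Longrightarrow> k \<in> C i"
  using YB BC' sym unfolding cdefs K_def by blast

lemma K_B_eq: "\<lbrakk>x \<in> B i; y \<in> B l; i \<in> I; l \<in> I; k \<in> K; R x k; R y k\<rbrakk> \<Longrightarrow> i = l"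
  using K_C BC' unfolding cdefs by blast

lemma K_BB: "\<lbrakk>x \<in> BU; y \<in> BU; k \<in> K; R x k; R k y\<rbrakk> \<Longrightarrow> R x y"
  using K_B_eq B_adj sym by (metis BUE)

lemma BBB: "\<lbrakk>x \<in> BU; y \<in> BU; z \<in> BU; R x y; R y z\<rbrakk> \<Longrightarrow> R x z"
  using B_eq B_adj by (metis BUE)

text \<open>Adding \<open>X\<close> to the top preserves nesting, since \<open>X\<close> is complete
  to \<open>B j\<close> and anticomplete to every other middle.\<close>

lemma nestT:
  assumes "p \<in> T" "q \<in> T" "x \<in> BU" "y \<in> BU" "R x y" "R p x" "R q y"
  shows "R p y \<or> R q x"
proof -
  obtain i where i: "i \<in> I" "x \<in> B i" "y \<in> B i" using BUE B_eq assms by metis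
  show ?thesis
  proof (cases "p \<in> X \<or> q \<in> X")
    case True
    then have "i = j" using XB'[OF i(1)] assms i unfolding cdefs by blast
    then show ?thesis using True XB i unfolding cdefs by blast
  next
    case False
    then show ?thesis using nestAB[OF i(1)] assms i unfolding nested_def T_def by blast
  qed
qed

lemma nestK:
  assumes "p \<in> K" "q \<in> K" "x \<in> BU" "y \<in> BU" "R x y" "R x p" "R y q"
  shows "R y p \<or> R x q"
proof -
  obtain i where i: "i \<in> I" "x \<in> B i" "y \<in> B i" using BUE B_eq assms by metis
  then have "p \<in> C i" "q \<in> C i" using K_C assms by blast+
  then show ?thesis using nestBC[OF i(1)] assms i unfolding nested_def by blast
qed

text \<open>A top vertex that sees one vertex of a middle and misses another occurs only in a
  basket, where each middle is complete to its base.\<close>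

lemma TBBK:
  assumes "p \<in> T" "x \<in> BU" "y \<in> BU" "k \<in> K" "R p x" "R x y" "R y k" "\<not> R p y"
  shows "R x k"
proof -
  obtain i where i: "i \<in> I" "x \<in> B i" "y \<in> B i" using BUE B_eq assms by metis
  have "p \<notin> X"
  proof
    assume p: "p \<in> X"
    then have "i = j" using XB'[OF i(1)] assms i unfolding cdefs by blast
    then show False using p XB i assms unfolding cdefs by blast
  qed
  then have "\<not> complete R A (B i)" using assms i unfolding cdefs T_def by blast
  then have "complete R (B i) (C i)" using AB_or i by blast
  then show ?thesis using K_C[OF i(3,1)] assms i unfolding cdefs by blast
qed

text \<open>In a basket only one middle is incomplete to the top. Otherwise a top vertex missing a
  middle vertex lies in \<open>X\<close>, so \<open>p\<close> and \<open>q\<close> both see only the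
  middle of arm \<open>j\<close>.\<close>

lemma BTTB:
  assumes "p \<in> T" "q \<in> T" "x \<in> BU" "y \<in> BU" "R x p" "R q y" "\<not> R x q" "\<not> R p y"
  shows "R x y"
proof (rule ccontr)
  assume n: "\<not> R x y"
  obtain i k where ik: "i \<in> I" "x \<in> B i" "k \<in> I" "y \<in> B k" using BUE assms by metis
  then have ne: "i \<noteq> k" using n B_adj by blast
  have Xj: "l = j" if "r \<in> X" "R r z" "z \<in> B l" "l \<in> I" for r z l
    using XB' that unfolding cdefs by blast
  have XT: "r \<in> A \<or> r \<in> X" if "r \<in> T" for r using that unfolding T_def by blast
  from AB_or show False
  proof
    assume "\<forall>i\<in>I. complete R A (B i)"
    then have "p \<notin> A" "q \<notin> A" using assms ik sym unfolding cdefs by blast+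
    then have "p \<in> X" "q \<in> X" using XT assms by blast+
    then show False using Xj[of p x i] Xj[of q y k] ik assms ne sym by blast
  next
    assume h: "X = {} \<and> Y = {} \<and> card I = 3 \<and> (\<forall>i\<in>I. complete R (B i) (C i)) \<and>
      (\<exists>i\<in>I. \<forall>k\<in>I - {i}. complete R A (B k))"
    then have "p \<in> A" "q \<in> A" using XT assms by blast+
    then show False using h ik ne assms sym unfolding cdefs by blast
  qed
qed

lemma F_non:
  assumes "f \<in> F" "R x x" "\<not> R f x"
  shows "x \<in> B j \<or> x \<in> C j"
proof -
  have "R f x" if "x \<in> U" using that UV inV assms(1) FF sym unfolding cdefs by blast
  moreover have "x \<in> A \<or> (\<exists>i\<in>I. x \<in> B i \<or> x \<in> C i) \<or> x \<in> F \<or> x \<in> X \<or> x \<in> Y \<or> x \<in> U"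
    using V_eq assms(2) by blast
  ultimately show ?thesis using assms FA FX FY FF FB FC unfolding cdefs by blast
qed

lemma F_nonnbrs:
  assumes "f \<in> F" "R x x" "\<not> R f x" "R y y" "\<not> R f y"
  shows "R x y"
  using F_non[OF assms(1-3)] F_non[OF assms(1,4,5)] F_BC[OF assms(1)] BB[OF jI] CC[OF jI jI] sym
  unfolding cdefs by blast

text \<open>Hence \<open>f\<close> lies on no induced 4-cycle. Outside \<open>U\<close>, the common
  neighbours all lie in the top if \<open>z\<close> is in \<open>B j\<close>, and all in the base if
  \<open>z\<close> is in \<open>C j\<close>.\<close>

lemma F_common:
  assumes f: "f \<in> F" and z: "R z z" "\<not> R f z" and x: "R f x" "R x z" and y: "R f y" "R y z"
  shows "R x y"
proof -
  have U: "R u v" "R v u" if "u \<in> U" "R v v" for u v using that UV sym unfolding cdefs by blast+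
  have V: "R x x" "R y y" using x y refl by blast+
  have nF: "w \<notin> F" if "R w z" for w
  proof
    assume w: "w \<in> F"
    have "\<not> R w z" using F_non[OF f z] FB' FC' w unfolding cdefs by blast
    then show False using that by blast
  qed
  have nBj: "w \<notin> B j \<and> w \<notin> C j" if "R f w" for w using FB' FC' f that unfolding cdefs by blast
  show ?thesis
  proof (cases "x \<in> U \<or> y \<in> U")
    case True
    then show ?thesis using U V by blast
  next
    case nU: False
    show ?thesis
    proof (cases "z \<in> B j")
      case True
      have "w \<in> T" if w: "R f w" "R w z" "R w w" "w \<notin> U" for w
      proof -
        have "w \<notin> BU" using B_eq[OF _ True _ jI w(2)] nBj[OF w(1)] BUE by metis
        moreover have "w \<notin> K" using K_C[OF True jI _ sym[OF w(2)]] nBj[OF w(1)] by blast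
        ultimately show ?thesis using V_cases[OF w(3)] nF[OF w(2)] w(4) by blast
      qed
      then show ?thesis using TT x y V nU by blast
    next
      case False
      then have zC: "z \<in> C j" using F_non f z by blast
      then have zK: "z \<in> K" using jI unfolding K_def by blast
      have "w \<in> K" if w: "R f w" "R w z" "R w w" "w \<notin> U" for w
      proof -
        have "w \<notin> T" using TK zK w by blast
        moreover have "w \<notin> BU"
        proof
          assume "w \<in> BU"
          then obtain l where l: "l \<in> I" "w \<in> B l" using BUE by blast
          then have "l = j" using BC'[OF l(1) jI] zC w unfolding cdefs by blast
          then show False using nBj[OF w(1)] l by blast
        qed
        ultimately show ?thesis using V_cases[OF w(3)] nF[OF w(2)] w(4) by blast
      qed
      then show ?thesis using KK x y V nU by blast
    qed
  qed
qed

lemma U_adj: "\<lbrakk>u \<in> U; R x x\<rbrakk> \<Longrightarrow> R u x"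
  using UV unfolding cdefs by blast

text \<open>The non-neighbours of a vertex of \<open>F\<close> form a clique, and a vertex of
  \<open>U\<close> has none.\<close>

lemma TBK:
  assumes "R v v" "R x x" "R y y" "\<not> R v x" "\<not> R v y" "\<not> R x y"
  shows "v \<in> T \<or> v \<in> BU \<or> v \<in> K"
  using V_cases[OF assms(1)] F_nonnbrs U_adj assms by blast

lemma T_BU: "x \<in> T \<Longrightarrow> x \<notin> BU"
proof
  assume x: "x \<in> T" "x \<in> BU"
  then obtain i where i: "i \<in> I" "x \<in> B i" using BUE by blast
  then obtain d where "d \<in> C i" "R x d" using B_C by blast
  moreover then have "d \<in> K" using i unfolding K_def by blast
  ultimately show False using TK x by blast
qed

lemma K_BU: "x \<in> K \<Longrightarrow> x \<notin> BU"
proof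
  assume x: "x \<in> K" "x \<in> BU"
  then obtain i where i: "i \<in> I" "x \<in> B i" using BUE by blast
  then obtain d where "d \<in> A" "R x d" using B_A by blast
  then show False using TK[of d x] x sym unfolding T_def by blast
qed

text \<open>The value 3 stands for everything outside the three layers, so \<open>lab v < 3\<close>
  says that \<open>v\<close> lies in a layer.\<close>

definition lab :: "'a \<Rightarrow> nat" where
  "lab v = (if v \<in> T then 0 else if v \<in> BU then 1 else if v \<in> K then 2 else 3)"

lemma lab_T: "v \<in> T \<Longrightarrow> lab v = 0" and lab_B: "v \<in> BU \<Longrightarrow> lab v = 1"
  and lab_K: "v \<in> K \<Longrightarrow> lab v = 2"
  unfolding lab_def using T_BU K_BU TK[of v v] KK[of v v] by auto

lemma lab_iff: "lab v < 3 \<longleftrightarrow> v \<in> T \<or> v \<in> BU \<or> v \<in> K"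
  unfolding lab_def by auto

lemma lab_dest: "lab v = 0 \<Longrightarrow> v \<in> T" "lab v = 1 \<Longrightarrow> v \<in> BU" "lab v = 2 \<Longrightarrow> v \<in> K"
  unfolding lab_def by (auto split: if_splits)

lemma lab_TK: "R x y \<Longrightarrow> \<not> (lab x = 0 \<and> lab y = 2) \<and> \<not> (lab x = 2 \<and> lab y = 0)"
  using TK sym lab_dest by blast

lemma lab_clique: "\<not> R x y \<Longrightarrow> \<not> (lab x = 0 \<and> lab y = 0) \<and> \<not> (lab x = 2 \<and> lab y = 2)"
  using TT KK lab_dest by blast

lemma lab_BKB: "\<lbrakk>R x y; R y z; \<not> R x z\<rbrakk> \<Longrightarrow> \<not> (lab x = 1 \<and> (lab y = 2 \<or> lab y = 1) \<and> lab z = 1)"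
  using K_BB[of x z y] BBB[of x y z] sym lab_dest[of x] lab_dest[of y] lab_dest[of z] by metis

lemma lab_TBBK:
  assumes "R w x" "R x y" "R y z" "\<not> R w y" "\<not> R x z"
  shows "\<not> (lab w = 0 \<and> lab x = 1 \<and> lab y = 1 \<and> lab z = 2)"
  using TBBK[of w x y z] assms lab_dest[of w] lab_dest[of x] lab_dest[of y] lab_dest[of z] by metis

lemma lab_BTTB:
  assumes "R w x" "R y z" "\<not> R w y" "\<not> R x z" "\<not> R w z"
  shows "\<not> (lab w = 1 \<and> lab x = 0 \<and> lab y = 0 \<and> lab z = 1)"
  using BTTB[of x y w z] assms lab_dest[of w] lab_dest[of x] lab_dest[of y] lab_dest[of z] by metis

section \<open>Holes and T0 in a blueprint\<close>

lemma P4_labels: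
  assumes lt: "lab w < 3" "lab x < 3" "lab y < 3" "lab z < 3"
    and R: "R w x" "R x y" "R y z" "\<not> R w y" "\<not> R w z" "\<not> R x z"
  shows "path_labels (lab w) (lab x) (lab y) (lab z)"
proof -
  have c: "lab v = 0 \<or> lab v = 1 \<or> lab v = 2" if "lab v < 3" for v using that by linarith
  have S: "R y x" "R z y" "R x w" "\<not> R z x" "\<not> R y w" "\<not> R z w" using R sym by blast+
  \<comment> \<open>Each of the 81 label words outside \<open>path_labels\<close> breaks one of
    these rules. The rule for a path top, middle, middle, base is applied in both
    directions.\<close>
  note facts = lab_TK[OF R(1)] lab_TK[OF R(2)] lab_TK[OF R(3)] lab_clique[OF R(4)] lab_clique[OF R(5)]
    lab_clique[OF R(6)] lab_BKB[OF R(1,2,4)] lab_BKB[OF R(2,3,6)] lab_TBBK[OF R(1,2,3,4,6)]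
    lab_TBBK[OF S(2,1,3,4,5)] lab_BTTB[OF R(1,3,4,6,5)]
  show ?thesis
    using c[OF lt(1)] c[OF lt(2)] c[OF lt(3)] c[OF lt(4)] facts unfolding path_labels_def by (elim disjE; simp)
qed

lemma C5_labels:
  assumes lt: "lab v < 3" "lab w < 3" "lab x < 3" "lab y < 3" "lab z < 3"
    and R: "R v w" "R w x" "R x y" "R y z" "R z v" "\<not> R v x" "\<not> R v y" "\<not> R w y" "\<not> R w z" "\<not> R x z"
  shows "pentagon_labels (lab v) (lab w) (lab x) (lab y) (lab z)"
proof -
  have S: "\<not> R x v" "\<not> R y v" "\<not> R y w" "\<not> R z w" "\<not> R z x" using R sym by blast+
  show ?thesis
    using path_labels_C5[OF P4_labels[OF lt(1-4) R(1-3,6,7,8)] P4_labels[OF lt(2-5) R(2-4,8,9,10)]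
      P4_labels[OF lt(3-5) lt(1) R(3-5) R(10) S(1,2)] P4_labels[OF lt(4,5,1,2) R(4,5,1) S(2,3,4)]] .
qed

text \<open>The cycles that the rules for edges, non-edges and short paths leave over have two
  adjacent middle vertices whose other neighbours are both top or both base. These are crossing
  edges, which nesting forbids.\<close>

lemma no_C4:
  assumes R: "R x y" "R y z" "R z w" "R w x"
  shows "R x z \<or> R y w"
proof (rule ccontr)
  assume "\<not> ?thesis"
  then have n: "\<not> R x z" "\<not> R y w" "\<not> R z x" "\<not> R w y" using sym by blast+
  have S: "R y x" "R z y" "R w z" "R x w" "R x x" "R y y" "R z z" "R w w" using R sym refl by blast+
  \<comment> \<open>A vertex of \<open>F\<close> on the cycle would make its two neighbours there
    adjacent by \<open>F_common\<close>; a vertex of \<open>U\<close> sees everything.\<close>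
  have lt: "lab x < 3" "lab y < 3" "lab z < 3" "lab w < 3"
    using V_cases F_common[of x z y w] F_common[of z x y w] F_common[of y w x z] F_common[of w y x z]
      U_adj R S n unfolding lab_iff by blast+
  have c: "lab v = 0 \<or> lab v = 1 \<or> lab v = 2" if "lab v < 3" for v using that by linarith
  have nT: "\<not> (lab p = 0 \<and> lab q = 0 \<and> lab u = 1 \<and> lab v = 1)"
    if "R u v" "R p u" "R q v" "\<not> R p v" "\<not> R q u" for p q u v
    using nestT[of p q u v] that lab_dest[of p] lab_dest[of q] lab_dest[of u] lab_dest[of v] by metis
  have nK: "\<not> (lab p = 2 \<and> lab q = 2 \<and> lab u = 1 \<and> lab v = 1)"
    if "R u v" "R u p" "R v q" "\<not> R v p" "\<not> R u q" for p q u v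
    using nestK[of p q u v] that lab_dest[of p] lab_dest[of q] lab_dest[of u] lab_dest[of v] by metis
  have BKB: "\<not> (lab p = 1 \<and> (lab q = 2 \<or> lab q = 1) \<and> lab r = 1)" if "R p q" "R q r" "\<not> R p r" for p q r
    using lab_BKB that by blast
  note TK = lab_TK[OF R(1)] lab_TK[OF R(2)] lab_TK[OF R(3)] lab_TK[OF R(4)]
    lab_clique[OF n(1)] lab_clique[OF n(2)]
  note BKB = BKB[OF R(1,2) n(1)] BKB[OF R(2,3) n(2)] BKB[OF R(3,4) n(3)] BKB[OF R(4,1) n(4)]
  note TB = nT[OF R(1) R(4) S(2) n(4) n(3)] nT[OF R(2) R(1) S(3) n(1) n(4)] nT[OF R(3) R(2) S(4) n(2) n(1)]
    nT[OF R(4) R(3) S(1) n(3) n(2)]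
  note KB = nK[OF R(1) S(4) R(2) n(2) n(1)] nK[OF R(2) S(1) R(3) n(3) n(2)] nK[OF R(3) S(2) R(4) n(4) n(3)]
    nK[OF R(4) S(3) R(1) n(1) n(4)]
  show False
    using c[OF lt(1)] c[OF lt(2)] c[OF lt(3)] c[OF lt(4)] TK BKB TB KB by argo
qed

lemma no_C6:
  assumes R: "R u v" "R v w" "R w x" "R x y" "R y z" "R z u"
    and n: "\<not> R u w" "\<not> R u x" "\<not> R u y" "\<not> R v x" "\<not> R v y" "\<not> R v z"
       "\<not> R w y" "\<not> R w z" "\<not> R x z"
  shows False
proof -
  have S: "R u u" "R v v" "R w w" "R x x" "R y y" "R z z" using R refl by blast+
  have m: "\<not> R w u" "\<not> R x u" "\<not> R y u" "\<not> R x v" "\<not> R y v" "\<not> R z v" "\<not> R y w" "\<not> R z w" "\<not> R z x"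
    using n sym by blast+
  have lt: "lab u < 3" "lab v < 3" "lab w < 3" "lab x < 3" "lab y < 3" "lab z < 3"
    unfolding lab_iff
    using TBK[of u w y] TBK[of v x z] TBK[of w u y] TBK[of x v z] TBK[of y u w] TBK[of z v x] S n m by blast+
  show False
    using path_labels_C6[OF P4_labels[OF lt(1-4) R(1-3) n(1,2,4)] P4_labels[OF lt(2-5) R(2-4) n(4,5,7)]
      P4_labels[OF lt(3-6) R(3-5) n(7,8,9)] P4_labels[OF lt(4-6) lt(1) R(4-6) n(9) m(2,3)]
      P4_labels[OF lt(5,6,1,2) R(5,6,1) m(3,5) m(6)]
      P4_labels[OF lt(6,1,2,3) R(6,1,2) m(6,8) n(1)]] .
qed

lemma no_C7:
  assumes R: "R s u" "R u v" "R v w" "R w x" "R x y" "R y z" "R z s"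
    and n: "\<not> R s v" "\<not> R s w" "\<not> R s x" "\<not> R s y"
       "\<not> R u w" "\<not> R u x" "\<not> R u y" "\<not> R u z" "\<not> R v x" "\<not> R v y" "\<not> R v z"
       "\<not> R w y" "\<not> R w z" "\<not> R x z"
  shows False
proof -
  have S: "R s s" "R u u" "R v v" "R w w" "R x x" "R y y" "R z z" using R refl by blast+
  have m: "\<not> R v s" "\<not> R w s" "\<not> R x s" "\<not> R y s" "\<not> R w u" "\<not> R x u" "\<not> R y u" "\<not> R z u" "\<not> R x v"
    "\<not> R y v" "\<not> R z v" "\<not> R y w" "\<not> R z w" "\<not> R z x"
    using n sym by blast+
  have lt: "lab s < 3" "lab u < 3" "lab v < 3" "lab w < 3" "lab x < 3" "lab y < 3" "lab z < 3"
    unfolding lab_iff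
    using TBK[of s v y] TBK[of u w z] TBK[of v s x] TBK[of w u z] TBK[of x s v] TBK[of y s v] TBK[of z u w]
      S n m by blast+
  show False
    using path_labels_C7[OF P4_labels[OF lt(1-4) R(1-3) n(1,2,5)] P4_labels[OF lt(2-5) R(2-4) n(5,6,9)]
      P4_labels[OF lt(3-6) R(3-5) n(9,10,12)] P4_labels[OF lt(4-7) R(4-6) n(12,13,14)]
      P4_labels[OF lt(5-7) lt(1) R(5-7) n(14) m(3,4)] P4_labels[OF lt(6,7,1,2) R(6,7,1) m(4,7,8)]] .
qed

text \<open>The 5-cycles through \<open>p\<close> make \<open>u0\<close> a middle vertex and
  \<open>w1\<close> a base vertex; those through \<open>q\<close> make \<open>u1\<close> a middle
  vertex. But middle neighbours of one base vertex are adjacent.\<close>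

lemma no_T0:
  assumes R: "R p q" "R p u0" "R p u2" "R p u3" "R q u1" "R q u2" "R q u3"
       "R u0 w1" "R u1 w1" "R u2 w2" "R u3 w3" "R w1 w2" "R w1 w3" "R w2 w3"
    and n: "\<not> R p u1" "\<not> R p w1" "\<not> R p w2" "\<not> R p w3"
       "\<not> R q u0" "\<not> R q w1" "\<not> R q w2" "\<not> R q w3"
       "\<not> R u0 u1" "\<not> R u0 u2" "\<not> R u0 u3" "\<not> R u0 w2" "\<not> R u0 w3"
       "\<not> R u1 u2" "\<not> R u1 u3" "\<not> R u1 w2" "\<not> R u1 w3"
       "\<not> R u2 u3" "\<not> R u2 w1" "\<not> R u2 w3" "\<not> R u3 w1" "\<not> R u3 w2"
  shows False
proof -
  have S: "R p p" "R q q" "R u0 u0" "R u1 u1" "R u2 u2" "R u3 u3" "R w1 w1" "R w2 w2" "R w3 w3"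
    using R refl sym by blast+
  have m: "\<not> R u1 p" "\<not> R w1 p" "\<not> R w2 p" "\<not> R w3 p" "\<not> R u0 q" "\<not> R w1 q" "\<not> R w2 q" "\<not> R w3 q"
    "\<not> R u1 u0" "\<not> R u2 u0" "\<not> R u3 u0" "\<not> R u2 u1" "\<not> R u3 u1" "\<not> R w2 u1" "\<not> R u3 u2"
    "\<not> R w1 u2" "\<not> R w3 u2" "\<not> R w1 u3" "\<not> R w2 u3" "\<not> R w2 u0" "\<not> R w3 u0"
    using n sym by blast+
  have r: "R u2 p" "R u3 p" "R u2 q" "R u3 q" "R w1 u1" "R w2 u2" "R w3 u3"
    using R sym by blast+
  have lt: "lab p < 3" "lab q < 3" "lab u0 < 3" "lab u1 < 3" "lab u2 < 3" "lab u3 < 3" "lab w1 < 3"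
      "lab w2 < 3" "lab w3 < 3"
    unfolding lab_iff
    by (fact TBK[OF S(1,4,8) n(1,3,16)] TBK[OF S(2,3,8) n(5,7,12)] TBK[OF S(3,4,5) n(9,10,14)]
      TBK[OF S(4,3,5) m(9) n(14,10)] TBK[OF S(5,3,4) m(10,12) n(9)] TBK[OF S(6,3,4) m(11,13) n(9)]
      TBK[OF S(7,5,6) m(16,18) n(18)] TBK[OF S(8,1,4) m(3,14) n(1)] TBK[OF S(9,2,3) m(8,21) n(5)])+
  have "pentagon_labels (lab p) (lab u0) (lab w1) (lab w2) (lab u2)"
    "pentagon_labels (lab p) (lab u0) (lab w1) (lab w3) (lab u3)"
    "pentagon_labels (lab p) (lab u2) (lab w2) (lab w3) (lab u3)"
    using lt R r n m by (auto intro!: C5_labels)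
  then have p: "lab p = 0 \<and> lab u0 = 1 \<and> lab w1 = 2" by (rule pentagon_labels_T0)
  have "pentagon_labels (lab q) (lab u1) (lab w1) (lab w2) (lab u2)"
    "pentagon_labels (lab q) (lab u1) (lab w1) (lab w3) (lab u3)"
    "pentagon_labels (lab q) (lab u2) (lab w2) (lab w3) (lab u3)"
    using lt R r n m by (auto intro!: C5_labels)
  then have q: "lab q = 0 \<and> lab u1 = 1 \<and> lab w1 = 2" by (rule pentagon_labels_T0)
  show False using K_BB[of u0 u1 w1] p q lab_dest[of u0] lab_dest[of u1] lab_dest[of w1] R(8) r(5) n(9) by blast
qed

section \<open>Two anticomplete paths in a blueprint\<close>

lemma P3_labels:
  assumes lt: "lab x < 3" "lab y < 3" "lab z < 3" and R: "R x y" "R y z" "\<not> R x z"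
  shows "(lab x \<noteq> 2 \<and> lab y \<noteq> 2 \<and> lab z \<noteq> 2) \<and> (lab x = 0 \<or> lab y = 0 \<or> lab z = 0) \<or>
    lab x = 1 \<and> lab y \<noteq> 0 \<and> lab z = 2 \<or> lab x = 2 \<and> lab y \<noteq> 0 \<and> lab z = 1 \<or>
    (lab x = 0 \<or> lab y = 0 \<or> lab z = 0) \<and> (lab x = 2 \<or> lab y = 2 \<or> lab z = 2)"
proof -
  have c: "lab v = 0 \<or> lab v = 1 \<or> lab v = 2" if "lab v < 3" for v using that by linarith
  show ?thesis
    using c[OF lt(1)] c[OF lt(2)] c[OF lt(3)] lab_TK[OF R(1)] lab_TK[OF R(2)] lab_clique[OF R(3)]
      lab_BKB[OF R] by (elim disjE; simp)
qed

text \<open>If the top is complete to the middles, \<open>u\<close> keeps \<open>x\<close>,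
  \<open>y\<close>, \<open>z\<close> out of \<open>A\<close>, and \<open>X\<close> with the middles
  is a disjoint union of cliques. In a basket \<open>u\<close> and \<open>w\<close> exclude two of
  the three middles; a vertex of \<open>A\<close> on the path misses \<open>u\<close>, so
  \<open>A\<close> is complete to the third middle and forms a clique with it.\<close>

lemma no_P2_aux:
  assumes P: "x \<in> T \<union> BU" "y \<in> T \<union> BU" "z \<in> T \<union> BU" "R x y" "R y z" "\<not> R x z"
    and Q: "u \<in> BU" "v \<in> BU \<union> K" "w \<in> K" "R u v" "R v w" "\<not> R u w"
    and PQ: "\<And>p q. p \<in> {x, y, z} \<Longrightarrow> q \<in> {u, v, w} \<Longrightarrow> \<not> R p q"
  shows False
proof -
  obtain i where i: "i \<in> I" "u \<in> B i" using Q(1) BUE by blast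
  from AB_or show False
  proof
    assume AB: "\<forall>i\<in>I. complete R A (B i)"
    have XB_or: "p \<in> X \<or> (\<exists>l\<in>I. p \<in> B l)" if "p \<in> {x, y, z}" for p
    proof -
      have "p \<notin> A" using PQ[OF that, of u] AB i unfolding cdefs by blast
      then show ?thesis using that P(1-3) unfolding T_def BU_def by blast
    qed
    have same: "p \<in> X \<and> q \<in> X \<or> (p \<in> X \<or> p \<in> B j) \<and> (q \<in> X \<or> q \<in> B j) \<or> (\<exists>l\<in>I. p \<in> B l \<and> q \<in> B l)"
      if "p \<in> {x, y, z}" "q \<in> {x, y, z}" "R p q" for p q
      using XB_or[OF that(1)] XB_or[OF that(2)] that(3) XB' B_eq sym[OF that(3)] unfolding cdefs by metis
    have Bj: "p \<in> B j" if "p \<in> B l" "l \<in> I" "R p q" "q \<in> X" for p l q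
      using that XB' sym unfolding cdefs by metis
    have XX': "R p q" if "p \<in> X \<or> p \<in> B j" "q \<in> X \<or> q \<in> B j" for p q
      using that XX XB BB[OF jI] sym unfolding cdefs by blast
    have "y \<in> X \<or> (\<exists>l\<in>I. y \<in> B l)" using XB_or by blast
    then show False
    proof
      assume "y \<in> X"
      then have "x \<in> X \<or> x \<in> B j" "z \<in> X \<or> z \<in> B j" using XB_or Bj P(4,5) sym by blast+
      then show False using XX' P(6) by blast
    next
      assume "\<exists>l\<in>I. y \<in> B l"
      then obtain l where l: "l \<in> I" "y \<in> B l" by blast
      have "p \<in> B l \<or> p \<in> X \<and> l = j" if "p \<in> {x, y, z}" "R p y" for p
        using XB_or[OF that(1)] B_eq[OF _ l(2) _ l(1) that(2)] XB'[OF l(1)] that(2) l(2) unfolding cdefs by blast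
      then have "(x \<in> B l \<or> x \<in> X \<and> l = j)" "(z \<in> B l \<or> z \<in> X \<and> l = j)" using P(4,5) sym by blast+
      then show False using XX' B_adj[of x l z] l P(6) by blast
    qed
  next
    assume h: "X = {} \<and> Y = {} \<and> card I = 3 \<and> (\<forall>i\<in>I. complete R (B i) (C i)) \<and>
      (\<exists>i\<in>I. \<forall>k\<in>I - {i}. complete R A (B k))"
    obtain l where l: "l \<in> I" "w \<in> C l" using h Q(3) unfolding K_def by blast
    have il: "i \<noteq> l" using h i l Q(6) unfolding cdefs by blast
    obtain i0 where i0: "\<And>k. k \<in> I \<Longrightarrow> k \<noteq> i0 \<Longrightarrow> complete R A (B k)" using h by blast
    obtain m where m: "m \<in> I" "m \<noteq> i" "m \<noteq> l" using ex_index by metis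
    have "card {i, l, m} = card I" using h il m by simp
    moreover have "finite I" using h by (auto intro: card_ge_0_finite)
    ultimately have Im: "I = {i, l, m}" using card_subset_eq[of I "{i, l, m}"] i l m by blast
    have Bm: "p \<in> A \<or> p \<in> B m" if "p \<in> {x, y, z}" for p
    proof -
      have "\<not> R p u" "\<not> R p w" using PQ that by blast+
      then have "p \<notin> B i" "p \<notin> B l" using B_adj i l h unfolding cdefs by blast+
      then show ?thesis using P(1-3) that h Im unfolding T_def BU_def by blast
    qed
    have "x \<in> A \<or> z \<in> A" using Bm[of x] Bm[of z] B_adj m P(6) by blast
    then have "i0 = i" using PQ[of x u] PQ[of z u] i0[OF i(1)] i(2) unfolding cdefs by blast
    then have "complete R A (B m)" using i0 m by blast
    then show False using Bm[of x] Bm[of z] B_adj[OF _ _ m(1)] AA P(6) sym unfolding cdefs by blast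
  qed
qed

lemma no_P2:
  assumes P: "R x y" "R y z" "\<not> R x z" and Q: "R u v" "R v w" "\<not> R u w"
    and n: "\<not> R x u" "\<not> R x v" "\<not> R x w" "\<not> R y u" "\<not> R y v" "\<not> R y w"
       "\<not> R z u" "\<not> R z v" "\<not> R z w"
  shows False
proof -
  have S: "R x x" "R y y" "R z z" "R u u" "R v v" "R w w" using P Q refl sym by blast+
  have m: "\<not> R u x" "\<not> R v x" "\<not> R w x" "\<not> R u y" "\<not> R v y" "\<not> R w y"
       "\<not> R u z" "\<not> R v z" "\<not> R w z" using n sym by blast+
  have lt: "lab x < 3" "lab y < 3" "lab z < 3" "lab u < 3" "lab v < 3" "lab w < 3"
    unfolding lab_iff
    by (fact TBK[OF S(1,4,6) n(1,3) Q(3)] TBK[OF S(2,4,6) n(4,6) Q(3)] TBK[OF S(3,4,6) n(7,9) Q(3)]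
      TBK[OF S(4,1,3) m(1,7) P(3)] TBK[OF S(5,1,3) m(2,8) P(3)] TBK[OF S(6,1,3) m(3,9) P(3)])+
  note cross = n[THEN lab_clique]
  have R': "R z y" "R y x" "\<not> R z x" "R w v" "R v u" "\<not> R w u" using P Q sym by blast+
  have c: "v \<in> T \<or> v \<in> BU \<or> v \<in> K" if "lab v < 3" for v using that lab_iff by blast
  have TB: "v \<in> T \<union> BU" if "lab v \<noteq> 2" "lab v < 3" for v using c[OF that(2)] lab_K[of v] that by auto
  have BK: "v \<in> BU \<union> K" if "lab v \<noteq> 0" "lab v < 3" for v using c[OF that(2)] lab_T[of v] that by auto
  note PP = P3_labels[OF lt(1-3) P] and QQ = P3_labels[OF lt(4-6) Q]
  \<comment> \<open>Anticomplete paths cannot both meet the top, nor both meet the base. As every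
    induced path meets one of these, one path avoids the base and the other avoids the top.\<close>
  have "(lab x \<noteq> 2 \<and> lab y \<noteq> 2 \<and> lab z \<noteq> 2) \<and> (lab u = 1 \<and> lab v \<noteq> 0 \<and> lab w = 2 \<or> lab u = 2 \<and> lab v \<noteq> 0 \<and> lab w = 1) \<or>
    (lab u \<noteq> 2 \<and> lab v \<noteq> 2 \<and> lab w \<noteq> 2) \<and> (lab x = 1 \<and> lab y \<noteq> 0 \<and> lab z = 2 \<or> lab x = 2 \<and> lab y \<noteq> 0 \<and> lab z = 1)"
    using PP QQ cross by argo
  then show False
  proof (elim disjE conjE)
    assume h: "lab x \<noteq> 2" "lab y \<noteq> 2" "lab z \<noteq> 2" "lab u = 1" "lab v \<noteq> 0" "lab w = 2"
    show False
    proof (rule no_P2_aux[of x y z u v w])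
      show "x \<in> T \<union> BU" "y \<in> T \<union> BU" "z \<in> T \<union> BU" using h TB lt by blast+
      show "u \<in> BU" "v \<in> BU \<union> K" "w \<in> K" using h BK lt lab_dest by blast+
      show "\<not> R p q" if "p \<in> {x, y, z}" "q \<in> {u, v, w}" for p q using that n by blast
    qed (use P Q in blast)+
  next
    assume h: "lab x \<noteq> 2" "lab y \<noteq> 2" "lab z \<noteq> 2" "lab u = 2" "lab v \<noteq> 0" "lab w = 1"
    show False
    proof (rule no_P2_aux[of x y z w v u])
      show "x \<in> T \<union> BU" "y \<in> T \<union> BU" "z \<in> T \<union> BU" using h TB lt by blast+
      show "w \<in> BU" "v \<in> BU \<union> K" "u \<in> K" using h BK lt lab_dest by blast+
      show "\<not> R p q" if "p \<in> {x, y, z}" "q \<in> {w, v, u}" for p q using that n by blast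
    qed (use P R' in blast)+
  next
    assume h: "lab u \<noteq> 2" "lab v \<noteq> 2" "lab w \<noteq> 2" "lab x = 1" "lab y \<noteq> 0" "lab z = 2"
    show False
    proof (rule no_P2_aux[of u v w x y z])
      show "u \<in> T \<union> BU" "v \<in> T \<union> BU" "w \<in> T \<union> BU" using h TB lt by blast+
      show "x \<in> BU" "y \<in> BU \<union> K" "z \<in> K" using h BK lt lab_dest by blast+
      show "\<not> R p q" if "p \<in> {u, v, w}" "q \<in> {x, y, z}" for p q using that m by blast
    qed (use Q P in blast)+
  next
    assume h: "lab u \<noteq> 2" "lab v \<noteq> 2" "lab w \<noteq> 2" "lab x = 2" "lab y \<noteq> 0" "lab z = 1"
    show False
    proof (rule no_P2_aux[of u v w z y x])
      show "u \<in> T \<union> BU" "v \<in> T \<union> BU" "w \<in> T \<union> BU" using h TB lt by blast+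
      show "z \<in> BU" "y \<in> BU \<union> K" "x \<in> K" using h BK lt lab_dest by blast+
      show "\<not> R p q" if "p \<in> {u, v, w}" "q \<in> {z, y, x}" for p q using that m by blast
    qed (use Q R' in blast)+
  qed
qed

end

section \<open>Induced subgraphs in terms of the reflexive closure\<close>

definition radj :: "'a set \<Rightarrow> ('a \<Rightarrow> 'a \<Rightarrow> bool) \<Rightarrow> 'a \<Rightarrow> 'a \<Rightarrow> bool" where
  "radj V E x y \<longleftrightarrow> x \<in> V \<and> y \<in> V \<and> (x = y \<or> E x y)"

lemma refl_graph_radj: "graph V E \<Longrightarrow> refl_graph (radj V E)"
  unfolding graph_def radj_def by (unfold_locales; blast)

text \<open>The clause on \<open>i\<close> and \<open>j\<close> compares closed neighbourhoods.
  Ranging over \<open>set [0..<n]\<close> lets \<open>code_simp\<close> evaluate the condition on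
  each concrete graph.\<close>

definition twinfree :: "nat \<Rightarrow> (nat \<Rightarrow> nat \<Rightarrow> bool) \<Rightarrow> bool" where
  "twinfree n H \<longleftrightarrow> (\<forall>i\<in>set [0..<n]. \<not> H i i \<and>
     (\<forall>j\<in>set [0..<n]. i \<noteq> j \<longrightarrow> (\<exists>k\<in>set [0..<n]. (i = k \<or> H i k) \<noteq> (j = k \<or> H j k))))"

definition realizes :: "('a \<Rightarrow> 'a \<Rightarrow> bool) \<Rightarrow> nat \<Rightarrow> (nat \<Rightarrow> nat \<Rightarrow> bool) \<Rightarrow> (nat \<Rightarrow> 'a) \<Rightarrow> bool" where
  "realizes R n H f \<longleftrightarrow> (\<forall>i\<in>set [0..<n]. \<forall>j\<in>set [0..<n]. R (f i) (f j) \<longleftrightarrow> i = j \<or> H i j)"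

lemma contains_induced_iff:
  assumes G: "graph V E" and H: "twinfree n H"
  shows "contains_induced V E {0..<n} H \<longleftrightarrow> (\<exists>f. realizes (radj V E) n H f)"
proof
  assume "contains_induced V E {0..<n} H"
  then obtain f where f: "inj_on f {0..<n}" "f ` {0..<n} \<subseteq> V" "\<forall>x\<in>{0..<n}. \<forall>y\<in>{0..<n}. E (f x) (f y) \<longleftrightarrow> H x y"
    unfolding contains_induced_def by blast
  have "realizes (radj V E) n H f"
    unfolding realizes_def radj_def using f inj_onD[OF f(1)] by (auto simp: image_subset_iff)
  then show "\<exists>f. realizes (radj V E) n H f" by blast
next
  assume "\<exists>f. realizes (radj V E) n H f"
  then obtain f where "realizes (radj V E) n H f" by blast
  then have f: "radj V E (f i) (f j) \<longleftrightarrow> i = j \<or> H i j" if "i < n" "j < n" for i j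
    using that unfolding realizes_def by simp
  have fV: "f i \<in> V" if "i < n" for i using f[OF that that] unfolding radj_def by blast
  have inj: "inj_on f {0..<n}"
  proof (rule inj_onI, rule ccontr)
    fix i j assume ij: "i \<in> {0..<n}" "j \<in> {0..<n}" "f i = f j" "i \<noteq> j"
    have "\<exists>k\<in>set [0..<n]. (i = k \<or> H i k) \<noteq> (j = k \<or> H j k)"
      using H ij unfolding twinfree_def atLeastLessThan_upt by blast
    then obtain k where k: "k < n" "(i = k \<or> H i k) \<noteq> (j = k \<or> H j k)" by (metis atLeastLessThan_iff set_upt)
    have "i < n" "j < n" using ij by simp_all
    then show False using f[of i k] f[of j k] k ij(3) by simp
  qed
  have "E (f i) (f j) \<longleftrightarrow> H i j" if "i < n" "j < n" for i j
  proof (cases "i = j")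
    case True
    then show ?thesis using H G that unfolding twinfree_def graph_def by simp
  next
    case False
    then have "f i \<noteq> f j" using inj that unfolding inj_on_def by auto
    then show ?thesis using f[OF that] fV that False unfolding radj_def by blast
  qed
  then show "contains_induced V E {0..<n} H"
    unfolding contains_induced_def using inj fV by (intro exI[of _ f]) auto
qed

lemma twinfree_graphs:
  "twinfree 6 twoP3_E" "twinfree 4 (cycle_E 4)" "twinfree 6 (cycle_E 6)" "twinfree 7 (cycle_E 7)"
  "twinfree 9 T0_E" "twinfree 7 (pentagon_E 3)"
  unfolding twinfree_def twoP3_E_def T0_E_def edges_rel_def cycle_E_def pentagon_E_def pentagon_E0_def
  by code_simp+

lemma (in refl_graph) nsym: "\<not> R x y \<Longrightarrow> \<not> R y x"
  using sym by blast

lemma (in refl_graph) refl2: "R x y \<Longrightarrow> R y y"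
  using sym refl by blast

context
  fixes V :: "'a set" and E R
  defines "R \<equiv> radj V E"
  assumes G: "graph V E"
begin

interpretation refl_graph R unfolding R_def by (rule refl_graph_radj[OF G])

lemmas contains_iff = twinfree_graphs[THEN contains_induced_iff[OF G], folded R_def]

lemma forb_graph_radj:
  assumes "\<not> contains_induced V E twoP3_V twoP3_E"
    and "\<not> contains_induced V E (cycle_V 4) (cycle_E 4)"
    and "\<not> contains_induced V E (cycle_V 6) (cycle_E 6)"
    and "\<not> contains_induced V E (cycle_V 7) (cycle_E 7)"
    and "\<not> contains_induced V E T0_V T0_E"
  shows "forb_graph R"
proof
  note F = assms[unfolded twoP3_V_def cycle_V_def T0_V_def contains_iff not_ex]
  show "R x z \<or> R y w" if h: "R x y" "R y z" "R z w" "R w x" for x y z w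
  proof (rule ccontr)
    assume "\<not> ?thesis"
    then have n: "\<not> R x z" "\<not> R y w" by blast+
    have "realizes R 4 (cycle_E 4) ((!) [x, y, z, w])"
      unfolding realizes_def by (simp add: upt_rec cycle_E_def h h[THEN sym] h[THEN refl] n n[THEN nsym])
    then show False using F(2) by blast
  qed
  show False if h: "R u v" "R v w" "R w x" "R x y" "R y z" "R z u"
    and n: "\<not> R u w" "\<not> R u x" "\<not> R u y" "\<not> R v x" "\<not> R v y" "\<not> R v z"
       "\<not> R w y" "\<not> R w z" "\<not> R x z" for u v w x y z
  proof -
    have "realizes R 6 (cycle_E 6) ((!) [u, v, w, x, y, z])"
      unfolding realizes_def by (simp add: upt_rec cycle_E_def h h[THEN sym] h[THEN refl] n n[THEN nsym])
    then show False using F(3) by blast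
  qed
  show False if h: "R s u" "R u v" "R v w" "R w x" "R x y" "R y z" "R z s"
    and n: "\<not> R s v" "\<not> R s w" "\<not> R s x" "\<not> R s y"
       "\<not> R u w" "\<not> R u x" "\<not> R u y" "\<not> R u z" "\<not> R v x" "\<not> R v y" "\<not> R v z"
       "\<not> R w y" "\<not> R w z" "\<not> R x z" for s u v w x y z
  proof -
    have "realizes R 7 (cycle_E 7) ((!) [s, u, v, w, x, y, z])"
      unfolding realizes_def by (simp add: upt_rec cycle_E_def h h[THEN sym] h[THEN refl] n n[THEN nsym])
    then show False using F(4) by blast
  qed
  show False if h: "R x y" "R y z" "R u v" "R v w" and n: "\<not> R x z" "\<not> R u w"
       "\<not> R x u" "\<not> R x v" "\<not> R x w" "\<not> R y u" "\<not> R y v" "\<not> R y w"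
       "\<not> R z u" "\<not> R z v" "\<not> R z w" for x y z u v w
  proof -
    have "realizes R 6 twoP3_E ((!) [x, y, z, u, v, w])"
      unfolding realizes_def
      by (simp add: upt_rec twoP3_E_def edges_rel_def h h[THEN sym] h[THEN refl] h[THEN refl2] n n[THEN nsym])
    then show False using F(1) by blast
  qed
  show False if h: "R p q" "R p u0" "R p u2" "R p u3" "R q u1" "R q u2" "R q u3"
       "R u0 w1" "R u1 w1" "R u2 w2" "R u3 w3" "R w1 w2" "R w1 w3" "R w2 w3"
    and n: "\<not> R p u1" "\<not> R p w1" "\<not> R p w2" "\<not> R p w3"
       "\<not> R q u0" "\<not> R q w1" "\<not> R q w2" "\<not> R q w3"
       "\<not> R u0 u1" "\<not> R u0 u2" "\<not> R u0 u3" "\<not> R u0 w2" "\<not> R u0 w3"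
       "\<not> R u1 u2" "\<not> R u1 u3" "\<not> R u1 w2" "\<not> R u1 w3"
       "\<not> R u2 u3" "\<not> R u2 w1" "\<not> R u2 w3" "\<not> R u3 w1" "\<not> R u3 w2" for p q u0 u1 u2 u3 w1 w2 w3
  proof -
    have "realizes R 9 T0_E ((!) [p, q, u0, u1, u2, u3, w1, w2, w3])"
      unfolding realizes_def
      by (simp add: upt_rec T0_E_def edges_rel_def h h[THEN sym] h[THEN refl] h[THEN refl2] n n[THEN nsym])
    then show False using F(5) by blast
  qed
qed

lemma forb_graph_not_contains:
  assumes "forb_graph R"
  shows "\<not> contains_induced V E twoP3_V twoP3_E"
    and "\<not> contains_induced V E (cycle_V 4) (cycle_E 4)"
    and "\<not> contains_induced V E (cycle_V 6) (cycle_E 6)"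
    and "\<not> contains_induced V E (cycle_V 7) (cycle_E 7)"
    and "\<not> contains_induced V E T0_V T0_E"
proof -
  interpret forb_graph R by (rule assms)
  have f: "R (f i) (f j) \<longleftrightarrow> i = j \<or> H i j" if "realizes R n H f" "i < n" "j < n" for f n H i j
    using that unfolding realizes_def by simp
  have "\<not> realizes R 6 twoP3_E f" for f
  proof
    assume "realizes R 6 twoP3_E f"
    from f[OF this] show False
      using P2[of "f 0" "f 1" "f 2" "f 3" "f 4" "f 5"] by (simp add: twoP3_E_def edges_rel_def)
  qed
  then show "\<not> contains_induced V E twoP3_V twoP3_E" unfolding twoP3_V_def contains_iff by blast
  have "\<not> realizes R 4 (cycle_E 4) f" for f
  proof
    assume "realizes R 4 (cycle_E 4) f"
    from f[OF this] show False using C4[of "f 0" "f 1" "f 2" "f 3"] by (simp add: cycle_E_def)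
  qed
  then show "\<not> contains_induced V E (cycle_V 4) (cycle_E 4)" unfolding cycle_V_def contains_iff by blast
  have "\<not> realizes R 6 (cycle_E 6) f" for f
  proof
    assume "realizes R 6 (cycle_E 6) f"
    from f[OF this] show False using C6[of "f 0" "f 1" "f 2" "f 3" "f 4" "f 5"] by (simp add: cycle_E_def)
  qed
  then show "\<not> contains_induced V E (cycle_V 6) (cycle_E 6)" unfolding cycle_V_def contains_iff by blast
  have "\<not> realizes R 7 (cycle_E 7) f" for f
  proof
    assume "realizes R 7 (cycle_E 7) f"
    from f[OF this] show False
      using C7[of "f 0" "f 1" "f 2" "f 3" "f 4" "f 5" "f 6"] by (simp add: cycle_E_def)
  qed
  then show "\<not> contains_induced V E (cycle_V 7) (cycle_E 7)" unfolding cycle_V_def contains_iff by blast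
  have "\<not> realizes R 9 T0_E f" for f
  proof
    assume "realizes R 9 T0_E f"
    from f[OF this] show False
      \<comment> \<open>The instantiation follows the order of the variables in \<open>T0\<close>,
        where \<open>u2\<close> and \<open>u3\<close> occur before \<open>u1\<close>.\<close>
      using T0[of "f 0" "f 1" "f 2" "f 4" "f 5" "f 3" "f 6" "f 7" "f 8"] by (simp add: T0_E_def edges_rel_def)
  qed
  then show "\<not> contains_induced V E T0_V T0_E" unfolding T0_V_def contains_iff by blast
qed

end

section \<open>Pentagons with the largest number of arms\<close>

definition is_pentagon :: "('a \<Rightarrow> 'a \<Rightarrow> bool) \<Rightarrow> nat set \<Rightarrow> 'a \<Rightarrow> (nat \<Rightarrow> 'a) \<Rightarrow> (nat \<Rightarrow> 'a) \<Rightarrow> bool" where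
  "is_pentagon R I a b c \<longleftrightarrow> (\<forall>i\<in>I. R a (b i) \<and> \<not> R a (c i) \<and>
     (\<forall>j\<in>I. (i \<noteq> j \<longrightarrow> \<not> R (b i) (b j)) \<and> R (c i) (c j) \<and> (R (b i) (c j) \<longleftrightarrow> i = j)))"

lemma ex_pentagon_iff:
  assumes G: "graph V E"
  shows "contains_induced V E (pentagon_V 3) (pentagon_E 3) \<longleftrightarrow>
    (\<exists>a b c. is_pentagon (radj V E) {1..3} a b c)"
proof -
  interpret refl_graph "radj V E" by (rule refl_graph_radj[OF G])
  have V: "pentagon_V 3 = {0..<7}" unfolding pentagon_V_def by auto
  have I: "{1..3} = {1, 2, 3::nat}" by auto
  show ?thesis unfolding V contains_induced_iff[OF G twinfree_graphs(6)]
  proof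
    assume "\<exists>f. realizes (radj V E) 7 (pentagon_E 3) f"
    then obtain f where "realizes (radj V E) 7 (pentagon_E 3) f" by blast
    then have f: "radj V E (f i) (f j) \<longleftrightarrow> i = j \<or> pentagon_E 3 i j" if "i < 7" "j < 7" for i j
      using that unfolding realizes_def by simp
    have "is_pentagon (radj V E) {1..3} (f 0) f (\<lambda>i. f (i + 3))"
      unfolding is_pentagon_def I by (simp add: f pentagon_E_def pentagon_E0_def)
    then show "\<exists>a b c. is_pentagon (radj V E) {1..3} a b c" by blast
  next
    assume "\<exists>a b c. is_pentagon (radj V E) {1..3} a b c"
    then obtain a b c where h: "is_pentagon (radj V E) {1..3} a b c" by blast
    have r: "radj V E a (b i)" "\<not> radj V E a (c i)" "radj V E (b i) a" "\<not> radj V E (c i) a"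
      if "i \<in> {1..3}" for i
      using h that sym unfolding is_pentagon_def by blast+
    have p: "i \<noteq> j \<Longrightarrow> \<not> radj V E (b i) (b j)"
       "radj V E (c i) (c j)" "radj V E (b i) (c j) \<longleftrightarrow> i = j" if "i \<in> {1..3}" "j \<in> {1..3}" for i j
      using h that unfolding is_pentagon_def by blast+
    have q: "radj V E (c j) (b i) \<longleftrightarrow> i = j" "radj V E (b i) (b j) \<longleftrightarrow> i = j"
      if "i \<in> {1..3}" "j \<in> {1..3}" for i j
      using p[OF that] r[OF that(1)] sym refl refl2 by blast+
    have "radj V E a a" using r(1)[of 1] refl by simp
    then have "realizes (radj V E) 7 (pentagon_E 3) ((!) [a, b 1, b 2, b 3, c 1, c 2, c 3])"
      unfolding realizes_def by (simp add: upt_rec pentagon_E_def pentagon_E0_def p q r)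
    then show "\<exists>f. realizes (radj V E) 7 (pentagon_E 3) f" by blast
  qed
qed

lemma ex_pentagon_graph:
  assumes G: "graph V E" and F: "forb_graph (radj V E)"
    and pent: "is_pentagon (radj V E) {1..3} a b c"
    and ns: "\<not> (\<exists>v\<in>V. simplicial V E v)"
  shows "\<exists>t a b c. t \<ge> 3 \<and> pentagon_graph (radj V E) a b c {1..t}"
proof -
  interpret forb_graph "radj V E" by (rule F)
  define has where "has t \<longleftrightarrow> (\<exists>a b c. is_pentagon (radj V E) {1..t} a b c)" for t :: nat
  have fin: "finite V" using G unfolding graph_def by blast
  \<comment> \<open>The \<open>b\<close>s are distinct vertices, so the number of arms is bounded
    and a largest one exists.\<close>
  have bound: "t \<le> card V" if "has t" for t
  proof -
    obtain a b c where h: "is_pentagon (radj V E) {1..t} a b c" using \<open>has t\<close> unfolding has_def by blast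
    have "inj_on b {1..t}"
    proof (rule inj_onI, rule ccontr)
      fix i j assume "i \<in> {1..t}" "j \<in> {1..t}" "b i = b j" "i \<noteq> j"
      then show False using h refl2 unfolding is_pentagon_def by metis
    qed
    moreover have "b ` {1..t} \<subseteq> V" using h unfolding is_pentagon_def radj_def by blast
    ultimately have "card {1..t} \<le> card V" using fin by (rule card_inj_on_le)
    then show ?thesis by simp
  qed
  have h3: "has 3" using pent unfolding has_def by blast
  define t where "t = (GREATEST t. has t)"
  have "has t" unfolding t_def by (rule GreatestI_nat[where P = has and k = 3 and b = "card V"]; fact h3 bound)
  have max: "u \<le> t" if "has u" for u unfolding t_def by (rule Greatest_le_nat[where P = has and b = "card V"]; fact that bound)
  obtain a b c where h: "is_pentagon (radj V E) {1..t} a b c" using \<open>has t\<close> unfolding has_def by blast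
  have "pentagon_graph (radj V E) a b c {1..t}"
  proof
    show "finite {1..t}" "3 \<le> card {1..t}" using max[OF h3] by simp_all
    show "radj V E a (b i)" "\<not> radj V E a (c i)" if "i \<in> {1..t}" for i
      using h that unfolding is_pentagon_def by blast+
    show "\<not> radj V E (b i) (b j)" if "i \<in> {1..t}" "j \<in> {1..t}" "i \<noteq> j" for i j
      using h that unfolding is_pentagon_def by blast
    show "radj V E (c i) (c j)" "radj V E (b i) (c j) \<longleftrightarrow> i = j" if "i \<in> {1..t}" "j \<in> {1..t}" for i j
      using h that unfolding is_pentagon_def by blast+
    show False if s: "radj V E a s" "radj V E s y" "\<And>i. i \<in> {1..t} \<Longrightarrow> \<not> radj V E s (b i)"
      "\<And>i. i \<in> {1..t} \<Longrightarrow> \<not> radj V E s (c i)" "\<And>i. i \<in> {1..t} \<Longrightarrow> radj V E y (c i)"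
      "\<And>i. i \<in> {1..t} \<Longrightarrow> \<not> radj V E y (b i)" "\<not> radj V E a y" for s y
    proof -
      \<comment> \<open>The pair \<open>s\<close>, \<open>y\<close> is appended as the arm
        \<open>Suc t\<close>, against the choice of \<open>t\<close>.\<close>
      define b' c' where "b' = b(Suc t := s)" and "c' = c(Suc t := y)"
      have old: "b' i = b i" "c' i = c i" if "i \<in> {1..t}" for i using that unfolding b'_def c'_def by auto
      have new: "b' (Suc t) = s" "c' (Suc t) = y" unfolding b'_def c'_def by auto
      have I: "i \<in> {1..Suc t} \<longleftrightarrow> i \<in> {1..t} \<or> i = Suc t" for i by auto
      have ne: "i \<noteq> Suc t" if "i \<in> {1..t}" for i using that by auto
      have "is_pentagon (radj V E) {1..Suc t} a b' c'"
        unfolding is_pentagon_def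
      proof (intro ballI conjI)
        fix i assume i: "i \<in> {1..Suc t}"
        show "radj V E a (b' i)" "\<not> radj V E a (c' i)"
          using i[unfolded I] h s(1,7) old new unfolding is_pentagon_def by metis+
        fix j assume j: "j \<in> {1..Suc t}"
        show "i \<noteq> j \<longrightarrow> \<not> radj V E (b' i) (b' j)"
          using i[unfolded I] j[unfolded I] h s(3) old new sym unfolding is_pentagon_def by metis
        show "radj V E (c' i) (c' j)"
          using i[unfolded I] j[unfolded I] h s(5) old new sym refl2[OF s(2)] unfolding is_pentagon_def by metis
        show "radj V E (b' i) (c' j) \<longleftrightarrow> i = j"
          using i[unfolded I] j[unfolded I] h s(2,4,6) old new sym ne unfolding is_pentagon_def by metis
      qed
      then have "has (Suc t)" unfolding has_def by blast
      then show False using max by fastforce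
    qed
    show "finite {v. radj V E v v}" by (rule finite_subset[OF _ fin]) (auto simp: radj_def)
    show "\<exists>x y. radj V E v x \<and> radj V E v y \<and> \<not> radj V E x y" if "radj V E v v" for v
    proof -
      have "v \<in> V" using that unfolding radj_def by blast
      then have "\<not> clique E (nbr V E v)" using ns unfolding simplicial_def by blast
      then obtain x y where "x \<in> V" "y \<in> V" "E v x" "E v y" "x \<noteq> y" "\<not> E x y"
        unfolding clique_def nbr_def by blast
      then show ?thesis using \<open>v \<in> V\<close> unfolding radj_def by blast
    qed
  qed
  then show ?thesis using max[OF h3] by blast
qed

lemma ex_blueprint:
  assumes "pentagon_graph R a b c I"
  shows "\<exists>j A B C F X Y U. blueprint R I j A B C F X Y U"
proof -
  interpret pentagon_graph R a b c I by (rule assms)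
  obtain i where i: "i \<in> I" using ex_index by blast
  \<comment> \<open>If no class \<open>F k\<close> is inhabited, any index may serve as
    \<open>j0\<close>.\<close>
  obtain j where j: "j \<in> I" "\<And>k v. k \<in> I \<Longrightarrow> v \<in> F k \<Longrightarrow> k = j"
  proof (cases "\<exists>k\<in>I. F k \<noteq> {}")
    case True
    then obtain k v where "k \<in> I" "v \<in> F k" by blast
    then show ?thesis using that[of k] F_unique by metis
  next
    case False
    then show ?thesis using that[OF i] by blast
  qed
  interpret pentagon_graph_F R a b c I j by (unfold_locales; fact j)
  show ?thesis using blueprint by blast
qed

section \<open>From blueprints to baskets, villas and mansions\<close>

lemma nested_subset:
  assumes "nested R S T" "x \<in> S" "y \<in> S"
  shows "{v\<in>T. R x v} \<subseteq> {v\<in>T. R y v} \<or> {v\<in>T. R y v} \<subseteq> {v\<in>T. R x v}"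
  using assms unfolding nested_def by blast

text \<open>Along a chain, inclusion of neighbourhoods is decided by size, so sorting by the number
  of non-neighbours puts the larger neighbourhoods first.\<close>

lemma nested_list:
  assumes N: "nested R S T" and fin: "finite S" "finite T"
  shows "\<exists>xs. distinct xs \<and> set xs = S \<and>
    (\<forall>k. Suc k < length xs \<longrightarrow> {v\<in>T. R (xs ! Suc k) v} \<subseteq> {v\<in>T. R (xs ! k) v})"
proof -
  define f where "f x = card {v\<in>T. \<not> R x v}" for x
  obtain ys where ys: "distinct ys" "set ys = S" using finite_distinct_list[OF fin(1)] by blast
  define xs where "xs = sort_key f ys"
  have xs: "distinct xs" "set xs = S" "sorted (map f xs)" unfolding xs_def using ys by simp_all
  have "{v\<in>T. R (xs ! Suc k) v} \<subseteq> {v\<in>T. R (xs ! k) v}" if k: "Suc k < length xs" for k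
  proof (rule ccontr)
    assume n: "\<not> ?thesis"
    have mem: "xs ! k \<in> S" "xs ! Suc k \<in> S" using k xs(2) by (metis Suc_lessD nth_mem)+
    have "{v\<in>T. \<not> R (xs ! Suc k) v} \<subset> {v\<in>T. \<not> R (xs ! k) v}"
      using nested_subset[OF N mem] n by blast
    then have "f (xs ! Suc k) < f (xs ! k)" unfolding f_def using fin(2) by (intro psubset_card_mono) auto
    moreover have "f (xs ! k) \<le> f (xs ! Suc k)"
      using sorted_nth_mono[OF xs(3), of k "Suc k"] k by simp
    ultimately show False by simp
  qed
  then show ?thesis using xs by blast
qed

lemma list_chain:
  assumes "\<And>k. Suc k < length xs \<Longrightarrow> N (xs ! Suc k) \<subseteq> N (xs ! k)" "i \<le> j" "j < length xs"
  shows "N (xs ! j) \<subseteq> N (xs ! i)"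
  using assms(2,3)
proof (induction j rule: dec_induct)
  case (step n)
  then show ?case using assms(1)[of n] by auto
qed simp

text \<open>\<open>N\<close> stands for the traces of neighbourhoods by which baskets and villas
  express their orderings.\<close>

lemma nested_of_list:
  assumes xs: "set xs = S" "\<And>k. Suc k < length xs \<Longrightarrow> N (xs ! Suc k) \<subseteq> N (xs ! k)"
    and N: "\<And>x v. x \<in> S \<Longrightarrow> v \<in> T \<Longrightarrow> v \<in> N x \<longleftrightarrow> R x v"
  shows "nested R S T"
  unfolding nested_def
proof (intro ballI impI)
  fix x y u v assume h: "x \<in> S" "y \<in> S" "u \<in> T" "v \<in> T" "R x u" "R y v"
  obtain i j where ij: "i < length xs" "x = xs ! i" "j < length xs" "y = xs ! j"
    using h(1,2) xs(1) by (metis in_set_conv_nth)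
  have "N y \<subseteq> N x \<or> N x \<subseteq> N y"
    using list_chain[of xs N, OF xs(2)] ij linear[of i j] by blast
  then show "R x v \<or> R y u" using h N by blast
qed

text \<open>Unlike the formulation by positions, \<open>sorted_wrt\<close> splits along
  \<open>@\<close> and \<open>#\<close>.\<close>

lemma is_partition_iff:
  "is_partition V Ps \<longleftrightarrow> \<Union>(set Ps) = V \<and> sorted_wrt (\<lambda>S T. S \<inter> T = {}) Ps"
  unfolding is_partition_def sorted_wrt_iff_nth_less
  by (metis Int_commute linorder_neqE_nat order_less_trans nat_neq_iff)

lemma sorted_wrt_upt:
  assumes "\<And>i k. i \<in> {m..<n} \<Longrightarrow> k \<in> {m..<n} \<Longrightarrow> i < k \<Longrightarrow> P (f i) (f k)"
  shows "sorted_wrt P (map f [m..<n])"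
  using assms by (auto simp: sorted_wrt_iff_nth_less)

context blueprint_graph begin

section \<open>Disjointness, simplicial vertices and anticonnectedness in a blueprint\<close>

lemma mem_sets:
  "x \<in> A \<Longrightarrow> R x x" "x \<in> F \<Longrightarrow> R x x" "x \<in> X \<Longrightarrow> R x x" "x \<in> Y \<Longrightarrow> R x x"
  "x \<in> U \<Longrightarrow> R x x" "i \<in> I \<Longrightarrow> x \<in> B i \<Longrightarrow> R x x" "i \<in> I \<Longrightarrow> x \<in> C i \<Longrightarrow> R x x"
  using V_eq by blast+

lemma disj_T: "i \<in> I \<Longrightarrow> A \<inter> B i = {}" "i \<in> I \<Longrightarrow> X \<inter> B i = {}"
  using T_BU unfolding T_def BU_def by blast+

lemma disj_K: "i \<in> I \<Longrightarrow> k \<in> I \<Longrightarrow> B i \<inter> C k = {}" "i \<in> I \<Longrightarrow> Y \<inter> B i = {}"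
  using K_BU unfolding K_def BU_def by blast+

text \<open>As \<open>R\<close> is reflexive on vertices, anticomplete sets of vertices are
  disjoint.\<close>

lemma disj_TK: "i \<in> I \<Longrightarrow> A \<inter> C i = {}" "i \<in> I \<Longrightarrow> X \<inter> C i = {}" "A \<inter> Y = {}" "X \<inter> Y = {}"
  using TK mem_sets unfolding T_def K_def by blast+

lemma disj_B: "i \<in> I \<Longrightarrow> k \<in> I \<Longrightarrow> i \<noteq> k \<Longrightarrow> B i \<inter> B k = {}"
  using B_eq mem_sets(6) by blast

lemma disj_C: "i \<in> I \<Longrightarrow> k \<in> I \<Longrightarrow> i \<noteq> k \<Longrightarrow> C i \<inter> C k = {}"
proof (rule ccontr)
  assume h: "i \<in> I" "k \<in> I" "i \<noteq> k" "C i \<inter> C k \<noteq> {}"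
  then obtain x where x: "x \<in> C i" "x \<in> C k" by blast
  then obtain b where "b \<in> B i" "R x b" using C_B h by blast
  then show False using BC'[OF h(1,2,3)] x sym unfolding cdefs by blast
qed

text \<open>Each part is told apart from \<open>F\<close> by a nonempty set that \<open>F\<close>
  sees completely and the part not at all: a suitable \<open>C k\<close> for top and middle,
  \<open>A\<close> for the base.\<close>

lemma disj_F: "i \<in> I \<Longrightarrow> B i \<inter> F = {}" "i \<in> I \<Longrightarrow> C i \<inter> F = {}" "A \<inter> F = {}" "X \<inter> F = {}" "Y \<inter> F = {}"
proof -
  obtain k where k: "k \<in> I" "k \<noteq> j" using ex_index by blast
  have FCk: "R f x" if "f \<in> F" "x \<in> C k" for f x using FC[OF k] that unfolding cdefs by blast
  obtain a where a: "a \<in> A" using A_ne by blast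
  have nFT: "x \<notin> F" if "x \<in> T" for x
  proof
    assume "x \<in> F"
    obtain d where "d \<in> C k" using C_ne[OF k(1)] by blast
    moreover then have "d \<in> K" using k unfolding K_def by blast
    ultimately show False using FCk \<open>x \<in> F\<close> TK that by blast
  qed
  then show "A \<inter> F = {}" "X \<inter> F = {}" unfolding T_def by blast+
  have nFK: "x \<notin> F" if "x \<in> K" for x
    using TK[of a x] a that FA sym unfolding cdefs T_def by blast
  then show "Y \<inter> F = {}" "i \<in> I \<Longrightarrow> C i \<inter> F = {}" unfolding K_def by blast+
  show "B i \<inter> F = {}" if i: "i \<in> I"
  proof (rule ccontr)
    assume "B i \<inter> F \<noteq> {}"
    then obtain x where x: "x \<in> B i" "x \<in> F" by blast
    obtain l where l: "l \<in> I" "l \<noteq> i" "l \<noteq> j" using ex_index by blast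
    obtain d where d: "d \<in> C l" using C_ne l by blast
    then have "R x d" using FC[OF l(1,3)] x unfolding cdefs by blast
    moreover have "\<not> R x d" using BC'[OF i l(1)] l d x unfolding cdefs by blast
    ultimately show False by blast
  qed
qed

text \<open>This excludes simplicial vertices. The delicate classes are \<open>X\<close> and
  \<open>Y\<close>: when inhabited they come with a vertex of \<open>F\<close>, which is nonadjacent
  to their neighbours in arm \<open>j\<close>.\<close>

lemma nonadjacent_nbrs:
  assumes "R v v" shows "\<exists>x y. R v x \<and> R v y \<and> \<not> R x y \<and> x \<notin> U \<and> y \<notin> U"
proof -
  have nU: "x \<notin> U" "y \<notin> U" if "R x x" "R y y" "\<not> R x y" for x y
    using that U_adj sym by blast+
  have "\<exists>x y. R v x \<and> R v y \<and> \<not> R x y"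
  proof -
    obtain a where a: "a \<in> A" using A_ne by blast
    have V: "v \<in> A \<or> (\<exists>i\<in>I. v \<in> B i) \<or> (\<exists>i\<in>I. v \<in> C i) \<or> v \<in> F \<or> v \<in> X \<or> v \<in> Y \<or> v \<in> U"
      using V_eq assms by blast
    have AB: "\<exists>k\<in>I. \<exists>l\<in>I. k \<noteq> l \<and> complete R A (B k) \<and> complete R A (B l)"
    proof -
      obtain i0 where i0: "\<And>k. k \<in> I \<Longrightarrow> k \<noteq> i0 \<Longrightarrow> complete R A (B k)" using AB_or jI by blast
      obtain k where k: "k \<in> I" "k \<noteq> i0" using ex_index by blast
      obtain l where "l \<in> I" "l \<noteq> i0" "l \<noteq> k" using ex_index by blast
      then show ?thesis using i0 k by blast
    qed
    obtain k where k: "k \<in> I" "k \<noteq> j" using ex_index by blast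
    obtain d where d: "d \<in> C k" using C_ne k by blast
    obtain w where w: "w \<in> B j" using B_ne jI by blast
    obtain e where e: "e \<in> C j" using C_ne jI by blast
    have ad: "\<not> R a d" using AC[OF k(1)] a d unfolding cdefs by blast
    from V consider "v \<in> A" | i where "i \<in> I" "v \<in> B i" | i where "i \<in> I" "v \<in> C i" | "v \<in> F" | "v \<in> X"
      | "v \<in> Y" | "v \<in> U" by blast
    then show ?thesis
    proof cases
      case 1
      obtain k l where kl: "k \<in> I" "l \<in> I" "k \<noteq> l" "complete R A (B k)" "complete R A (B l)" using AB by blast
      obtain x y where "x \<in> B k" "y \<in> B l" using B_ne kl by blast
      then show ?thesis using 1 kl BB'[OF kl(1-3)] unfolding cdefs by blast
    next
      case 2
      then show ?thesis using B_A[OF 2] B_C[OF 2] AC[OF 2(1)] unfolding cdefs by blast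
    next
      case 3
      obtain x where x: "x \<in> B i" "R v x" using C_B[OF 3] by blast
      obtain l where l: "l \<in> I" "l \<noteq> i" using ex_index by blast
      obtain y where y: "y \<in> C l" using C_ne l by blast
      then have "R v y" "\<not> R x y" using CC[OF 3(1) l(1)] BC'[OF 3(1) l(1)] 3 x l unfolding cdefs by blast+
      then show ?thesis using x by blast
    next
      case 4
      then show ?thesis using FA FC[OF k] a d ad unfolding cdefs by blast
    next
      case 5
      then obtain f where f: "f \<in> F" using FXY by blast
      then show ?thesis using 5 FX XB FB' w sym unfolding cdefs by blast
    next
      case 6
      then obtain f where f: "f \<in> F" using FXY by blast
      then show ?thesis using 6 FY YC[OF jI] FC' e sym unfolding cdefs by blast
    next
      case 7
      then show ?thesis using U_adj a d ad mem_sets(1) mem_sets(7)[OF k(1)] by blast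
    qed
  qed
  then obtain x y where "R v x" "R v y" "\<not> R x y" by blast
  then show ?thesis using nU[of x y] refl2 by metis
qed

lemma ex_pentagon:
  shows "\<exists>a b c. is_pentagon R I a b c"
proof -
  \<comment> \<open>In a basket one middle \<open>B i0\<close> may be incomplete to the top, so
    \<open>a\<close> is chosen as a neighbour of a given \<open>b0\<close> in \<open>B i0\<close>;
    in the other arms any middle vertex will do.\<close>
  obtain i0 where i0: "i0 \<in> I" "\<And>k. k \<in> I \<Longrightarrow> k \<noteq> i0 \<Longrightarrow> complete R A (B k)" using AB_or jI by blast
  obtain b0 where b0: "b0 \<in> B i0" using B_ne i0 by blast
  obtain a where a: "a \<in> A" "R b0 a" using B_A i0 b0 by blast
  define b where "b k = (if k = i0 then b0 else SOME x. x \<in> B k)" for k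
  have b: "b k \<in> B k" if "k \<in> I" for k
    using b0 B_ne[OF that] unfolding b_def by (simp add: some_in_eq)
  define c where "c k = (SOME x. x \<in> C k \<and> R (b k) x)" for k
  have c: "c k \<in> C k \<and> R (b k) (c k)" if "k \<in> I" for k
    unfolding c_def using B_C[OF that b[OF that]] someI_ex[of "\<lambda>x. x \<in> C k \<and> R (b k) x"] by blast
  have ab: "R a (b k)" if "k \<in> I" for k
    using i0(2)[OF that] a sym b[OF that] unfolding cdefs b_def by (cases "k = i0") auto
  have "is_pentagon R I a b c"
    unfolding is_pentagon_def
  proof (intro ballI conjI impI)
    fix i assume i: "i \<in> I"
    show "R a (b i)" by (rule ab[OF i])
    show "\<not> R a (c i)" using AC[OF i] a c[OF i] unfolding cdefs by blast
    fix k assume k: "k \<in> I"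
    show "\<not> R (b i) (b k)" if "i \<noteq> k" using BB'[OF i k that] b i k unfolding cdefs by blast
    show "R (c i) (c k)" using CC[OF i k] c i k unfolding cdefs by blast
    show "R (b i) (c k) \<longleftrightarrow> i = k" using BC'[OF i k] c b i k unfolding cdefs by blast
  qed
  then show ?thesis by blast
qed

lemma forb_graph: "forb_graph R"
  using no_C4 no_C6 no_C7 no_P2 no_T0 by unfold_locales

text \<open>In the complement everything outside \<open>U\<close> is joined to one fixed
  \<open>a\<close>: the base directly, top and middle through a base vertex, and \<open>F\<close>
  through the arm \<open>j\<close>.\<close>

lemma anti_path:
  assumes "R x x" "R y y" "x \<notin> U" "y \<notin> U"
  shows "(\<lambda>u v. (u \<in> {v. R v v} - U \<and> v \<in> {v. R v v} - U \<and> \<not> R u v))\<^sup>*\<^sup>* x y"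
proof -
  define S where "S u v \<longleftrightarrow> u \<in> {v. R v v} - U \<and> v \<in> {v. R v v} - U \<and> \<not> R u v" for u v
  have Ssym: "symp S" unfolding S_def symp_def using sym by blast
  have rs: "S\<^sup>*\<^sup>* u v" if "S\<^sup>*\<^sup>* v u" for u v using that symp_rtranclp[OF Ssym] unfolding symp_def by blast
  have SI: "S u v" if "R u u" "R v v" "\<not> R u v" for u v using that U_adj sym unfolding S_def by blast
  obtain a where a: "a \<in> A" using A_ne by blast
  have toA: "S\<^sup>*\<^sup>* k a" if "k \<in> K" for k
    using SI[of k a] TK[of a k] KK[OF that that] mem_sets(1)[OF a] a that sym unfolding T_def by blast
  have Cin: "c \<in> K" if "i \<in> I" "c \<in> C i" for i c using that unfolding K_def by blast
  obtain e where e: "e \<in> C j" using C_ne jI by blast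
  have T: "S\<^sup>*\<^sup>* p a" if "p \<in> T" for p
    using SI[of p e] TK[OF that Cin[OF jI e]] TT[OF that that] toA[OF Cin[OF jI e]] mem_sets(7)[OF jI e]
    by (meson converse_rtranclp_into_rtranclp)
  have B: "S\<^sup>*\<^sup>* b a" if b: "b \<in> B i" "i \<in> I" for b i
  proof -
    obtain l where l: "l \<in> I" "l \<noteq> i" using ex_index by blast
    obtain d where d: "d \<in> C l" using C_ne l by blast
    then have "S b d" using SI[of b d] BC'[OF b(2) l(1)] l b mem_sets(6)[OF b(2,1)] mem_sets(7)[OF l(1) d]
      unfolding cdefs by blast
    then show ?thesis using toA[OF Cin[OF l(1) d]] by (meson converse_rtranclp_into_rtranclp)
  qed
  have F: "S\<^sup>*\<^sup>* f a" if f: "f \<in> F" for f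
  proof -
    obtain w where w: "w \<in> B j" using B_ne jI by blast
    then have "S f w" using SI[of f w] FB' f mem_sets(2)[OF f] mem_sets(6)[OF jI w] unfolding cdefs by blast
    then show ?thesis using B[OF w jI] by (meson converse_rtranclp_into_rtranclp)
  qed
  have all: "S\<^sup>*\<^sup>* u a" if u: "R u u" "u \<notin> U" for u
  proof -
    consider "u \<in> T" | i where "i \<in> I" "u \<in> B i" | "u \<in> K" | "u \<in> F"
      using V_cases[OF u(1)] u(2) BUE by metis
    then show ?thesis using T B toA F by (cases; blast)
  qed
  have "S\<^sup>*\<^sup>* x y" using all[OF assms(1,3)] rs[OF all[OF assms(2,4)]] by simp
  then show ?thesis unfolding S_def .
qed

end

lemma nested_list_full:
  assumes "nested R S T" "finite S" "finite T" "\<And>v. v \<in> T \<Longrightarrow> \<exists>x\<in>S. R x v"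
  shows "\<exists>xs. distinct xs \<and> set xs = S \<and>
    (\<forall>k. Suc k < length xs \<longrightarrow> {v\<in>T. R (xs ! Suc k) v} \<subseteq> {v\<in>T. R (xs ! k) v}) \<and>
    {v\<in>T. R (xs ! 0) v} = T"
proof -
  obtain xs where xs: "distinct xs" "set xs = S"
    "\<And>k. Suc k < length xs \<Longrightarrow> {v\<in>T. R (xs ! Suc k) v} \<subseteq> {v\<in>T. R (xs ! k) v}"
    using nested_list[OF assms(1-3)] by blast
  have "v \<in> {v\<in>T. R (xs ! 0) v}" if v: "v \<in> T" for v
  proof -
    obtain x where "x \<in> S" "R x v" using assms(4)[OF v] by blast
    then obtain k where "k < length xs" "R (xs ! k) v" using xs(2) by (metis in_set_conv_nth)
    then show ?thesis using list_chain[of xs "\<lambda>x. {v\<in>T. R x v}" 0 k, OF xs(3)] v by blast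
  qed
  then show ?thesis using xs by blast
qed

section \<open>Reading baskets, villas and mansions off a blueprint\<close>

locale blueprint_E =
  fixes V :: "'a set" and E and t :: nat and j A B C F X Y U
  assumes G: "graph V E" and t: "t \<ge> 3"
    and bpE: "blueprint (radj V E) {1..t} j A B C F X Y U"
begin

sublocale blueprint_graph "radj V E" "{1..t}" j A B C F X Y U
proof -
  interpret refl_graph "radj V E" by (rule refl_graph_radj[OF G])
  show "blueprint_graph (radj V E) {1..t} j A B C F X Y U"
    by (unfold_locales; use bpE t in simp)
qed

lemma V_radj: "{v. radj V E v v} = V"
  unfolding radj_def by blast

lemma finV: "finite V"
  using G unfolding graph_def by blast

lemma sub:
  "A \<subseteq> V" "F \<subseteq> V" "X \<subseteq> V" "Y \<subseteq> V" "U \<subseteq> V" "i \<in> {1..t} \<Longrightarrow> B i \<subseteq> V" "i \<in> {1..t} \<Longrightarrow> C i \<subseteq> V"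
  using mem_sets V_radj by blast+

lemma cliqueE: "complete (radj V E) S S \<Longrightarrow> clique E S"
  unfolding complete_def clique_def radj_def by blast

lemma completeE: "complete (radj V E) S S' \<Longrightarrow> S \<inter> S' = {} \<Longrightarrow> complete E S S'"
  unfolding complete_def radj_def disjoint_iff by metis

lemma anticompleteE: "anticomplete (radj V E) S S' \<Longrightarrow> S \<subseteq> V \<Longrightarrow> S' \<subseteq> V \<Longrightarrow> anticomplete E S S'"
  unfolding anticomplete_def radj_def by blast

lemma complete_UN: "(\<And>i. i \<in> J \<Longrightarrow> complete P S (M i)) \<Longrightarrow> complete P S (\<Union>i\<in>J. M i)"
  and anticomplete_UN: "(\<And>i. i \<in> J \<Longrightarrow> anticomplete P S (M i)) \<Longrightarrow> anticomplete P S (\<Union>i\<in>J. M i)"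
  unfolding complete_def anticomplete_def by blast+

lemma nbr_eq:
  assumes "x \<in> S" "S \<inter> S' = {}" "S' \<subseteq> V'" "S \<subseteq> V" "S' \<subseteq> V"
  shows "nbr V' E x \<inter> S' = {v\<in>S'. radj V E x v}"
  using assms unfolding nbr_def radj_def by blast

abbreviation "Q \<equiv> A \<union> (\<Union>i\<in>{1..t}. B i) \<union> (\<Union>i\<in>{1..t}. C i)"

text \<open>Every vertex of the other classes has a non-neighbour, and a vertex of \<open>U\<close>
  has none.\<close>

lemma disj_U: "(Q \<union> F \<union> X \<union> Y) \<inter> U = {}"
proof -
  have nU: "x \<notin> U" if "radj V E y y" "\<not> radj V E x y" for x y using U_adj that by blast
  obtain a where a: "a \<in> A" using A_ne by blast
  obtain w where w: "w \<in> B j" using B_ne jI by blast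
  obtain e where e: "e \<in> C j" using C_ne jI by blast
  have "A \<inter> U = {}" using AC[OF jI] e nU[of e] mem_sets(7)[OF jI e] unfolding cdefs by blast
  moreover have "F \<inter> U = {}" using FB' w nU[of w] mem_sets(6)[OF jI w] unfolding cdefs by blast
  moreover have "X \<inter> U = {}" using XC[OF jI] e nU[of e] mem_sets(7)[OF jI e] unfolding cdefs by blast
  moreover have "Y \<inter> U = {}" using YA a nU[of a] mem_sets(1)[OF a] unfolding cdefs by blast
  moreover have "C i \<inter> U = {}" if i: "i \<in> {1..t}" for i
    using AC[OF i] a nU[of a] mem_sets(1)[OF a] sym unfolding cdefs by blast
  moreover have "B i \<inter> U = {}" if i: "i \<in> {1..t}" for i
  proof -
    obtain l where l: "l \<in> {1..t}" "i \<noteq> l" using ex_index by metis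
    obtain d where d: "d \<in> C l" using C_ne l by blast
    show ?thesis using BC'[OF i l] d nU[of d] mem_sets(7)[OF l(1) d] unfolding cdefs by blast
  qed
  ultimately show ?thesis by blast
qed

lemma V_minus_U: "V - U = Q \<union> F \<union> X \<union> Y"
  using V_eq disj_U unfolding V_radj by blast

lemma universal: "clique E (V - (V - U))" "complete E (V - (V - U)) (V - U)"
proof -
  have "E u x" if "u \<in> U" "x \<in> V" "u \<noteq> x" for u x
    using UV that unfolding V_radj complete_def radj_def by blast
  then show "clique E (V - (V - U))" "complete E (V - (V - U)) (V - U)"
    unfolding clique_def complete_def by auto
qed

lemma set_ivl: "set [1..<t + 1] = {1..t}"
  by auto

lemma sorted_BC:
  "sorted_wrt (\<lambda>S T. S \<inter> T = {}) (map B [1..<t + 1] @ map C [1..<t + 1])"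
proof -
  have "sorted_wrt (\<lambda>S T. S \<inter> T = {}) (map B [1..<t + 1])"
    by (rule sorted_wrt_upt) (rule disj_B; simp)
  moreover have "sorted_wrt (\<lambda>S T. S \<inter> T = {}) (map C [1..<t + 1])"
    by (rule sorted_wrt_upt) (rule disj_C; simp)
  ultimately show ?thesis
    unfolding sorted_wrt_append set_map set_ivl using disj_K(1) by blast
qed

lemma disj_YC: "i \<in> {1..t} \<Longrightarrow> Y \<inter> C i = {}"
proof (rule ccontr)
  assume i: "i \<in> {1..t}" and "Y \<inter> C i \<noteq> {}"
  then obtain x where "x \<in> Y" "x \<in> C i" by blast
  then show False using C_B[OF i] YB[OF i] unfolding cdefs by blast
qed

lemma sorted_ABC:
  "sorted_wrt (\<lambda>S T. S \<inter> T = {}) ([A] @ map B [1..<t + 1] @ map C [1..<t + 1])"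
proof -
  have "\<forall>S\<in>set (map B [1..<t + 1] @ map C [1..<t + 1]). A \<inter> S = {}"
    using disj_T(1) disj_TK(1) unfolding set_append set_map set_ivl by blast
  then show ?thesis using sorted_BC by simp
qed

lemma villa_partition_Q:
  assumes AB: "\<And>i. i \<in> {1..t} \<Longrightarrow> complete (radj V E) A (B i)"
  shows "villa_partition Q E t A B C"
  unfolding villa_partition_def
proof (intro conjI ballI impI)
  show "is_partition Q ([A] @ map B [1..<t + 1] @ map C [1..<t + 1])"
    unfolding is_partition_iff
  proof
    show "\<Union> (set ([A] @ map B [1..<t + 1] @ map C [1..<t + 1])) = Q"
      unfolding set_append set_map set_ivl by auto
    show "sorted_wrt (\<lambda>S T. S \<inter> T = {}) ([A] @ map B [1..<t + 1] @ map C [1..<t + 1])"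
      by (rule sorted_ABC)
  qed
  show "3 \<le> t" "A \<noteq> {}" by (fact t A_ne)+
  show "clique E A" by (rule cliqueE[OF AA])
  show "complete E A (\<Union> (B ` {1..t}))"
    using AB disj_T(1) by (intro complete_UN completeE)
  show "anticomplete E A (\<Union> (C ` {1..t}))"
    using AC sub by (intro anticomplete_UN anticompleteE)
  fix i assume i: "i \<in> {1..t}"
  show "B i \<noteq> {}" "C i \<noteq> {}" by (fact B_ne[OF i] C_ne[OF i])+
  show "clique E (B i)" by (rule cliqueE[OF BB[OF i]])
  show "clique E (C i)" by (rule cliqueE[OF CC[OF i i]])
  show "\<exists>bs. distinct bs \<and> set bs = B i \<and> nbr Q E (last bs) \<inter> C i \<noteq> {} \<and>
      (\<forall>k. Suc k < length bs \<longrightarrow> nbr Q E (bs ! Suc k) \<inter> C i \<subseteq> nbr Q E (bs ! k) \<inter> C i) \<and>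
      nbr Q E (bs ! 0) \<inter> C i = C i"
  proof -
    have "\<exists>x\<in>B i. radj V E x v" if "v \<in> C i" for v using C_B[OF i that] sym by blast
    then obtain bs where bs: "distinct bs" "set bs = B i"
      "\<And>k. Suc k < length bs \<Longrightarrow> {v\<in>C i. radj V E (bs ! Suc k) v} \<subseteq> {v\<in>C i. radj V E (bs ! k) v}"
      "{v\<in>C i. radj V E (bs ! 0) v} = C i"
      using nested_list_full[OF nestBC[OF i] finite_subset[OF sub(6)[OF i] finV]
          finite_subset[OF sub(7)[OF i] finV]] by blast
    have CQ: "C i \<subseteq> Q" using i by blast
    have eq: "nbr Q E x \<inter> C i = {v\<in>C i. radj V E x v}" if "x \<in> B i" for x
      by (rule nbr_eq[OF that disj_K(1)[OF i i] CQ sub(6)[OF i] sub(7)[OF i]])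
    have ne: "bs \<noteq> []" using bs(2) B_ne[OF i] by auto
    have mem: "bs ! k \<in> B i" if "k < length bs" for k using that bs(2) nth_mem by blast
    have "last bs \<in> B i" using ne bs(2) last_in_set by blast
    then have "nbr Q E (last bs) \<inter> C i \<noteq> {}" using eq B_C[OF i] by blast
    then show ?thesis using bs eq mem ne by (intro exI[of _ bs]) (simp add: Suc_lessD)
  qed
  fix k assume k: "k \<in> {1..t}" and ik: "i \<noteq> k"
  show "anticomplete E (B i) (B k)" by (rule anticompleteE[OF BB'[OF i k ik] sub(6)[OF i] sub(6)[OF k]])
  show "complete E (C i) (C k)" by (rule completeE[OF CC[OF i k] disj_C[OF i k ik]])
  show "anticomplete E (B i) (C k)" by (rule anticompleteE[OF BC'[OF i k ik] sub(6)[OF i] sub(7)[OF k]])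
qed

lemma mansion:
  assumes AB: "\<And>i. i \<in> {1..t} \<Longrightarrow> complete (radj V E) A (B i)" and F: "F \<noteq> {}"
  shows "is_mansion (V - U) E"
  unfolding is_mansion_def
proof (intro exI conjI)
  show "is_partition (V - U) ([A] @ map B [1..<t + 1] @ map C [1..<t + 1] @ [F, X, Y])"
    unfolding is_partition_iff V_minus_U
  proof
    show "\<Union> (set ([A] @ map B [1..<t + 1] @ map C [1..<t + 1] @ [F, X, Y])) = Q \<union> F \<union> X \<union> Y"
      unfolding set_append set_map set_ivl by auto
    obtain k where k: "k \<in> {1..t}" "k \<noteq> j" using ex_index by blast
    \<comment> \<open>A common vertex would both see and miss the middle of an arm \<open>k\<close>
      different from \<open>j\<close>.\<close>
    have AX: "A \<inter> X = {}"
    proof (rule ccontr)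
      assume "A \<inter> X \<noteq> {}"
      then obtain x where x: "x \<in> A" "x \<in> X" by blast
      obtain y where "y \<in> B k" using B_ne k by blast
      then show False using x AB[OF k(1)] XB'[OF k] unfolding cdefs by blast
    qed
    have "sorted_wrt (\<lambda>S T. S \<inter> T = {}) [F, X, Y]"
      using disj_F(4,5) disj_TK(4) by auto
    moreover have "\<forall>S\<in>set ([A] @ map B [1..<t + 1] @ map C [1..<t + 1]). \<forall>S'\<in>set [F, X, Y]. S \<inter> S' = {}"
    proof -
      have "\<forall>S'\<in>set [F, X, Y]. A \<inter> S' = {}" using AX disj_F(3) disj_TK(3) by simp
      moreover have "\<forall>S'\<in>set [F, X, Y]. B i \<inter> S' = {}" if "i \<in> {1..t}" for i
        using disj_F(1) disj_T(2) disj_K(2) that by (simp add: Int_commute)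
      moreover have "\<forall>S'\<in>set [F, X, Y]. C i \<inter> S' = {}" if "i \<in> {1..t}" for i
        using disj_F(2) disj_TK(2) disj_YC that by (simp add: Int_commute)
      ultimately show ?thesis unfolding set_append set_map set_ivl ball_Un ball_simps by simp
    qed
    ultimately have "sorted_wrt (\<lambda>S T. S \<inter> T = {}) (([A] @ map B [1..<t + 1] @ map C [1..<t + 1]) @ [F, X, Y])"
      using sorted_ABC unfolding sorted_wrt_append by blast
    then show "sorted_wrt (\<lambda>S T. S \<inter> T = {}) ([A] @ map B [1..<t + 1] @ map C [1..<t + 1] @ [F, X, Y])"
      by simp
  qed
  show "villa_partition Q E t A B C" by (rule villa_partition_Q[OF AB])
  show "3 \<le> t" "j \<in> {1..t}" "F \<noteq> {}" by (fact t jI F)+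
  show "clique E F" "clique E X" "clique E Y" by (rule cliqueE; fact FF XX YY)+
  show "complete E F A" using FA disj_F by (intro completeE) blast+
  show "complete E F (\<Union>i\<in>{1..t} - {j}. B i)" "complete E F (\<Union>i\<in>{1..t} - {j}. C i)"
    using FB FC disj_F by (intro complete_UN completeE; blast)+
  show "anticomplete E F (B j \<union> C j)"
    using anticompleteE[OF FB'] anticompleteE[OF FC'] sub jI unfolding anticomplete_def by blast
  show "complete E (B j) (C j)" using F_BC F disj_K(1)[OF jI jI] by (intro completeE) blast+
  show "complete E X (A \<union> B j)"
  proof -
    obtain k where k: "k \<in> {1..t}" "k \<noteq> j" using ex_index by blast
    obtain y where "y \<in> B k" using B_ne k by blast
    then have "A \<inter> X = {}" using AB[OF k(1)] XB'[OF k] unfolding cdefs by blast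
    then show ?thesis using completeE[OF XA] completeE[OF XB] disj_T(2)[OF jI] unfolding complete_def by blast
  qed
  show "anticomplete E X (\<Union>i\<in>{1..t} - {j}. B i)" "anticomplete E X (\<Union>i\<in>{1..t}. C i)"
    using XB' XC sub by (intro anticomplete_UN anticompleteE; blast)+
  show "complete E F (X \<union> Y)"
    using completeE[OF FX] completeE[OF FY] disj_F unfolding complete_def by blast
  show "anticomplete E X Y" by (rule anticompleteE[OF XY sub(3,4)])
  show "complete E Y (\<Union>i\<in>{1..t}. C i)"
    using YC disj_YC by (intro complete_UN completeE)
  show "anticomplete E Y (A \<union> (\<Union>i\<in>{1..t}. B i))"
    using anticompleteE[OF YA] anticompleteE[OF YB] sub unfolding anticomplete_def by blast
qed

lemma basket:
  assumes X: "X = {}" "Y = {}" and t3: "t = 3"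
    and BC: "\<And>i. i \<in> {1..t} \<Longrightarrow> complete (radj V E) (B i) (C i)"
    and i0: "i0 \<in> {1..t}" "\<And>k. k \<in> {1..t} \<Longrightarrow> k \<noteq> i0 \<Longrightarrow> complete (radj V E) A (B k)"
  shows "is_5basket (V - U) E"
proof -
  have I: "{1..t} = {1, 2, 3}" using t3 by auto
  have Q: "V - U = Q \<union> F" using V_minus_U X by blast
  have UN: "(\<Union>i\<in>{1..t}. S i) = S 1 \<union> S 2 \<union> S 3" for S :: "nat \<Rightarrow> 'a set" unfolding I by auto
  show ?thesis
    unfolding is_5basket_def
  proof (rule exI[of _ A], rule exI[of _ B], rule exI[of _ C], rule exI[of _ F], rule exI[of _ i0],
      rule exI[of _ j], intro conjI)
    show "is_partition (V - U) [A, B 1, B 2, B 3, C 1, C 2, C 3, F]"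
      unfolding is_partition_iff Q
    proof
      show "\<Union> (set [A, B 1, B 2, B 3, C 1, C 2, C 3, F]) = Q \<union> F" unfolding UN by auto
      have m: "1 \<in> {1..t}" "2 \<in> {1..t}" "3 \<in> {1..t}" using t3 by auto
      have d: "(1::nat) \<noteq> 2" "(1::nat) \<noteq> 3" "(2::nat) \<noteq> 3" by auto
      show "sorted_wrt (\<lambda>S T. S \<inter> T = {}) [A, B 1, B 2, B 3, C 1, C 2, C 3, F]"
        by (simp only: sorted_wrt.simps list.set ball_simps ball_empty simp_thms
          m[THEN disj_T(1)] m[THEN disj_TK(1)] disj_B[OF m(1,2) d(1)] disj_B[OF m(1,3) d(2)] disj_B[OF m(2,3) d(3)]
          disj_C[OF m(1,2) d(1)] disj_C[OF m(1,3) d(2)] disj_C[OF m(2,3) d(3)]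
          m(1)[THEN disj_K(1), OF m(1)] m(1)[THEN disj_K(1), OF m(2)] m(1)[THEN disj_K(1), OF m(3)]
          m(2)[THEN disj_K(1), OF m(1)] m(2)[THEN disj_K(1), OF m(2)] m(2)[THEN disj_K(1), OF m(3)]
          m(3)[THEN disj_K(1), OF m(1)] m(3)[THEN disj_K(1), OF m(2)] m(3)[THEN disj_K(1), OF m(3)]
          m[THEN disj_F(1)] m[THEN disj_F(2)] disj_F(3))
    qed
    show "A \<noteq> {}" by (rule A_ne)
    show "clique E A" "clique E F" by (rule cliqueE; fact AA FF)+
    show "i0 \<in> {1, 2, 3}" "j \<in> {1, 2, 3}" using i0(1) jI unfolding I by blast+
    show "\<forall>i\<in>{1, 2, 3}. B i \<noteq> {} \<and> clique E (B i) \<and> C i \<noteq> {} \<and> clique E (C i)"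
      unfolding I[symmetric] using B_ne C_ne cliqueE BB CC by blast
    show "\<forall>i\<in>{1, 2, 3}. \<forall>k\<in>{1, 2, 3}. i \<noteq> k \<longrightarrow> anticomplete E (B i) (B k)"
      unfolding I[symmetric] using anticompleteE[OF BB'] sub by blast
    show "\<forall>i\<in>{1, 2, 3}. \<forall>k\<in>{1, 2, 3}. i \<noteq> k \<longrightarrow> complete E (C i) (C k)"
      unfolding I[symmetric] using completeE[OF CC] disj_C by blast
    show "\<forall>i\<in>{1, 2, 3}. complete E (B i) (C i)"
      unfolding I[symmetric] using completeE[OF BC] disj_K(1) by blast
    show "\<forall>i\<in>{1, 2, 3}. \<forall>k\<in>{1, 2, 3}. i \<noteq> k \<longrightarrow> anticomplete E (B i) (C k)"
      unfolding I[symmetric] using anticompleteE[OF BC'] sub by blast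
    show "anticomplete E A (C 1 \<union> C 2 \<union> C 3)"
      unfolding UN[symmetric] using AC sub by (intro anticomplete_UN anticompleteE)
    show "complete E A (B 1 \<union> B 2 \<union> B 3 - B i0)"
      unfolding UN[symmetric] using completeE[OF i0(2)] disj_T(1) unfolding complete_def by blast
    show "\<exists>as. distinct as \<and> set as = A \<and>
        (\<forall>k. Suc k < length as \<longrightarrow>
          nbr (V - U) E (as ! Suc k) \<inter> B i0 \<subseteq> nbr (V - U) E (as ! k) \<inter> B i0) \<and>
        nbr (V - U) E (as ! 0) \<inter> B i0 = B i0"
    proof -
      have "\<exists>x\<in>A. radj V E x v" if "v \<in> B i0" for v using B_A[OF i0(1) that] sym by blast
      then obtain as where as: "distinct as" "set as = A"
        "\<And>k. Suc k < length as \<Longrightarrow> {v\<in>B i0. radj V E (as ! Suc k) v} \<subseteq> {v\<in>B i0. radj V E (as ! k) v}"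
        "{v\<in>B i0. radj V E (as ! 0) v} = B i0"
        using nested_list_full[OF nestAB[OF i0(1)] finite_subset[OF sub(1) finV]
            finite_subset[OF sub(6)[OF i0(1)] finV]] by blast
      have BQ: "B i0 \<subseteq> V - U" using i0(1) Q by blast
      have eq: "nbr (V - U) E x \<inter> B i0 = {v\<in>B i0. radj V E x v}" if "x \<in> A" for x
        by (rule nbr_eq[OF that disj_T(1)[OF i0(1)] BQ sub(1) sub(6)[OF i0(1)]])
      have ne: "as \<noteq> []" using as(2) A_ne by auto
      have mem: "as ! k \<in> A" if "k < length as" for k using that as(2) nth_mem by blast
      show ?thesis using as eq mem ne by (intro exI[of _ as]) (simp add: Suc_lessD)
    qed
    show "complete E F (V - U - (B j \<union> C j \<union> F))"
      unfolding Q using completeE[OF FA] completeE[OF FB] completeE[OF FC] disj_F unfolding complete_def by blast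
    show "anticomplete E F (B j \<union> C j)"
      using anticompleteE[OF FB'] anticompleteE[OF FC'] sub jI unfolding anticomplete_def by blast
  qed
qed

lemma basket_villa_or_mansion: "basket_villa_or_mansion (V - U) E"
proof (cases "\<forall>i\<in>{1..t}. complete (radj V E) A (B i)")
  case True
  show ?thesis
  proof (cases "F = {}")
    case F: True
    then have "V - U = Q" using V_minus_U FXY by blast
    then have "is_villa (V - U) E" using villa_partition_Q True unfolding is_villa_def by metis
    then show ?thesis unfolding basket_villa_or_mansion_def by blast
  next
    case False
    then show ?thesis using mansion True unfolding basket_villa_or_mansion_def by blast
  qed
next
  case False
  then have h: "X = {}" "Y = {}" "card {1..t} = 3"
    "\<And>i. i \<in> {1..t} \<Longrightarrow> complete (radj V E) (B i) (C i)"
    "\<exists>i\<in>{1..t}. \<forall>k\<in>{1..t} - {i}. complete (radj V E) A (B k)"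
    using AB_or by blast+
  obtain i0 where "i0 \<in> {1..t}" "\<And>k. k \<in> {1..t} \<Longrightarrow> k \<noteq> i0 \<Longrightarrow> complete (radj V E) A (B k)"
    using h(5) by blast
  then have "is_5basket (V - U) E" using basket[OF h(1,2) _ h(4)] h(3) by simp
  then show ?thesis unfolding basket_villa_or_mansion_def by blast
qed

end

section \<open>From baskets, villas and mansions to blueprints\<close>

lemma sorted_wrt_uptD:
  assumes "sorted_wrt P (map f [m..<n])" "i \<in> {m..<n}" "k \<in> {m..<n}" "i < k"
  shows "P (f i) (f k)"
proof -
  have "sorted_wrt (\<lambda>x y. P (f x) (f y)) [m..<n]" using assms(1) by (simp add: sorted_wrt_map)
  then have "P (f ([m..<n] ! (i - m))) (f ([m..<n] ! (k - m)))"
    using sorted_wrt_nth_less[of "\<lambda>x y. P (f x) (f y)" "[m..<n]" "i - m" "k - m"] assms(2-4) by auto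
  then show ?thesis using assms(2-4) by simp
qed

lemma partition_BC:
  assumes "sorted_wrt (\<lambda>S T. S \<inter> T = {}) (map B [1..<t + 1] @ map C [1..<t + 1])" "i \<in> {1..t}" "k \<in> {1..t}"
  shows "i \<noteq> k \<Longrightarrow> B i \<inter> B k = {}" and "B i \<inter> C k = {}"
proof -
  have B: "sorted_wrt (\<lambda>S T. S \<inter> T = {}) (map B [1..<t + 1])"
    and BC: "\<forall>S\<in>set (map B [1..<t + 1]). \<forall>T\<in>set (map C [1..<t + 1]). S \<inter> T = {}"
    using assms(1) unfolding sorted_wrt_append by blast+
  have ik: "i \<in> {1..<t + 1}" "k \<in> {1..<t + 1}" using assms by auto
  show "B i \<inter> B k = {}" if "i \<noteq> k"
    using sorted_wrt_uptD[OF B ik] sorted_wrt_uptD[OF B ik(2,1)] that by (cases "i < k") auto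
  show "B i \<inter> C k = {}" using BC ik unfolding set_map set_upt by blast
qed

context
  fixes V :: "'a set" and E R
  defines "R \<equiv> radj V E"
  assumes G: "graph V E"
begin

interpretation refl_graph R unfolding R_def by (rule refl_graph_radj[OF G])

lemma completeR: "complete E S S' \<Longrightarrow> S \<subseteq> V \<Longrightarrow> S' \<subseteq> V \<Longrightarrow> complete R S S'"
  unfolding R_def complete_def radj_def by blast

lemma cliqueR: "clique E S \<Longrightarrow> S \<subseteq> V \<Longrightarrow> complete R S S"
  unfolding R_def complete_def clique_def radj_def by blast

lemma anticompleteR: "anticomplete E S S' \<Longrightarrow> S \<inter> S' = {} \<Longrightarrow> anticomplete R S S'"
  unfolding R_def anticomplete_def radj_def disjoint_iff by metis

lemma nbr_iff:
  assumes "S \<inter> S' = {}" "S' \<subseteq> V'" "S \<subseteq> V" "S' \<subseteq> V" "x \<in> S" "v \<in> S'"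
  shows "v \<in> nbr V' E x \<inter> S' \<longleftrightarrow> R x v"
  using assms unfolding nbr_def R_def radj_def by blast

text \<open>This is the part of \<open>blueprint\<close> that villas and mansions share, in the
  shape in which \<open>blueprint\<close> lists it.\<close>

lemma villa_facts:
  assumes "villa_partition Q E t A B C" "Q \<subseteq> V"
  shows "t \<ge> 3" "Q = A \<union> (\<Union>i\<in>{1..t}. B i) \<union> (\<Union>i\<in>{1..t}. C i)" "A \<noteq> {}" "complete R A A"
    and "\<forall>i\<in>{1..t}. B i \<noteq> {} \<and> C i \<noteq> {} \<and> complete R (B i) (B i) \<and> anticomplete R A (C i) \<and>
        nested R A (B i) \<and> nested R (B i) (C i) \<and>
        (\<forall>v\<in>B i. (\<exists>x\<in>A. R v x) \<and> (\<exists>x\<in>C i. R v x)) \<and> (\<forall>v\<in>C i. \<exists>x\<in>B i. R v x)"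
    and "\<forall>i\<in>{1..t}. \<forall>k\<in>{1..t}. complete R (C i) (C k) \<and>
        (i \<noteq> k \<longrightarrow> anticomplete R (B i) (B k) \<and> anticomplete R (B i) (C k))"
    and "\<forall>i\<in>{1..t}. complete R A (B i)"
proof -
  note v = assms(1)[unfolded villa_partition_def]
  show t: "t \<ge> 3" and A: "A \<noteq> {}" using v by blast+
  have P: "is_partition Q ([A] @ map B [1..<t + 1] @ map C [1..<t + 1])" using v by blast
  have set: "set [1..<t + 1] = {1..t}" by auto
  show Q: "Q = A \<union> (\<Union>i\<in>{1..t}. B i) \<union> (\<Union>i\<in>{1..t}. C i)"
    using P unfolding is_partition_iff set_append set_map set by auto
  have sub: "A \<subseteq> V" "B i \<subseteq> V" "C i \<subseteq> V" "C i \<subseteq> Q" if "i \<in> {1..t}" for i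
    using that Q assms(2) by blast+
  have AV: "A \<subseteq> V" using Q assms(2) by blast
  have D: "\<forall>S\<in>set (map B [1..<t + 1] @ map C [1..<t + 1]). A \<inter> S = {}"
    "sorted_wrt (\<lambda>S T. S \<inter> T = {}) (map B [1..<t + 1] @ map C [1..<t + 1])"
    using P unfolding is_partition_iff by auto
  note d = partition_BC[OF D(2)]
  have dA: "A \<inter> C i = {}" if "i \<in> {1..t}" for i using D(1) that unfolding set_append set_map set by blast
  have cl: "clique E A" "\<forall>i\<in>{1..t}. B i \<noteq> {} \<and> clique E (B i) \<and> C i \<noteq> {} \<and> clique E (C i)" using v by blast+
  have AB: "complete E A (\<Union>i\<in>{1..t}. B i)" and AC: "anticomplete E A (\<Union>i\<in>{1..t}. C i)" using v by blast+
  show "complete R A A" by (rule cliqueR[OF cl(1) AV])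
  show RAB: "\<forall>i\<in>{1..t}. complete R A (B i)"
  proof
    fix i assume i: "i \<in> {1..t}"
    then have "complete E A (B i)" using AB unfolding complete_def by blast
    then show "complete R A (B i)" using completeR AV sub(2)[OF i] by blast
  qed
  show "\<forall>i\<in>{1..t}. \<forall>k\<in>{1..t}. complete R (C i) (C k) \<and>
        (i \<noteq> k \<longrightarrow> anticomplete R (B i) (B k) \<and> anticomplete R (B i) (C k))"
  proof (intro ballI conjI impI)
    fix i k assume i: "i \<in> {1..t}" and k: "k \<in> {1..t}"
    show "complete R (C i) (C k)"
    proof (cases "i = k")
      case True
      then show ?thesis using cl(2) cliqueR sub(3) i by blast
    next
      case False
      then have "complete E (C i) (C k)" using v i k by blast
      then show ?thesis using completeR sub(3) i k by blast
    qed
    assume ik: "i \<noteq> k"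
    have "anticomplete E (B i) (B k)" "anticomplete E (B i) (C k)" using v i k ik by blast+
    then show "anticomplete R (B i) (B k)" "anticomplete R (B i) (C k)"
      using anticompleteR d[OF i k] ik by blast+
  qed
  show "\<forall>i\<in>{1..t}. B i \<noteq> {} \<and> C i \<noteq> {} \<and> complete R (B i) (B i) \<and> anticomplete R A (C i) \<and>
        nested R A (B i) \<and> nested R (B i) (C i) \<and>
        (\<forall>v\<in>B i. (\<exists>x\<in>A. R v x) \<and> (\<exists>x\<in>C i. R v x)) \<and> (\<forall>v\<in>C i. \<exists>x\<in>B i. R v x)"
  proof
    fix i assume i: "i \<in> {1..t}"
    have "\<forall>i\<in>{1..t}. \<exists>bs. distinct bs \<and> set bs = B i \<and> nbr Q E (last bs) \<inter> C i \<noteq> {} \<and>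
        (\<forall>k. Suc k < length bs \<longrightarrow> nbr Q E (bs ! Suc k) \<inter> C i \<subseteq> nbr Q E (bs ! k) \<inter> C i) \<and>
        nbr Q E (bs ! 0) \<inter> C i = C i"
      using v by (elim conjE)
    from bspec[OF this i] obtain bs where bs: "set bs = B i" "nbr Q E (last bs) \<inter> C i \<noteq> {}"
      "\<And>k. Suc k < length bs \<Longrightarrow> nbr Q E (bs ! Suc k) \<inter> C i \<subseteq> nbr Q E (bs ! k) \<inter> C i"
      "nbr Q E (bs ! 0) \<inter> C i = C i"
      by (elim exE conjE) blast
    have eq: "v \<in> nbr Q E x \<inter> C i \<longleftrightarrow> R x v" if "x \<in> B i" "v \<in> C i" for x v
      by (rule nbr_iff[OF d(2)[OF i i] sub(4)[OF i] sub(2)[OF i] sub(3)[OF i] that])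
    have "B i \<noteq> {}" using cl(2) i by blast
    then have ne: "bs \<noteq> []" using bs(1) by auto
    have "nested R (B i) (C i)" by (rule nested_of_list[OF bs(1,3) eq])
    moreover have "\<exists>x\<in>C i. R v x" if vB: "v \<in> B i" for v
    proof -
      obtain k where k: "k < length bs" "v = bs ! k"
        using vB unfolding bs(1)[symmetric] in_set_conv_nth by blast
      \<comment> \<open>Traces decrease along the list, so the nonempty trace of its last entry lies
        inside that of every \<open>v\<close>.\<close>
      have "nbr Q E (bs ! (length bs - 1)) \<inter> C i \<subseteq> nbr Q E (bs ! k) \<inter> C i"
        by (rule list_chain[of bs "\<lambda>x. nbr Q E x \<inter> C i", OF bs(3)]) (use k in auto)
      then have "nbr Q E v \<inter> C i \<noteq> {}" using bs(2) k(2) last_conv_nth[OF ne] by auto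
      then show ?thesis using eq[OF vB] by blast
    qed
    moreover have "\<exists>x\<in>B i. R v x" if "v \<in> C i" for v
    proof -
      have "bs ! 0 \<in> B i" using ne bs(1) nth_mem by blast
      then show ?thesis using eq[of "bs ! 0" v] bs(4) that sym by blast
    qed
    moreover have "B i \<noteq> {}" "C i \<noteq> {}" using cl(2) i by blast+
    moreover have "complete R (B i) (B i)" using cl(2) cliqueR sub(2) i by blast
    moreover have "anticomplete R A (C i)"
    proof -
      have "anticomplete E A (C i)" using AC i unfolding anticomplete_def by blast
      then show ?thesis using anticompleteR dA i by blast
    qed
    moreover have "nested R A (B i)" using RAB i unfolding nested_def complete_def by blast
    moreover have "\<exists>x\<in>A. R v x" if "v \<in> B i" for v using RAB i A that sym unfolding complete_def by blast
    ultimately show "B i \<noteq> {} \<and> C i \<noteq> {} \<and> complete R (B i) (B i) \<and> anticomplete R A (C i) \<and>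
        nested R A (B i) \<and> nested R (B i) (C i) \<and>
        (\<forall>v\<in>B i. (\<exists>x\<in>A. R v x) \<and> (\<exists>x\<in>C i. R v x)) \<and> (\<forall>v\<in>C i. \<exists>x\<in>B i. R v x)"
      by blast
  qed
qed

lemma V_R: "{v. R v v} = V"
  unfolding R_def radj_def by blast

lemma complete_empty [simp]: "complete R {} S'" "complete R S' {}"
  and anticomplete_empty [simp]: "anticomplete R {} S'" "anticomplete R S' {}"
  unfolding complete_def anticomplete_def by blast+

lemma universalR:
  assumes "Q \<subseteq> V" "clique E (V - Q)" "complete E (V - Q) Q"
  shows "complete R (V - Q) {v. R v v}"
  using assms unfolding V_R unfolding R_def radj_def complete_def clique_def by blast

text \<open>Any arm may serve as \<open>j\<close> when \<open>F\<close> and \<open>X\<close> are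
  empty; 1 is chosen.\<close>

lemma blueprint_villa:
  assumes Q: "Q \<subseteq> V" "clique E (V - Q)" "complete E (V - Q) Q" and v: "villa_partition Q E t A B C"
  shows "blueprint R {1..t} 1 A B C {} {} {} (V - Q)"
proof -
  note f = villa_facts[OF v Q(1)]
  have "V = A \<union> \<Union> (B ` {1..t}) \<union> \<Union> (C ` {1..t}) \<union> (V - Q)" using f(2) Q(1) by blast
  then show ?thesis
    unfolding blueprint_def using f(1,3-7) universalR[OF Q] by (simp add: V_R)
qed

lemma blueprint_mansion:
  assumes Q: "Q \<subseteq> V" "clique E (V - Q)" "complete E (V - Q) Q" and m: "is_mansion Q E"
  shows "\<exists>(t::nat) j A B C F X Y. t \<ge> 3 \<and> blueprint R {1..t} j A B C F X Y (V - Q)"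
proof -
  obtain t A B C F X Y j where
    P: "is_partition Q ([A] @ map B [1..<t + 1] @ map C [1..<t + 1] @ [F, X, Y])" and
    cl: "clique E F" "clique E X" "clique E Y" "F \<noteq> {}" and
    vp: "villa_partition (A \<union> (\<Union>i\<in>{1..t}. B i) \<union> (\<Union>i\<in>{1..t}. C i)) E t A B C" and
    j: "j \<in> {1..t}" and
    FA: "complete E F A" "complete E F (\<Union>i\<in>{1..t} - {j}. B i)" "complete E F (\<Union>i\<in>{1..t} - {j}. C i)" and
    Fj: "anticomplete E F (B j \<union> C j)" and BC: "complete E (B j) (C j)" and
    X: "complete E X (A \<union> B j)" "anticomplete E X (\<Union>i\<in>{1..t} - {j}. B i)" "anticomplete E X (\<Union>i\<in>{1..t}. C i)" and
    FXY: "complete E F (X \<union> Y)" and XY: "anticomplete E X Y" and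
    Y: "complete E Y (\<Union>i\<in>{1..t}. C i)" "anticomplete E Y (A \<union> (\<Union>i\<in>{1..t}. B i))"
    using m unfolding is_mansion_def by blast
  have set: "set [1..<t + 1] = {1..t}" by auto
  have Qeq: "Q = A \<union> (\<Union>i\<in>{1..t}. B i) \<union> (\<Union>i\<in>{1..t}. C i) \<union> F \<union> X \<union> Y"
    using P unfolding is_partition_iff set_append set_map set by auto
  have W: "A \<union> (\<Union>i\<in>{1..t}. B i) \<union> (\<Union>i\<in>{1..t}. C i) \<subseteq> V" using Qeq Q(1) by blast
  note f = villa_facts[OF vp W]
  have sub: "A \<subseteq> V" "F \<subseteq> V" "X \<subseteq> V" "Y \<subseteq> V" using Qeq Q(1) by blast+
  have subi: "B i \<subseteq> V" "C i \<subseteq> V" if "i \<in> {1..t}" for i using that W by blast+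
  have "sorted_wrt (\<lambda>S T. S \<inter> T = {}) (([A] @ map B [1..<t + 1] @ map C [1..<t + 1]) @ [F, X, Y])"
    using P unfolding is_partition_iff by simp
  then have D: "\<forall>S\<in>set ([A] @ map B [1..<t + 1] @ map C [1..<t + 1]). \<forall>S'\<in>set [F, X, Y]. S \<inter> S' = {}"
    "sorted_wrt (\<lambda>S T. S \<inter> T = {}) [F, X, Y]"
    unfolding sorted_wrt_append by blast+
  have d: "F \<inter> X = {}" "F \<inter> Y = {}" "X \<inter> Y = {}" "A \<inter> F = {}" "A \<inter> X = {}" "A \<inter> Y = {}"
    using D by auto
  have di: "B i \<inter> F = {}" "B i \<inter> X = {}" "B i \<inter> Y = {}" "C i \<inter> F = {}" "C i \<inter> X = {}" "C i \<inter> Y = {}"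
    if "i \<in> {1..t}" for i
    using D(1) that unfolding set_append set_map set by simp_all
  have "\<forall>i\<in>{1..t}. anticomplete R X (C i) \<and> complete R Y (C i) \<and> anticomplete R Y (B i)"
  proof (intro ballI conjI)
    fix i assume i: "i \<in> {1..t}"
    have "anticomplete E X (C i)" using X(3) i unfolding anticomplete_def by blast
    moreover have "complete E Y (C i)" using Y(1) i unfolding complete_def by blast
    moreover have "anticomplete E Y (B i)" using Y(2) i unfolding anticomplete_def by blast
    ultimately show "anticomplete R X (C i)" "complete R Y (C i)" "anticomplete R Y (B i)"
      using anticompleteR[of X "C i"] anticompleteR[of Y "B i"] completeR[of Y "C i"] di[OF i] sub subi[OF i] by blast+
  qed
  moreover have "\<forall>i\<in>{1..t} - {j}. complete R F (B i) \<and> complete R F (C i) \<and> anticomplete R X (B i)"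
  proof (intro ballI conjI)
    fix i assume ij: "i \<in> {1..t} - {j}"
    then have i: "i \<in> {1..t}" by blast
    have "complete E F (B i)" "complete E F (C i)" "anticomplete E X (B i)"
      using FA(2,3) X(2) ij unfolding complete_def anticomplete_def by blast+
    then show "complete R F (B i)" "complete R F (C i)" "anticomplete R X (B i)"
      using anticompleteR[of X "B i"] completeR[of F "C i"] completeR[of F "B i"] di[OF i] sub subi[OF i] by blast+
  qed
  moreover have "anticomplete R F (B j)" "anticomplete R F (C j)"
  proof -
    have "anticomplete E F (B j)" "anticomplete E F (C j)" using Fj unfolding anticomplete_def by blast+
    then show "anticomplete R F (B j)" "anticomplete R F (C j)"
      using anticompleteR[of F "B j"] anticompleteR[of F "C j"] di[OF j] by blast+
  qed
  moreover have "complete R F A" by (rule completeR[OF FA(1) sub(2,1)])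
  moreover have "complete R F X" "complete R F Y" "complete R X A" "complete R X (B j)"
  proof -
    have "complete E F X" "complete E F Y" "complete E X A" "complete E X (B j)"
      using FXY X(1) unfolding complete_def by blast+
    then show "complete R F X" "complete R F Y" "complete R X A" "complete R X (B j)"
      using completeR sub subi(1)[OF j] by blast+
  qed
  moreover have "anticomplete R X Y" by (rule anticompleteR[OF XY d(3)])
  moreover have "anticomplete R Y A"
  proof -
    have "anticomplete E Y A" using Y(2) unfolding anticomplete_def by blast
    then show ?thesis using anticompleteR[of Y A] d(6) by blast
  qed
  moreover have "complete R (B j) (C j)" by (rule completeR[OF BC subi[OF j]])
  moreover have "complete R F F" "complete R X X" "complete R Y Y" using cliqueR cl sub by blast+
  moreover have "{v. R v v} = A \<union> (\<Union>i\<in>{1..t}. B i) \<union> (\<Union>i\<in>{1..t}. C i) \<union> F \<union> X \<union> Y \<union> (V - Q)"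
    using Qeq Q(1) V_R by blast
  ultimately have "blueprint R {1..t} j A B C F X Y (V - Q)"
    unfolding blueprint_def using f(3-7) universalR[OF Q] cl(4) j by (intro conjI) auto
  then show ?thesis using f(1) by blast
qed

text \<open>Since every middle is complete to its base, the nesting between them is immediate. The
  ordering of \<open>A\<close> in a basket supplies the nesting between \<open>A\<close> and
  \<open>B i0\<close>.\<close>

lemma blueprint_basket:
  assumes Q: "Q \<subseteq> V" "clique E (V - Q)" "complete E (V - Q) Q" and b: "is_5basket Q E"
  shows "\<exists>j A B C F. blueprint R {1..3::nat} j A B C F {} {} (V - Q)"
proof -
  have I: "{1, 2, 3} = {1..3::nat}" by auto
  obtain A B C F i0 j as where
    P: "is_partition Q [A, B 1, B 2, B 3, C 1, C 2, C 3, F]" and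
    A: "A \<noteq> {}" "clique E A" and
    cl: "\<forall>i\<in>{1..3::nat}. B i \<noteq> {} \<and> clique E (B i) \<and> C i \<noteq> {} \<and> clique E (C i)" and
    F: "clique E F" and
    BB: "\<forall>i\<in>{1..3::nat}. \<forall>j\<in>{1..3}. i \<noteq> j \<longrightarrow> anticomplete E (B i) (B j)" and
    CC: "\<forall>i\<in>{1..3::nat}. \<forall>j\<in>{1..3}. i \<noteq> j \<longrightarrow> complete E (C i) (C j)" and
    i0: "i0 \<in> {1..3}" and
    AB: "complete E A ((B 1 \<union> B 2 \<union> B 3) - B i0)" and
    as': "distinct as" "set as = A"
      "\<forall>k. Suc k < length as \<longrightarrow> nbr Q E (as ! Suc k) \<inter> B i0 \<subseteq> nbr Q E (as ! k) \<inter> B i0"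
      "nbr Q E (as ! 0) \<inter> B i0 = B i0" and
    AC: "anticomplete E A (C 1 \<union> C 2 \<union> C 3)" and
    BC: "\<forall>i\<in>{1..3::nat}. complete E (B i) (C i)" and
    BC': "\<forall>i\<in>{1..3::nat}. \<forall>j\<in>{1..3}. i \<noteq> j \<longrightarrow> anticomplete E (B i) (C j)" and
    j: "j \<in> {1..3}" and
    FQ: "complete E F (Q - (B j \<union> C j \<union> F))" and Fj: "anticomplete E F (B j \<union> C j)"
    using b unfolding is_5basket_def I by (elim exE conjE) (rule that; assumption)
  have UN: "S 1 \<union> S 2 \<union> S 3 = (\<Union>i\<in>{1..3}. S i)" for S :: "nat \<Rightarrow> 'a set" unfolding I[symmetric] by auto
  have Qeq: "Q = A \<union> (\<Union>i\<in>{1..3}. B i) \<union> (\<Union>i\<in>{1..3}. C i) \<union> F"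
    using P unfolding is_partition_iff UN[symmetric] by auto
  have sub: "A \<subseteq> V" "F \<subseteq> V" using Qeq Q(1) by blast+
  have subi: "B i \<subseteq> V" "C i \<subseteq> V" "B i \<subseteq> Q" "C i \<subseteq> Q" if "i \<in> {1..3}" for i using that Qeq Q(1) by blast+
  have sw: "sorted_wrt (\<lambda>S T. S \<inter> T = {}) [A, B 1, B 2, B 3, C 1, C 2, C 3, F]"
    using P unfolding is_partition_iff by blast
  have up: "[1..<3 + 1] = [1, 2, 3::nat]" by (simp add: upt_rec)
  have d: "i \<noteq> k \<Longrightarrow> B i \<inter> B k = {}" "B i \<inter> C k = {}" if "i \<in> {1..3}" "k \<in> {1..3}" for i k
    using partition_BC[of B 3 C, OF _ that] sw unfolding up by simp_all
  have dC: "C i \<inter> C k = {}" if "i \<in> {1..3}" "k \<in> {1..3}" "i \<noteq> k" for i k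
    using that sw unfolding I[symmetric] by auto
  have di: "A \<inter> B i = {}" "A \<inter> C i = {}" "B i \<inter> F = {}" "C i \<inter> F = {}" if "i \<in> {1..3}" for i
    using that sw unfolding I[symmetric] by auto
  have dF: "A \<inter> F = {}" using sw by auto
  have RAB: "complete R A (B k)" if "k \<in> {1..3}" "k \<noteq> i0" for k
  proof -
    have "B k \<subseteq> (B 1 \<union> B 2 \<union> B 3) - B i0" using d(1)[OF that(1) i0 that(2)] that(1) unfolding UN by blast
    then have "complete E A (B k)" using AB unfolding complete_def by blast
    then show ?thesis using completeR sub subi that(1) by blast
  qed
  have as: "set as = A" "\<And>k. Suc k < length as \<Longrightarrow> nbr Q E (as ! Suc k) \<inter> B i0 \<subseteq> nbr Q E (as ! k) \<inter> B i0"
    "nbr Q E (as ! 0) \<inter> B i0 = B i0" using as' by blast+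
  have eq: "v \<in> nbr Q E x \<inter> B i0 \<longleftrightarrow> R x v" if "x \<in> A" "v \<in> B i0" for x v
    by (rule nbr_iff[OF di(1)[OF i0] subi(3)[OF i0] sub(1) subi(1)[OF i0] that])
  have nest0: "nested R A (B i0)" by (rule nested_of_list[OF as(1,2) eq])
  have a0: "as ! 0 \<in> A" using A as(1) nth_mem[of 0 as] by auto
  have nestAB: "nested R A (B i)" if "i \<in> {1..3}" for i
    using nest0 RAB[OF that] unfolding nested_def complete_def by (cases "i = i0") blast+
  have BA: "\<exists>x\<in>A. R v x" if "i \<in> {1..3}" "v \<in> B i" for i v
  proof (cases "i = i0")
    case True
    then show ?thesis using eq[OF a0] as(3) that(2) a0 sym by blast
  next
    case False
    then show ?thesis using RAB that A sym unfolding complete_def by blast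
  qed
  have RBC: "complete R (B i) (C i)" if "i \<in> {1..3}" for i using BC completeR subi that by blast
  have B3: "\<forall>i\<in>{1..3}. B i \<noteq> {} \<and> C i \<noteq> {} \<and> complete R (B i) (B i) \<and> anticomplete R A (C i) \<and>
        nested R A (B i) \<and> nested R (B i) (C i) \<and>
        (\<forall>v\<in>B i. (\<exists>x\<in>A. R v x) \<and> (\<exists>x\<in>C i. R v x)) \<and> (\<forall>v\<in>C i. \<exists>x\<in>B i. R v x)"
  proof
    fix i :: nat assume i: "i \<in> {1..3}"
    have ne: "B i \<noteq> {}" "C i \<noteq> {}" using cl i by blast+
    have "complete R (B i) (B i)" using cl cliqueR subi(1) i by blast
    moreover have "anticomplete R A (C i)"
    proof -
      have "anticomplete E A (C i)" using AC i unfolding UN anticomplete_def by blast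
      then show ?thesis using anticompleteR di(2)[OF i] by blast
    qed
    moreover have "nested R (B i) (C i)" using RBC[OF i] unfolding nested_def complete_def by blast
    moreover have "\<forall>v\<in>B i. \<exists>x\<in>C i. R v x" "\<forall>v\<in>C i. \<exists>x\<in>B i. R v x"
      using RBC[OF i] ne sym unfolding complete_def by blast+
    ultimately show "B i \<noteq> {} \<and> C i \<noteq> {} \<and> complete R (B i) (B i) \<and> anticomplete R A (C i) \<and>
        nested R A (B i) \<and> nested R (B i) (C i) \<and>
        (\<forall>v\<in>B i. (\<exists>x\<in>A. R v x) \<and> (\<exists>x\<in>C i. R v x)) \<and> (\<forall>v\<in>C i. \<exists>x\<in>B i. R v x)"
      using ne nestAB[OF i] BA[OF i] by blast
  qed
  have "\<forall>i\<in>{1..3}. \<forall>k\<in>{1..3}. complete R (C i) (C k) \<and>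
        (i \<noteq> k \<longrightarrow> anticomplete R (B i) (B k) \<and> anticomplete R (B i) (C k))"
  proof (intro ballI conjI impI)
    fix i k :: nat assume i: "i \<in> {1..3}" and k: "k \<in> {1..3}"
    show "complete R (C i) (C k)"
    proof (cases "i = k")
      case True
      then show ?thesis using cl cliqueR subi(2) i by blast
    next
      case False
      then have "complete E (C i) (C k)" using CC i k by blast
      then show ?thesis using completeR subi(2) i k by blast
    qed
    assume ik: "i \<noteq> k"
    have "anticomplete E (B i) (B k)" "anticomplete E (B i) (C k)" using BB BC' i k ik by blast+
    then show "anticomplete R (B i) (B k)" "anticomplete R (B i) (C k)"
      using anticompleteR d[OF i k] ik by blast+
  qed
  moreover have "\<forall>i\<in>{1..3} - {j}. complete R F (B i) \<and> complete R F (C i)"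
  proof (intro ballI conjI)
    fix i assume "i \<in> {1..3} - {j}"
    then have i: "i \<in> {1..3}" "i \<noteq> j" by blast+
    have "B i \<subseteq> Q - (B j \<union> C j \<union> F)"
      using subi(3)[OF i(1)] d(1)[OF i(1) j i(2)] d(2)[OF i(1) j] di(3)[OF i(1)] by blast
    then have "complete E F (B i)" using FQ unfolding complete_def by blast
    then show "complete R F (B i)" using completeR sub(2) subi(1)[OF i(1)] by blast
    have "C i \<subseteq> Q - (B j \<union> C j \<union> F)"
      using subi(4)[OF i(1)] dC[OF i(1) j i(2)] d(2)[OF j i(1)] di(4)[OF i(1)] by blast
    then have "complete E F (C i)" using FQ unfolding complete_def by blast
    then show "complete R F (C i)" using completeR sub(2) subi(2)[OF i(1)] by blast
  qed
  moreover have "complete R F A"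
  proof -
    have "A \<subseteq> Q - (B j \<union> C j \<union> F)" using Qeq di(1,2)[OF j] dF by blast
    then have "complete E F A" using FQ unfolding complete_def by blast
    then show ?thesis using completeR sub by blast
  qed
  moreover have "anticomplete R F (B j)" "anticomplete R F (C j)"
  proof -
    have "anticomplete E F (B j)" "anticomplete E F (C j)" using Fj unfolding anticomplete_def by blast+
    then show "anticomplete R F (B j)" "anticomplete R F (C j)"
      using anticompleteR[of F "B j"] anticompleteR[of F "C j"] di[OF j] by blast+
  qed
  moreover have "complete R A A" "complete R F F" using cliqueR A(2) F sub by blast+
  moreover have "{v. R v v} = A \<union> (\<Union>i\<in>{1..3}. B i) \<union> (\<Union>i\<in>{1..3}. C i) \<union> F \<union> {} \<union> {} \<union> (V - Q)"
    using Qeq Q(1) V_R by blast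
  moreover have "\<exists>i\<in>{1..3}. \<forall>k\<in>{1..3} - {i}. complete R A (B k)" using RAB i0 by blast
  ultimately have "blueprint R {1..3::nat} j A B C F {} {} (V - Q)"
    unfolding blueprint_def using B3 RBC universalR[OF Q] A(1) j by (intro conjI) auto
  then show ?thesis by blast
qed

lemma ex_blueprint_of:
  assumes "Q \<subseteq> V" "clique E (V - Q)" "complete E (V - Q) Q" "basket_villa_or_mansion Q E"
  shows "\<exists>(t::nat) j A B C F X Y. t \<ge> 3 \<and> blueprint R {1..t} j A B C F X Y (V - Q)"
  using assms(4) unfolding basket_villa_or_mansion_def
proof (elim disjE)
  assume "is_5basket Q E"
  then show ?thesis using blueprint_basket[OF assms(1-3)] by blast
next
  assume "is_villa Q E"
  then obtain t A B C where v: "villa_partition Q E t A B C" unfolding is_villa_def by blast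
  then have "t \<ge> 3" unfolding villa_partition_def by blast
  then show ?thesis using blueprint_villa[OF assms(1-3) v] by blast
next
  assume "is_mansion Q E"
  then show ?thesis using blueprint_mansion[OF assms(1-3)] by blast
qed

end

section \<open>Anticomponents\<close>

abbreviation anti_step :: "'a set \<Rightarrow> ('a \<Rightarrow> 'a \<Rightarrow> bool) \<Rightarrow> 'a \<Rightarrow> 'a \<Rightarrow> bool" where
  "anti_step S E \<equiv> \<lambda>x y. x \<in> S \<and> y \<in> S \<and> x \<noteq> y \<and> \<not> E x y"

lemma anticonnected_iff:
  "anticonnected S E \<longleftrightarrow> S \<noteq> {} \<and> (\<forall>x\<in>S. \<forall>y\<in>S. (anti_step S E)\<^sup>*\<^sup>* x y)"
  unfolding anticonnected_def connected_wrt_def by (rule refl)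

lemma anticonnected_pair:
  assumes "x \<noteq> y" "\<not> E x y" "\<not> E y x"
  shows "anticonnected {x, y} E"
  unfolding anticonnected_iff using assms by (auto intro: r_into_rtranclp)

lemma anticonnected_ex_step:
  assumes "anticonnected S E" "x \<in> S" "y \<in> S" "x \<noteq> y"
  shows "\<exists>z\<in>S. z \<noteq> x \<and> \<not> E x z"
proof -
  have "(anti_step S E)\<^sup>*\<^sup>* x y" using assms unfolding anticonnected_iff by blast
  then show ?thesis using assms(4) by (cases rule: converse_rtranclpE) auto
qed

lemma ex_anticomponent:
  assumes "finite V" "S \<subseteq> V" "anticonnected S E"
  shows "\<exists>T. S \<subseteq> T \<and> anticomponent V E T"
proof -
  define M where "M = {T. S \<subseteq> T \<and> T \<subseteq> V \<and> anticonnected T E}"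
  have "M \<subseteq> Pow V" unfolding M_def by blast
  then have "finite M" using assms(1) finite_subset by blast
  moreover have "S \<in> M" unfolding M_def using assms(2,3) by blast
  ultimately obtain T where T: "T \<in> M" "\<And>T'. T' \<in> M \<Longrightarrow> T \<subseteq> T' \<Longrightarrow> T = T'"
    using finite_has_maximal2[of M S] by metis
  have T': "S \<subseteq> T" "T \<subseteq> V" "anticonnected T E" using T(1) unfolding M_def by blast+
  have "T' = T" if "T \<subseteq> T'" "T' \<subseteq> V" "anticonnected T' E" for T'
    using T(2)[of T'] that T'(1) unfolding M_def by blast
  then have "anticomponent V E T" unfolding anticomponent_def using T' by blast
  then show ?thesis using T' by blast
qed

lemma card_ge_2D:
  assumes "card S \<ge> 2" shows "\<exists>x\<in>S. \<exists>y\<in>S. x \<noteq> y"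
proof (rule ccontr)
  assume n: "\<not> ?thesis"
  then have "S = {} \<or> (\<exists>x. S = {x})" by blast
  then show False using assms by auto
qed

lemma card_ge_2I: "finite S \<Longrightarrow> x \<in> S \<Longrightarrow> y \<in> S \<Longrightarrow> x \<noteq> y \<Longrightarrow> card S \<ge> 2"
  by (metis card_le_Suc0_iff_eq not_less_eq_eq numeral_2_eq_2)

text \<open>A nonadjacent pair lies in some nontrivial anticomponent, so uniqueness makes each
  vertex outside \<open>S\<close> adjacent to all others. Conversely, every vertex of an
  anticonnected set with two elements has a non-neighbour, so such a set stays inside
  \<open>S\<close>. The hypothesis on \<open>P\<close> comes with the data on \<open>V - S\<close>
  because a blueprint describes the whole graph, universal vertices included.\<close>

lemma unique_anticomponent_iff:
  assumes G: "graph V E" and P: "\<And>S. S \<subseteq> V \<Longrightarrow> clique E (V - S) \<Longrightarrow> complete E (V - S) S \<Longrightarrow> P S \<Longrightarrow>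
      anticonnected S E \<and> (\<exists>x\<in>S. \<exists>y\<in>S. x \<noteq> y)"
  shows "(\<exists>S. nontrivial_anticomponent V E S \<and> (\<forall>S'. nontrivial_anticomponent V E S' \<longrightarrow> S' = S) \<and> P S) \<longleftrightarrow>
    (\<exists>S. S \<subseteq> V \<and> P S \<and> clique E (V - S) \<and> complete E (V - S) S)"
proof
  have fin: "finite V" and sym: "\<And>x y. E x y \<Longrightarrow> E y x" using G unfolding graph_def by blast+
  assume "\<exists>S. nontrivial_anticomponent V E S \<and> (\<forall>S'. nontrivial_anticomponent V E S' \<longrightarrow> S' = S) \<and> P S"
  then obtain S where S: "anticomponent V E S" "card S \<ge> 2" "P S"
    and uniq: "\<And>S'. anticomponent V E S' \<Longrightarrow> card S' \<ge> 2 \<Longrightarrow> S' = S"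
    unfolding nontrivial_anticomponent_def by blast
  have SV: "S \<subseteq> V" using S(1) unfolding anticomponent_def by blast
  have key: "x \<in> S \<and> y \<in> S" if xy: "x \<in> V" "y \<in> V" "x \<noteq> y" "\<not> E x y" for x y
  proof -
    have "anticonnected {x, y} E" using anticonnected_pair xy sym by metis
    moreover have "{x, y} \<subseteq> V" using xy by blast
    ultimately obtain T where T: "{x, y} \<subseteq> T" "anticomponent V E T" using ex_anticomponent[OF fin] by metis
    have "T \<subseteq> V" using T(2) unfolding anticomponent_def by blast
    then have "finite T" using fin by (rule finite_subset)
    then have "card T \<ge> 2" using card_ge_2I[of T x y] T xy by blast
    then show ?thesis using uniq T by blast
  qed
  have "clique E (V - S)" unfolding clique_def using key by blast
  moreover have "complete E (V - S) S" unfolding complete_def using key SV by blast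
  ultimately show "\<exists>S. S \<subseteq> V \<and> P S \<and> clique E (V - S) \<and> complete E (V - S) S" using SV S by blast
next
  have fin: "finite V" and sym: "\<And>x y. E x y \<Longrightarrow> E y x" using G unfolding graph_def by blast+
  assume "\<exists>S. S \<subseteq> V \<and> P S \<and> clique E (V - S) \<and> complete E (V - S) S"
  then obtain S where S: "S \<subseteq> V" "P S" "clique E (V - S)" "complete E (V - S) S" by blast
  have ac: "anticonnected S E" and two: "\<exists>x\<in>S. \<exists>y\<in>S. x \<noteq> y" using P S by blast+
  have adj: "x \<in> S" if "x \<in> V" "y \<in> V" "x \<noteq> y" "\<not> E x y" for x y
    using that S(3,4) unfolding clique_def complete_def by blast
  have sub: "T \<subseteq> S" if T: "T \<subseteq> V" "anticonnected T E" "x \<in> T" "y \<in> T" "x \<noteq> y" for T x y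
  proof
    fix z assume z: "z \<in> T"
    obtain w where "w \<in> T" "w \<noteq> z" using T by blast
    then obtain u where "u \<in> T" "u \<noteq> z" "\<not> E z u" using anticonnected_ex_step[OF T(2) z] by metis
    then show "z \<in> S" using adj[of z u] z T(1) by blast
  qed
  have max: "T = S" if "S \<subseteq> T" "T \<subseteq> V" "anticonnected T E" for T
    using sub[OF that(2,3)] two that(1) by blast
  have "card S \<ge> 2" using card_ge_2I[of S] two finite_subset[OF S(1) fin] by blast
  then have "nontrivial_anticomponent V E S"
    unfolding nontrivial_anticomponent_def anticomponent_def using S ac max by blast
  moreover have "S' = S" if S': "nontrivial_anticomponent V E S'" for S'
  proof -
    have h: "S' \<subseteq> V" "anticonnected S' E" "\<And>T. S' \<subseteq> T \<Longrightarrow> T \<subseteq> V \<Longrightarrow> anticonnected T E \<Longrightarrow> T = S'" "card S' \<ge> 2"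
      using S' unfolding nontrivial_anticomponent_def anticomponent_def by blast+
    obtain x y where "x \<in> S'" "y \<in> S'" "x \<noteq> y" using card_ge_2D[OF h(4)] by blast
    then have "S' \<subseteq> S" using sub[OF h(1,2)] by blast
    then show ?thesis using h(3)[OF _ S(1) ac] by blast
  qed
  ultimately show "\<exists>S. nontrivial_anticomponent V E S \<and> (\<forall>S'. nontrivial_anticomponent V E S' \<longrightarrow> S' = S) \<and> P S"
    using S(2) by blast
qed

section \<open>Assembly of the equivalences\<close>

lemma is_pentagon_subset: "is_pentagon R I a b c \<Longrightarrow> J \<subseteq> I \<Longrightarrow> is_pentagon R J a b c"
  unfolding is_pentagon_def by blast

lemma (in blueprint_E) blueprint_properties:
  "forb_graph (radj V E)" "\<exists>a b c. is_pentagon (radj V E) {1..3} a b c"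
  "\<not> (\<exists>v\<in>V. simplicial V E v)" "anticonnected (V - U) E" "\<exists>x\<in>V - U. \<exists>y\<in>V - U. x \<noteq> y"
proof -
  show "forb_graph (radj V E)" by (rule forb_graph)
  have "{1..3} \<subseteq> {1..t}" using t by auto
  then show "\<exists>a b c. is_pentagon (radj V E) {1..3} a b c"
    using ex_pentagon is_pentagon_subset by metis
  show "\<not> (\<exists>v\<in>V. simplicial V E v)"
  proof
    assume "\<exists>v\<in>V. simplicial V E v"
    then obtain v where v: "v \<in> V" "clique E (nbr V E v)" unfolding simplicial_def by blast
    then have "radj V E v v" unfolding radj_def by blast
    then obtain x y where xy: "radj V E v x" "radj V E v y" "\<not> radj V E x y" using nonadjacent_nbrs by blast
    then have "x \<in> nbr V E v" "y \<in> nbr V E v" "x \<noteq> y" using sym unfolding nbr_def radj_def by blast+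
    then have "E x y" using v(2) unfolding clique_def by blast
    then show False using xy unfolding radj_def by blast
  qed
  obtain a d where ad: "a \<in> A" "d \<in> C j" using A_ne C_ne jI by blast
  then have "\<not> radj V E a d" using AC[OF jI] unfolding cdefs by blast
  then have "a \<noteq> d" using mem_sets(1) ad by blast
  moreover have "a \<in> V - U" "d \<in> V - U" using ad V_minus_U jI by blast+
  ultimately show two: "\<exists>x\<in>V - U. \<exists>y\<in>V - U. x \<noteq> y" by blast
  show "anticonnected (V - U) E"
    unfolding anticonnected_iff
  proof (intro conjI ballI)
    show "V - U \<noteq> {}" using two by blast
    fix x y assume "x \<in> V - U" "y \<in> V - U"
    then have "(\<lambda>u v. u \<in> V - U \<and> v \<in> V - U \<and> \<not> radj V E u v)\<^sup>*\<^sup>* x y"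
      using anti_path[of x y] unfolding V_radj by (simp add: radj_def)
    then show "(anti_step (V - U) E)\<^sup>*\<^sup>* x y"
      by (rule rtranclp_mono[THEN predicate2D, rotated]) (auto simp: radj_def)
  qed
qed

theorem theorem5p7:
  fixes V :: "'a set" and E :: "'a \<Rightarrow> 'a \<Rightarrow> bool"
  assumes G: "graph V E"
  defines "cond_a \<equiv>
      \<not> contains_induced V E twoP3_V twoP3_E \<and>
      \<not> contains_induced V E (cycle_V 4) (cycle_E 4) \<and>
      \<not> contains_induced V E (cycle_V 6) (cycle_E 6) \<and>
      \<not> contains_induced V E (cycle_V 7) (cycle_E 7) \<and>
      \<not> contains_induced V E T0_V T0_E \<and>
      contains_induced V E (pentagon_V 3) (pentagon_E 3) \<and>
      \<not> (\<exists>v\<in>V. simplicial V E v)"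
  and "cond_b \<equiv>
      (\<exists>S. nontrivial_anticomponent V E S \<and>
           (\<forall>S'. nontrivial_anticomponent V E S' \<longrightarrow> S' = S) \<and>
           basket_villa_or_mansion S E)"
  and "cond_c \<equiv>
      (\<exists>Q. Q \<subseteq> V \<and> basket_villa_or_mansion Q E \<and>
           clique E (V - Q) \<and> complete E (V - Q) Q)"
  shows "(cond_a \<longleftrightarrow> cond_b) \<and> (cond_b \<longleftrightarrow> cond_c)"
proof -
  have bp: "\<exists>t j A B C F X Y. blueprint_E V E t j A B C F X Y (V - Q)"
    if "Q \<subseteq> V" "clique E (V - Q)" "complete E (V - Q) Q" "basket_villa_or_mansion Q E" for Q
    using ex_blueprint_of[OF G that] G unfolding blueprint_E_def by blast
  have bc: "cond_b \<longleftrightarrow> cond_c"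
    unfolding cond_b_def cond_c_def
  proof (rule unique_anticomponent_iff[OF G])
    fix S assume S: "S \<subseteq> V" "clique E (V - S)" "complete E (V - S) S" "basket_villa_or_mansion S E"
    from bp[OF S] obtain t j A B C F X Y where "blueprint_E V E t j A B C F X Y (V - S)" by (elim exE)
    from blueprint_E.blueprint_properties(4,5)[OF this]
    show "anticonnected S E \<and> (\<exists>x\<in>S. \<exists>y\<in>S. x \<noteq> y)" using S(1) by (simp add: double_diff)
  qed
  have "cond_a" if cond_c
  proof -
    obtain Q where Q: "Q \<subseteq> V" "clique E (V - Q)" "complete E (V - Q) Q" "basket_villa_or_mansion Q E"
      using \<open>cond_c\<close> unfolding cond_c_def by blast
    from bp[OF Q] obtain t j A B C F X Y where "blueprint_E V E t j A B C F X Y (V - Q)" by (elim exE)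
    from blueprint_E.blueprint_properties(1-3)[OF this] show cond_a
      unfolding cond_a_def ex_pentagon_iff[OF G] using forb_graph_not_contains[OF G] by blast
  qed
  moreover have "cond_c" if cond_a
  proof -
    have F: "forb_graph (radj V E)" using forb_graph_radj[OF G] \<open>cond_a\<close> unfolding cond_a_def by blast
    obtain a b c where "is_pentagon (radj V E) {1..3} a b c"
      using \<open>cond_a\<close> unfolding cond_a_def ex_pentagon_iff[OF G] by blast
    then obtain t a b c where t: "t \<ge> 3" "pentagon_graph (radj V E) a b c {1..t}"
      using ex_pentagon_graph[OF G F] \<open>cond_a\<close> unfolding cond_a_def by metis
    from ex_blueprint[OF t(2)] obtain j A B C F X Y U
      where "blueprint (radj V E) {1..t} j A B C F X Y U" by (elim exE)
    then interpret blueprint_E V E t j A B C F X Y U using G t(1) by unfold_locales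
    show cond_c
      unfolding cond_c_def using basket_villa_or_mansion universal by blast
  qed
  ultimately show ?thesis using bc by blast
qed

end
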